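(* Fix $s\in\mathbb{C}$ and let $\mathcal{E}_s$ be the complex vector space of functions on $(\mathbb{R}\setminus\mathbb{Z})\times(\mathbb{R}\setminus\mathbb{Z})$ spanned by $L^{\pm}(s,a,c)$ and $e^{-2\pi i a c}L^{\pm}(1-s,1-c,a)$. The functions in $\mathcal{E}_s$ are real-analytic functions of $(a,c)$ on $(\mathbb{R}\setminus\mathbb{Z})\times(\mathbb{R}\setminus\mathbb{Z})$, and: (i) every $F\in\mathcal{E}_s$ satisfies $F(a+1,c)=F(a,c)$ and $F(a,c+1)=e^{-2\pi i a}F(a,c)$; (ii)(a) if $\Re(s)>0$, then for each noninteger $c$ every $F\in\mathcal{E}_s$ has $f_c(a):=F(a,c)\in L^1[(0,1),da]$, and all Fourier coefficients $f_n(c)=\int_0^1F(a,c)e^{-2\pi i n a}\,da$, $n\in\mathbb{Z}$, are continuous functions of $c$ on $0<c<1$; (b) if $\Re(s)<1$, then for each noninteger $a$ every $F\in\mathcal{E}_s$ has $g_a(c):=e^{2\pi i a c}F(a,c)\in L^1[(0,1),dc]$, and all Fourier coefficients $g_n(a)=\int_0^1e^{2\pi i a c}F(a,c)e^{-2\pi i n c}\,dc$, $n\in\mathbb{Z}$, are continuous functions of $a$ on $0<a<1$; (c) if $0<\Re(s)<1$, then every function in $\mathcal{E}_s$ belongs to $L^1(\Box,da\,dc)$, where $\Box=[0,1]^2$, and $\mathcal{E}_s$ is invariant under all four families $\{{\rm T}_m\},\{{\rm S}_m\},\{{\rm T}_m^\vee\},\{{\rm S}_m^\vee\}$ ($m\ge1$)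 of two-variable Hecke operators.
   Context: For real $a,c\notin\mathbb{Z}$ and $\Re(s)>0$, $L^{+}(s,a,c)=\sum_{n\in\mathbb{Z}}e^{2\pi i n a}|n+c|^{-s}$ and $L^{-}(s,a,c)=\sum_{n\in\mathbb{Z}}\operatorname{sgn}(n+c)e^{2\pi i n a}|n+c|^{-s}$ (limits of symmetric partial sums); for fixed such $(a,c)$ these continue analytically to entire functions of $s$, used for all $s$. The Hecke operators are ${\rm T}_m f(a,c)=\frac1m\sum_{k=0}^{m-1}f(\frac{a+k}{m},mc)$, ${\rm S}_m f(a,c)=\frac1m\sum_{k=0}^{m-1}e^{2\pi i k a}f(ma,\frac{c+k}{m})$, ${\rm T}_m^\vee f(a,c)=\frac1m\sum_{k=0}^{m-1}e^{2\pi i\frac{(1-m)a+k}{m}}f(\frac{a+k}{m},1+m(c-1))$, ${\rm S}_m^\vee f(a,c)=\frac1m\sum_{k=0}^{m-1}e^{2\pi i(m-(k+1))a}f(1+m(a-1),\frac{c+m-(k+1)}{m})$, applied to functions on $\mathbb{R}\times\mathbb{R}$ (defined off integer grid lines). *)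

theory Defs
  imports "HOL-Complex_Analysis.Complex_Analysis" "HOL-Library.Function_Algebras"
begin

abbreviation e2pi :: "real \<Rightarrow> complex" where
  "e2pi x \<equiv> cis (2 * pi * x)"


subsection \<open>The functions $L^{\pm}(s,a,c)$\<close>

definition Lplus_partial :: "nat \<Rightarrow> complex \<Rightarrow> real \<Rightarrow> real \<Rightarrow> complex" where
  "Lplus_partial N s a c =
     (\<Sum>n\<in>{- int N..int N}. e2pi (of_int n * a) * of_real \<bar>of_int n + c\<bar> powr (- s))"

definition Lminus_partial :: "nat \<Rightarrow> complex \<Rightarrow> real \<Rightarrow> real \<Rightarrow> complex" where
  "Lminus_partial N s a c =
     (\<Sum>n\<in>{- int N..int N}. of_real (sgn (of_int n + c)) * e2pi (of_int n * a)
                               * of_real \<bar>of_int n + c\<bar> powr (- s))"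

text \<open>
  For nonintegral \<open>a\<close>, \<open>c\<close> the function of \<open>s\<close> is the entire function that extends the limit of
  the symmetric partial sums, which exists on the half plane \<open>Re s > 0\<close>; by the identity theorem
  there is at most one such entire function. The value is unspecified if \<open>a\<close> or \<open>c\<close> is an integer.
\<close>

definition Lplus :: "complex \<Rightarrow> real \<Rightarrow> real \<Rightarrow> complex" where
  "Lplus s a c =
     (THE f. f holomorphic_on UNIV \<and>
        (\<forall>z. Re z > 0 \<longrightarrow> (\<lambda>N. Lplus_partial N z a c) \<longlonglongrightarrow> f z)) s"

definition Lminus :: "complex \<Rightarrow> real \<Rightarrow> real \<Rightarrow> complex" where
  "Lminus s a c =
     (THE f. f holomorphic_on UNIV \<and>
        (\<forall>z. Re z > 0 \<longrightarrow> (\<lambda>N. Lminus_partial N z a c) \<longlonglongrightarrow> f z)) s"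


subsection \<open>The vector space $\mathcal{E}_s$\<close>

definition offgrid :: "(real \<times> real) set" where
  "offgrid = (- \<int>) \<times> (- \<int>)"

text \<open>
  A function on \<^const>\<open>offgrid\<close> is represented by its extension by zero to the whole plane, so that
  equality of such functions is equality on \<^const>\<open>offgrid\<close>.
\<close>

definition on_offgrid :: "(real \<times> real \<Rightarrow> complex) \<Rightarrow> real \<times> real \<Rightarrow> complex" where
  "on_offgrid f = (\<lambda>p. if p \<in> offgrid then f p else 0)"

definition fun_scale :: "complex \<Rightarrow> (real \<times> real \<Rightarrow> complex) \<Rightarrow> real \<times> real \<Rightarrow> complex" where
  "fun_scale z f = (\<lambda>p. z * f p)"

lemma vector_space_fun_scale: "vector_space fun_scale"
  by unfold_locales (auto simp: fun_scale_def fun_eq_iff algebra_simps)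

definition lerch_space :: "complex \<Rightarrow> (real \<times> real \<Rightarrow> complex) set" where
  "lerch_space s = module.span fun_scale
     {on_offgrid (\<lambda>(a, c). Lplus s a c),
      on_offgrid (\<lambda>(a, c). Lminus s a c),
      on_offgrid (\<lambda>(a, c). e2pi (- (a * c)) * Lplus (1 - s) (1 - c) a),
      on_offgrid (\<lambda>(a, c). e2pi (- (a * c)) * Lminus (1 - s) (1 - c) a)}"


subsection \<open>Real-analytic functions of two real variables\<close>

text \<open>
  Intended for open \<open>S\<close>: near each point of \<open>S\<close> the function is the sum of a double power series
  (for complex-valued families, \<open>has_sum\<close> is absolute convergence).
\<close>

definition real_analytic2_on :: "(real \<times> real \<Rightarrow> complex) \<Rightarrow> (real \<times> real) set \<Rightarrow> bool" where
  "real_analytic2_on f S \<longleftrightarrow>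
     (\<forall>(x0, y0)\<in>S. \<exists>A :: nat \<Rightarrow> nat \<Rightarrow> complex. \<exists>\<epsilon>>0. \<forall>x y. \<bar>x - x0\<bar> < \<epsilon> \<and> \<bar>y - y0\<bar> < \<epsilon> \<longrightarrow>
        ((\<lambda>(j, k). A j k * of_real (x - x0) ^ j * of_real (y - y0) ^ k) has_sum f (x, y)) UNIV)"


subsection \<open>Two-variable Hecke operators\<close>

definition hecke_T :: "nat \<Rightarrow> (real \<times> real \<Rightarrow> complex) \<Rightarrow> real \<times> real \<Rightarrow> complex" where
  "hecke_T m f = (\<lambda>(a, c). 1 / of_nat m *
     (\<Sum>k<m. f ((a + of_nat k) / of_nat m, of_nat m * c)))"

definition hecke_S :: "nat \<Rightarrow> (real \<times> real \<Rightarrow> complex) \<Rightarrow> real \<times> real \<Rightarrow> complex" where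
  "hecke_S m f = (\<lambda>(a, c). 1 / of_nat m *
     (\<Sum>k<m. e2pi (of_nat k * a) * f (of_nat m * a, (c + of_nat k) / of_nat m)))"

definition hecke_T_dual :: "nat \<Rightarrow> (real \<times> real \<Rightarrow> complex) \<Rightarrow> real \<times> real \<Rightarrow> complex" where
  "hecke_T_dual m f = (\<lambda>(a, c). 1 / of_nat m *
     (\<Sum>k<m. e2pi (((1 - of_nat m) * a + of_nat k) / of_nat m)
              * f ((a + of_nat k) / of_nat m, 1 + of_nat m * (c - 1))))"

definition hecke_S_dual :: "nat \<Rightarrow> (real \<times> real \<Rightarrow> complex) \<Rightarrow> real \<times> real \<Rightarrow> complex" where
  "hecke_S_dual m f = (\<lambda>(a, c). 1 / of_nat m *
     (\<Sum>k<m. e2pi ((of_nat m - (of_nat k + 1)) * a)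
              * f (1 + of_nat m * (a - 1), (c + of_nat m - (of_nat k + 1)) / of_nat m)))"

text \<open>
  For \<open>f\<close> defined on \<^const>\<open>offgrid\<close>, \<open>hecke_T m f\<close> and \<open>hecke_T_dual m f\<close> are defined at exactly the
  points of \<open>T_domain m\<close>, where all the evaluation points lie in \<^const>\<open>offgrid\<close>; likewise \<open>S_domain m\<close>
  for \<open>hecke_S m f\<close> and \<open>hecke_S_dual m f\<close>. These sets are \<^const>\<open>offgrid\<close> minus further grid lines.
\<close>

definition T_domain :: "nat \<Rightarrow> (real \<times> real) set" where
  "T_domain m = {(a, c). a \<notin> \<int> \<and> of_nat m * c \<notin> \<int>}"

definition S_domain :: "nat \<Rightarrow> (real \<times> real) set" where
  "S_domain m = {(a, c). of_nat m * a \<notin> \<int> \<and> c \<notin> \<int>}"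

text \<open>
  A transform, defined on a dense open subset \<open>D\<close> of \<^const>\<open>offgrid\<close>, is identified with a member of
  the space if it agrees with that member on \<open>D\<close>; as the members of \<^const>\<open>lerch_space\<close> are
  continuous on \<^const>\<open>offgrid\<close>, there is at most one.
\<close>

definition invariant_under ::
  "(real \<times> real \<Rightarrow> complex) set \<Rightarrow> ((real \<times> real \<Rightarrow> complex) \<Rightarrow> real \<times> real \<Rightarrow> complex)
     \<Rightarrow> (real \<times> real) set \<Rightarrow> bool" where
  "invariant_under V H D \<longleftrightarrow> (\<forall>F\<in>V. \<exists>G\<in>V. \<forall>p\<in>D. H F p = G p)"

end

theory Submission
  imports Defs
begin

text \<open>
  Summing against the kernel \<open>exp (2 \<pi> \<i> a z) / (exp (2 \<pi> \<i> z) - 1)\<close>, which decays exponentially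
  in both vertical directions when \<open>0 < a < 1\<close>, turns \<open>\<Sum>n\<ge>0. exp (2 \<pi> \<i> n a) (n + c) powr (- s)\<close>
  into one integral over a vertical line that converges absolutely for every complex \<open>s\<close>. It is
  entire in \<open>s\<close>, its integrand has dominated power series in \<open>a\<close> and \<open>c\<close>, and the bound
  \<open>O((a \<bar>y\<bar>) powr (- \<tau>) + ((1 - a) \<bar>y\<bar>) powr (- \<tau>))\<close> for the kernel at height \<open>y\<close>, with
  \<open>\<tau> < 1 < \<tau> + Re s\<close>, makes it integrable in \<open>a\<close> when \<open>Re s > 0\<close>. So the functional equation
  between \<open>s\<close> and \<open>1 - s\<close> plays no role. For \<open>0 < Re s < 1\<close> both \<open>s\<close> and \<open>1 - s\<close> lie in the half
  plane of convergence; orthogonality of characters and splitting into residue classes modulo \<open>m\<close>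
  show that the whole space consists of eigenfunctions, with eigenvalue \<open>m powr (- s)\<close> of \<open>T\<^sub>m\<close>
  and \<open>m powr (s - 1)\<close> of \<open>S\<^sub>m\<close>. By quasi-periodicity the dual operators act on it as \<open>T\<^sub>m\<close>
  and \<open>S\<^sub>m\<close>.
\<close>

subsection \<open>Real-analytic functions of two real variables\<close>

text \<open>Two features of the definitions shape the argument. \<open>Lplus\<close> and
  \<open>Lminus\<close> are values of an entire function characterised by its limits on
  \<open>Re s > 0\<close>, so an explicit entire candidate must exist before anything can be said at
  a given \<open>s\<close>. And symmetric partial sums are too rigid for the Hecke operators, which
  stretch the range of summation by \<open>m\<close>; convergence is therefore proved for all ranges
  whose two ends go to infinity independently. The candidate comes from the residue exp(2 pi i n a)
  (n + c)^(-s) / (2 pi i) of the summand at n. Only one residue is taken at a time: moving the line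
  by 1 peels off one term, and iterating this recurrence gives the series. On lines with
  half-integral real part exp(2 pi i z) is negative, so the kernel has no pole there and is, apart
  from a phase, a positive function of the height. The dual generators use (1 - c, a) and 1 - s.
  This exchange turns \<open>hecke_T m\<close> into \<open>hecke_S m\<close> and back, and
  m^((1-s)-1) = m^(-s), which is why both kinds of generators share their eigenvalues.\<close>

lemma has_sum_mult_Times:
  fixes f :: "'a \<Rightarrow> complex" and g :: "'b \<Rightarrow> complex"
  assumes "(f has_sum a) A" "(g has_sum b) B"
  shows "((\<lambda>(x, y). f x * g y) has_sum a * b) (A \<times> B)"
proof (rule has_sum_SigmaI)
  show "((\<lambda>y. case (x, y) of (x, y) \<Rightarrow> f x * g y) has_sum f x * b) B" for x
    using has_sum_cmult_right[OF assms(2)] by simp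
  show "((\<lambda>x. f x * b) has_sum a * b) A"
    using has_sum_cmult_left[OF assms(1)] .
  have f: "(\<lambda>x. norm (f x)) summable_on A" and g: "(\<lambda>x. norm (g x)) summable_on B"
    using assms summable_on_iff_abs_summable_on_complex has_sum_imp_summable by blast+
  have "(\<lambda>p. norm (f (fst p) * g (snd p))) summable_on A \<times> B"
  proof (subst Infinite_Sum.abs_summable_on_Sigma_iff, intro conjI ballI)
    show "(\<lambda>y. norm (f (fst (x, y)) * g (snd (x, y)))) summable_on B" for x
      using summable_on_cmult_right[OF g, of "norm (f x)"] by (simp add: norm_mult)
    show "(\<lambda>x. norm (\<Sum>\<^sub>\<infinity>y\<in>B. norm (f (fst (x, y)) * g (snd (x, y))))) summable_on A"
      using summable_on_cmult_left[OF f, of "\<Sum>\<^sub>\<infinity>y\<in>B. norm (g y)"]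
      by (simp add: norm_mult infsum_cmult_right' infsum_nonneg abs_mult)
  qed
  then show "(\<lambda>(x, y). f x * g y) summable_on A \<times> B"
    using Infinite_Sum.abs_summable_summable by (simp add: case_prod_unfold)
qed

lemma real_analytic2_onI:
  assumes "\<And>x0 y0. (x0, y0) \<in> S \<Longrightarrow> \<exists>A \<epsilon>. \<epsilon> > 0 \<and> (\<forall>x y. \<bar>x - x0\<bar> < \<epsilon> \<and> \<bar>y - y0\<bar> < \<epsilon> \<longrightarrow>
        ((\<lambda>(j, k). A j k * of_real (x - x0) ^ j * of_real (y - y0) ^ k) has_sum f (x, y)) UNIV)"
  shows "real_analytic2_on f S"
  unfolding real_analytic2_on_def by (clarify, drule assms) blast

lemma real_analytic2_onE:
  assumes "real_analytic2_on f S" "(x0, y0) \<in> S"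
  obtains A \<epsilon> where "\<epsilon> > 0" "\<And>x y. \<bar>x - x0\<bar> < \<epsilon> \<Longrightarrow> \<bar>y - y0\<bar> < \<epsilon> \<Longrightarrow>
        ((\<lambda>(j, k). A j k * of_real (x - x0) ^ j * of_real (y - y0) ^ k) has_sum f (x, y)) UNIV"
  using assms unfolding real_analytic2_on_def by fast

lemma real_analytic2_on_subset: "real_analytic2_on f T \<Longrightarrow> S \<subseteq> T \<Longrightarrow> real_analytic2_on f S"
  unfolding real_analytic2_on_def by blast

lemma real_analytic2_on_add:
  assumes "real_analytic2_on f S" "real_analytic2_on g S"
  shows "real_analytic2_on (\<lambda>p. f p + g p) S"
proof (rule real_analytic2_onI)
  fix x0 y0 assume p: "(x0, y0) \<in> S"
  obtain A \<epsilon> where A: "\<epsilon> > 0" "\<And>x y. \<bar>x - x0\<bar> < \<epsilon> \<Longrightarrow> \<bar>y - y0\<bar> < \<epsilon> \<Longrightarrow>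
        ((\<lambda>(j, k). A j k * of_real (x - x0) ^ j * of_real (y - y0) ^ k) has_sum f (x, y)) UNIV"
    by (rule real_analytic2_onE[OF assms(1) p]) blast
  obtain B \<delta> where B: "\<delta> > 0" "\<And>x y. \<bar>x - x0\<bar> < \<delta> \<Longrightarrow> \<bar>y - y0\<bar> < \<delta> \<Longrightarrow>
        ((\<lambda>(j, k). B j k * of_real (x - x0) ^ j * of_real (y - y0) ^ k) has_sum g (x, y)) UNIV"
    by (rule real_analytic2_onE[OF assms(2) p]) blast
  show "\<exists>A \<epsilon>. \<epsilon> > 0 \<and> (\<forall>x y. \<bar>x - x0\<bar> < \<epsilon> \<and> \<bar>y - y0\<bar> < \<epsilon> \<longrightarrow>
        ((\<lambda>(j, k). A j k * of_real (x - x0) ^ j * of_real (y - y0) ^ k) has_sum f (x, y) + g (x, y)) UNIV)"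
  proof (intro exI conjI allI impI)
    show "min \<epsilon> \<delta> > 0" using A B by simp
    fix x y assume xy: "\<bar>x - x0\<bar> < min \<epsilon> \<delta> \<and> \<bar>y - y0\<bar> < min \<epsilon> \<delta>"
    define u v where "u = complex_of_real (x - x0)" and "v = complex_of_real (y - y0)"
    have "((\<lambda>p. (case p of (j, k) \<Rightarrow> A j k * u ^ j * v ^ k) + (case p of (j, k) \<Rightarrow> B j k * u ^ j * v ^ k))
        has_sum f (x, y) + g (x, y)) UNIV"
      unfolding u_def v_def using xy A B by (intro has_sum_add) auto
    then have "((\<lambda>(j, k). (A j k + B j k) * u ^ j * v ^ k) has_sum f (x, y) + g (x, y)) UNIV"
      by (simp add: case_prod_unfold distrib_right)
    then show "((\<lambda>(j, k). (A j k + B j k) * of_real (x - x0) ^ j * of_real (y - y0) ^ k) has_sum f (x, y) + g (x, y)) UNIV"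
      by (simp only: u_def v_def)
  qed
qed

lemma real_analytic2_on_mult:
  assumes "real_analytic2_on f S" "real_analytic2_on g S"
  shows "real_analytic2_on (\<lambda>p. f p * g p) S"
proof (rule real_analytic2_onI)
  fix x0 y0 assume p: "(x0, y0) \<in> S"
  obtain A \<epsilon> where A: "\<epsilon> > 0" "\<And>x y. \<bar>x - x0\<bar> < \<epsilon> \<Longrightarrow> \<bar>y - y0\<bar> < \<epsilon> \<Longrightarrow>
        ((\<lambda>(j, k). A j k * of_real (x - x0) ^ j * of_real (y - y0) ^ k) has_sum f (x, y)) UNIV"
    by (rule real_analytic2_onE[OF assms(1) p]) blast
  obtain B \<delta> where B: "\<delta> > 0" "\<And>x y. \<bar>x - x0\<bar> < \<delta> \<Longrightarrow> \<bar>y - y0\<bar> < \<delta> \<Longrightarrow>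
        ((\<lambda>(j, k). B j k * of_real (x - x0) ^ j * of_real (y - y0) ^ k) has_sum g (x, y)) UNIV"
    by (rule real_analytic2_onE[OF assms(2) p]) blast
  \<comment> \<open>Two-dimensional Cauchy product: the coefficient of bidegree (j, k) collects all
    splittings into (i, l) and (j - i, k - l).\<close>
  define C where "C = (\<lambda>j k. \<Sum>(i, l)\<in>{..j} \<times> {..k}. A i l * B (j - i) (k - l))"
  show "\<exists>A \<epsilon>. \<epsilon> > 0 \<and> (\<forall>x y. \<bar>x - x0\<bar> < \<epsilon> \<and> \<bar>y - y0\<bar> < \<epsilon> \<longrightarrow>
        ((\<lambda>(j, k). A j k * of_real (x - x0) ^ j * of_real (y - y0) ^ k) has_sum f (x, y) * g (x, y)) UNIV)"
  proof (intro exI conjI allI impI)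
    show "min \<epsilon> \<delta> > 0" using A B by simp
    fix x y assume xy: "\<bar>x - x0\<bar> < min \<epsilon> \<delta> \<and> \<bar>y - y0\<bar> < min \<epsilon> \<delta>"
    define u v where "u = complex_of_real (x - x0)" and "v = complex_of_real (y - y0)"
    have "((\<lambda>(p, q). (case p of (j, k) \<Rightarrow> A j k * u ^ j * v ^ k) * (case q of (j, k) \<Rightarrow> B j k * u ^ j * v ^ k))
        has_sum f (x, y) * g (x, y)) (UNIV \<times> UNIV)"
      unfolding u_def v_def using xy A B by (intro has_sum_mult_Times) auto
    \<comment> \<open>Pairs of monomials are indexed by their total bidegree together with the
      bidegree of the first factor; on this index set the subtractions of natural numbers are
      exact.\<close>
    also have "?this \<longleftrightarrow> ((\<lambda>((j, k), i, l). A i l * B (j - i) (k - l) * u ^ j * v ^ k)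
        has_sum f (x, y) * g (x, y)) (SIGMA (j, k):UNIV. {..j} \<times> {..k})"
      by (rule has_sum_reindex_bij_witness
          [where j = "\<lambda>((i, l), (i', l')). ((i + i', l + l'), (i, l))"
             and i = "\<lambda>((j, k), i, l). ((i, l), (j - i, k - l))"])
         (auto simp: power_add)
    finally have "((\<lambda>(j, k). C j k * u ^ j * v ^ k) has_sum f (x, y) * g (x, y)) UNIV"
    proof (rule has_sum_Sigma')
      fix p :: "nat \<times> nat"
      obtain j k where p: "p = (j, k)" by (cases p)
      show "((\<lambda>q. (\<lambda>((j, k), i, l). A i l * B (j - i) (k - l) * u ^ j * v ^ k) (p, q))
          has_sum (case p of (j, k) \<Rightarrow> C j k * u ^ j * v ^ k)) (case p of (j, k) \<Rightarrow> {..j} \<times> {..k})"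
        by (rule has_sum_finiteI) (auto simp: p C_def sum_distrib_right case_prod_unfold)
    qed
    then show "((\<lambda>(j, k). C j k * of_real (x - x0) ^ j * of_real (y - y0) ^ k) has_sum f (x, y) * g (x, y)) UNIV"
      by (simp only: u_def v_def)
  qed
qed

lemma real_analytic2_on_swap:
  assumes "real_analytic2_on f T" "\<And>x y. (x, y) \<in> S \<Longrightarrow> (y, x) \<in> T"
  shows "real_analytic2_on (\<lambda>(x, y). f (y, x)) S"
proof (rule real_analytic2_onI)
  fix x0 y0 assume "(x0, y0) \<in> S"
  then have p: "(y0, x0) \<in> T" by (rule assms(2))
  obtain A \<epsilon> where A: "\<epsilon> > 0" "\<And>x y. \<bar>x - y0\<bar> < \<epsilon> \<Longrightarrow> \<bar>y - x0\<bar> < \<epsilon> \<Longrightarrow>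
        ((\<lambda>(j, k). A j k * of_real (x - y0) ^ j * of_real (y - x0) ^ k) has_sum f (x, y)) UNIV"
    by (rule real_analytic2_onE[OF assms(1) p]) blast
  show "\<exists>A \<epsilon>. \<epsilon> > 0 \<and> (\<forall>x y. \<bar>x - x0\<bar> < \<epsilon> \<and> \<bar>y - y0\<bar> < \<epsilon> \<longrightarrow>
        ((\<lambda>(j, k). A j k * of_real (x - x0) ^ j * of_real (y - y0) ^ k)
           has_sum (case (x, y) of (x, y) \<Rightarrow> f (y, x))) UNIV)"
  proof (intro exI conjI allI impI)
    fix x y assume "\<bar>x - x0\<bar> < \<epsilon> \<and> \<bar>y - y0\<bar> < \<epsilon>"
    then have "((\<lambda>(j, k). A j k * of_real (y - y0) ^ j * of_real (x - x0) ^ k) has_sum f (y, x)) (UNIV \<times> UNIV)"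
      using A(2)[of y x] by simp
    then have "((\<lambda>(k, j). A j k * of_real (y - y0) ^ j * of_real (x - x0) ^ k) has_sum f (y, x)) (UNIV \<times> UNIV)"
      by (subst (asm) has_sum_swap) simp
    then show "((\<lambda>(j, k). A k j * of_real (x - x0) ^ j * of_real (y - y0) ^ k)
        has_sum (case (x, y) of (x, y) \<Rightarrow> f (y, x))) UNIV"
      by (simp add: mult_ac)
  qed (rule A(1))
qed

text \<open>A factor of modulus one preserves the radius of the expansion. Translations and the
  reflection x -> 1 - x are the only affine substitutions in the construction.\<close>

lemma real_analytic2_on_affine_fst:
  fixes p q :: real
  assumes "real_analytic2_on f T" "\<And>x y. (x, y) \<in> S \<Longrightarrow> (p * x + q, y) \<in> T" "\<bar>p\<bar> = 1"
  shows "real_analytic2_on (\<lambda>(x, y). f (p * x + q, y)) S"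
proof (rule real_analytic2_onI)
  fix x0 y0 assume "(x0, y0) \<in> S"
  then have p: "(p * x0 + q, y0) \<in> T" by (rule assms(2))
  obtain A \<epsilon> where A: "\<epsilon> > 0" "\<And>x y. \<bar>x - (p * x0 + q)\<bar> < \<epsilon> \<Longrightarrow> \<bar>y - y0\<bar> < \<epsilon> \<Longrightarrow>
        ((\<lambda>(j, k). A j k * of_real (x - (p * x0 + q)) ^ j * of_real (y - y0) ^ k) has_sum f (x, y)) UNIV"
    by (rule real_analytic2_onE[OF assms(1) p]) blast
  show "\<exists>A \<epsilon>. \<epsilon> > 0 \<and> (\<forall>x y. \<bar>x - x0\<bar> < \<epsilon> \<and> \<bar>y - y0\<bar> < \<epsilon> \<longrightarrow>
        ((\<lambda>(j, k). A j k * of_real (x - x0) ^ j * of_real (y - y0) ^ k)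
           has_sum (case (x, y) of (x, y) \<Rightarrow> f (p * x + q, y))) UNIV)"
  proof (intro exI conjI allI impI)
    fix x y assume xy: "\<bar>x - x0\<bar> < \<epsilon> \<and> \<bar>y - y0\<bar> < \<epsilon>"
    have eq: "p * x + q - (p * x0 + q) = p * (x - x0)" by algebra
    show "((\<lambda>(j, k). (A j k * of_real p ^ j) * of_real (x - x0) ^ j * of_real (y - y0) ^ k)
        has_sum (case (x, y) of (x, y) \<Rightarrow> f (p * x + q, y))) UNIV"
      using A(2)[of "p * x + q" y] xy assms(3) unfolding eq
      by (simp add: abs_mult power_mult_distrib mult_ac)
  qed (rule A(1))
qed

text \<open>Agreement is demanded on an open set around \<open>S\<close>, since the expansion at a
  point of \<open>S\<close> speaks about nearby values, possibly outside \<open>S\<close>.\<close>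

lemma real_analytic2_on_cong:
  assumes "real_analytic2_on f S" "open T" "S \<subseteq> T" "\<And>p. p \<in> T \<Longrightarrow> f p = g p"
  shows "real_analytic2_on g S"
proof (rule real_analytic2_onI)
  fix x0 y0 assume p: "(x0, y0) \<in> S"
  obtain A \<epsilon> where A: "\<epsilon> > 0" "\<And>x y. \<bar>x - x0\<bar> < \<epsilon> \<Longrightarrow> \<bar>y - y0\<bar> < \<epsilon> \<Longrightarrow>
        ((\<lambda>(j, k). A j k * of_real (x - x0) ^ j * of_real (y - y0) ^ k) has_sum f (x, y)) UNIV"
    by (rule real_analytic2_onE[OF assms(1) p]) blast
  have "(x0, y0) \<in> T" using assms(3) p by blast
  then obtain d where d: "d > 0" "ball (x0, y0) d \<subseteq> T"
    using assms(2) open_contains_ball by blast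
  show "\<exists>A \<epsilon>. \<epsilon> > 0 \<and> (\<forall>x y. \<bar>x - x0\<bar> < \<epsilon> \<and> \<bar>y - y0\<bar> < \<epsilon> \<longrightarrow>
        ((\<lambda>(j, k). A j k * of_real (x - x0) ^ j * of_real (y - y0) ^ k) has_sum g (x, y)) UNIV)"
  proof (intro exI conjI allI impI)
    show "min \<epsilon> (d/2) > 0" using A d by simp
    fix x y assume xy: "\<bar>x - x0\<bar> < min \<epsilon> (d/2) \<and> \<bar>y - y0\<bar> < min \<epsilon> (d/2)"
    have "dist (x, y) (x0, y0) \<le> \<bar>x - x0\<bar> + \<bar>y - y0\<bar>"
      using sqrt_sum_squares_le_sum_abs[of "x - x0" "y - y0"] by (simp add: dist_Pair_Pair dist_real_def)
    then have "(x, y) \<in> ball (x0, y0) d" using xy by (simp add: dist_commute)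
    then have "(x, y) \<in> T" using d(2) by blast
    then show "((\<lambda>(j, k). A j k * of_real (x - x0) ^ j * of_real (y - y0) ^ k) has_sum g (x, y)) UNIV"
      using A(2)[of x y] xy assms(4) by auto
  qed
qed

text \<open>The Taylor series in one variable is read as a double series supported on
  \<open>k = 0\<close>.\<close>

lemma real_analytic2_on_fst:
  assumes "open T" "h holomorphic_on T" "\<And>x y. (x, y) \<in> S \<Longrightarrow> complex_of_real x \<in> T"
  shows "real_analytic2_on (\<lambda>(x, y). h (of_real x)) S"
proof (rule real_analytic2_onI)
  fix x0 y0 assume "(x0, y0) \<in> S"
  then have "complex_of_real x0 \<in> T" by (rule assms(3))
  then obtain r where r: "r > 0" "ball (complex_of_real x0) r \<subseteq> T"
    using assms(1) by (meson open_contains_ball)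
  have h: "h holomorphic_on ball (complex_of_real x0) r"
    using assms(2) r holomorphic_on_subset by blast
  define a where "a = (\<lambda>n. (deriv ^^ n) h (of_real x0) / fact n)"
  show "\<exists>A \<epsilon>. \<epsilon> > 0 \<and> (\<forall>x y. \<bar>x - x0\<bar> < \<epsilon> \<and> \<bar>y - y0\<bar> < \<epsilon> \<longrightarrow>
        ((\<lambda>(j, k). A j k * of_real (x - x0) ^ j * of_real (y - y0) ^ k)
           has_sum (case (x, y) of (x, y) \<Rightarrow> h (of_real x))) UNIV)"
  proof (intro exI conjI allI impI)
    fix x y assume xy: "\<bar>x - x0\<bar> < r \<and> \<bar>y - y0\<bar> < r"
    have sums: "(\<lambda>n. a n * z ^ n) sums h (of_real x0 + z)" if "norm z < r" for z
      using holomorphic_power_series[OF h, of "of_real x0 + z"] that by (simp add: dist_norm a_def)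
    \<comment> \<open>Convergence at the larger radius \<open>r'\<close> yields the absolute
      convergence at \<open>x - x0\<close> that \<open>has_sum\<close> requires.\<close>
    obtain r' where r': "\<bar>x - x0\<bar> < r'" "r' < r" using xy dense by blast
    have "summable (\<lambda>n. norm (a n * of_real (x - x0) ^ n))"
      by (rule powser_insidea[where x = "of_real r'"])
         (use sums[of "of_real r'"] r' in \<open>auto simp: sums_iff simp del: of_real_diff\<close>)
    moreover have "(\<lambda>n. a n * of_real (x - x0) ^ n) sums h (of_real x)"
      using sums[of "of_real (x - x0)"] xy by (simp only: norm_of_real) simp
    ultimately have "((\<lambda>n. a n * of_real (x - x0) ^ n) has_sum h (of_real x)) UNIV"
      by (rule norm_summable_imp_has_sum)
    then have "((\<lambda>(j, k). a j * of_real (x - x0) ^ j) has_sum h (of_real x)) (UNIV \<times> {0::nat})"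
      by (subst has_sum_reindex_bij_witness[where j = fst and i = "\<lambda>j. (j, 0)" and h = "\<lambda>n. a n * of_real (x - x0) ^ n" and T = UNIV]) auto
    then show "((\<lambda>(j, k). (if k = 0 then a j else 0) * of_real (x - x0) ^ j * of_real (y - y0) ^ k)
           has_sum (case (x, y) of (x, y) \<Rightarrow> h (of_real x))) UNIV"
      by (subst (asm) has_sum_cong_neutral[where T = UNIV and g = "\<lambda>(j, k). (if k = 0 then a j else 0) * of_real (x - x0) ^ j * of_real (y - y0) ^ k"])
         (auto split: if_splits)
  qed (rule r(1))
qed

lemma real_analytic2_on_snd:
  assumes "open T" "h holomorphic_on T" "\<And>x y. (x, y) \<in> S \<Longrightarrow> complex_of_real y \<in> T"
  shows "real_analytic2_on (\<lambda>(x, y). h (of_real y)) S"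
  using real_analytic2_on_swap[OF real_analytic2_on_fst[OF assms(1,2)], of "prod.swap ` S" S] assms(3)
  by force

lemma real_analytic2_on_const: "real_analytic2_on (\<lambda>p. z) S"
  using real_analytic2_on_fst[of UNIV "\<lambda>_. z" S] by (simp add: case_prod_unfold)

text \<open>The twist exp(-2 pi i a c) of the dual generators depends on the product of the
  variables and is out of reach of the one-variable lemmas.\<close>

lemma real_analytic2_on_exp_mult:
  "real_analytic2_on (\<lambda>(x, y). exp (z * of_real x * of_real y)) S"
proof (rule real_analytic2_onI)
  fix x0 y0
  text \<open>\<open>x y = x0 y + y0 x - x0 y0 + (x - x0) (y - y0)\<close>, and the last term contributes a diagonal series.\<close>
  have "real_analytic2_on (\<lambda>(x, y). exp (z * of_real ((x - x0) * (y - y0)))) {(x0, y0)}"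
  proof (rule real_analytic2_onI)
    fix x1 y1 assume "(x1, y1) \<in> {(x0, y0)}"
    then have [simp]: "x1 = x0" "y1 = y0" by auto
    show "\<exists>A \<epsilon>. \<epsilon> > 0 \<and> (\<forall>x y. \<bar>x - x1\<bar> < \<epsilon> \<and> \<bar>y - y1\<bar> < \<epsilon> \<longrightarrow>
        ((\<lambda>(j, k). A j k * of_real (x - x1) ^ j * of_real (y - y1) ^ k)
           has_sum (case (x, y) of (x, y) \<Rightarrow> exp (z * of_real ((x - x0) * (y - y0))))) UNIV)"
    proof (intro exI conjI allI impI)
      fix x y
      let ?w = "z * of_real ((x - x0) * (y - y0))"
      have "((\<lambda>n. ?w ^ n /\<^sub>R fact n) has_sum exp ?w) UNIV"
        using summable_norm_exp[of ?w] exp_converges[of ?w] by (rule norm_summable_imp_has_sum)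
      then have "((\<lambda>(j, k). ?w ^ j /\<^sub>R fact j) has_sum exp ?w) (range (\<lambda>n. (n, n)))"
        by (subst has_sum_reindex) (auto simp: inj_on_def o_def)
      then show "((\<lambda>(j, k). (if j = k then z ^ j / fact j else 0) * of_real (x - x1) ^ j * of_real (y - y1) ^ k)
           has_sum (case (x, y) of (x, y) \<Rightarrow> exp (z * of_real ((x - x0) * (y - y0))))) UNIV"
        by (subst (asm) has_sum_cong_neutral[where T = UNIV and g = "\<lambda>(j, k). (if j = k then z ^ j / fact j else 0) * of_real (x - x0) ^ j * of_real (y - y0) ^ k"])
           (auto simp: power_mult_distrib scaleR_conv_of_real divide_simps simp del: of_real_diff)
    qed (rule zero_less_one)
  qed
  moreover have "real_analytic2_on (\<lambda>(x, y). exp (z * of_real y0 * (of_real x - of_real x0))) {(x0, y0)}"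
    by (rule real_analytic2_on_fst[where T = UNIV]) (auto intro!: holomorphic_intros)
  moreover have "real_analytic2_on (\<lambda>(x, y). exp (z * of_real x0 * of_real y)) {(x0, y0)}"
    by (rule real_analytic2_on_snd[where T = UNIV]) (auto intro!: holomorphic_intros)
  ultimately have "real_analytic2_on (\<lambda>p. (case p of (x, y) \<Rightarrow> exp (z * of_real ((x - x0) * (y - y0)))) *
      ((case p of (x, y) \<Rightarrow> exp (z * of_real y0 * (of_real x - of_real x0))) *
       (case p of (x, y) \<Rightarrow> exp (z * of_real x0 * of_real y)))) {(x0, y0)}"
    by (intro real_analytic2_on_mult)
  also have "(\<lambda>p. (case p of (x, y) \<Rightarrow> exp (z * of_real ((x - x0) * (y - y0)))) *
      ((case p of (x, y) \<Rightarrow> exp (z * of_real y0 * (of_real x - of_real x0))) *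
       (case p of (x, y) \<Rightarrow> exp (z * of_real x0 * of_real y)))) = (\<lambda>(x, y). exp (z * of_real x * of_real y))"
    by (auto simp: fun_eq_iff algebra_simps simp flip: exp_add)
  finally show "\<exists>A \<epsilon>. \<epsilon> > 0 \<and> (\<forall>x y. \<bar>x - x0\<bar> < \<epsilon> \<and> \<bar>y - y0\<bar> < \<epsilon> \<longrightarrow>
        ((\<lambda>(j, k). A j k * of_real (x - x0) ^ j * of_real (y - y0) ^ k)
           has_sum (case (x, y) of (x, y) \<Rightarrow> exp (z * of_real x * of_real y))) UNIV)"
    unfolding real_analytic2_on_def by auto
qed

text \<open>Weierstrass M-test on the closed square of half the radius: absolute convergence at its
  corner supplies the majorant \<open>M\<close> for all of its points.\<close>

lemma real_analytic2_on_imp_continuous_on: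
  assumes "real_analytic2_on f S"
  shows "continuous_on S f"
proof (rule continuous_at_imp_continuous_on, safe)
  fix x0 y0 assume p: "(x0, y0) \<in> S"
  obtain A \<epsilon> where A: "\<epsilon> > 0" "\<And>x y. \<bar>x - x0\<bar> < \<epsilon> \<Longrightarrow> \<bar>y - y0\<bar> < \<epsilon> \<Longrightarrow>
        ((\<lambda>(j, k). A j k * of_real (x - x0) ^ j * of_real (y - y0) ^ k) has_sum f (x, y)) UNIV"
    by (rule real_analytic2_onE[OF assms p]) blast
  define B where "B = {x0 - \<epsilon>/2 .. x0 + \<epsilon>/2} \<times> {y0 - \<epsilon>/2 .. y0 + \<epsilon>/2}"
  define M where "M = (\<lambda>(j, k). norm (A j k) * (\<epsilon>/2) ^ j * (\<epsilon>/2) ^ k)"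
  have "(\<lambda>p. norm (case p of (j, k) \<Rightarrow> A j k * of_real (\<epsilon>/2) ^ j * of_real (\<epsilon>/2) ^ k)) summable_on UNIV"
    using A(2)[of "x0 + \<epsilon>/2" "y0 + \<epsilon>/2"] \<open>\<epsilon> > 0\<close>
    by (subst summable_on_iff_abs_summable_on_complex[symmetric]) (auto simp: has_sum_imp_summable)
  then have M: "M summable_on UNIV"
    using \<open>\<epsilon> > 0\<close> by (simp add: M_def case_prod_unfold norm_mult norm_power norm_divide)
  have "uniform_limit B (\<lambda>J q. \<Sum>(j, k)\<in>J. A j k * of_real (fst q - x0) ^ j * of_real (snd q - y0) ^ k)
     (\<lambda>q. \<Sum>\<^sub>\<infinity>(j, k)\<in>UNIV. A j k * of_real (fst q - x0) ^ j * of_real (snd q - y0) ^ k) (finite_subsets_at_top UNIV)"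
  proof (rule Weierstrass_m_test_general[OF _ M])
    fix p q assume q: "q \<in> B"
    then have "\<bar>fst q - x0\<bar> \<le> \<epsilon>/2" "\<bar>snd q - y0\<bar> \<le> \<epsilon>/2"
      unfolding B_def mem_Times_iff atLeastAtMost_iff by linarith+
    then show "norm (case p of (j, k) \<Rightarrow> A j k * of_real (fst q - x0) ^ j * of_real (snd q - y0) ^ k) \<le> M p"
      using \<open>\<epsilon> > 0\<close>
      by (auto simp: M_def case_prod_unfold norm_mult norm_power simp flip: of_real_diff intro!: mult_mono power_mono)
  qed
  then have "continuous_on B (\<lambda>q. \<Sum>\<^sub>\<infinity>(j, k)\<in>UNIV. A j k * of_real (fst q - x0) ^ j * of_real (snd q - y0) ^ k)"
  proof (rule uniform_limit_theorem[rotated])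
    show "\<forall>\<^sub>F J in finite_subsets_at_top UNIV. continuous_on B
        (\<lambda>q. \<Sum>(j, k)\<in>J. A j k * of_real (fst q - x0) ^ j * of_real (snd q - y0) ^ k)"
      unfolding case_prod_unfold by (intro always_eventually allI continuous_intros)
  qed simp
  moreover have "(\<Sum>\<^sub>\<infinity>(j, k)\<in>UNIV. A j k * of_real (fst q - x0) ^ j * of_real (snd q - y0) ^ k) = f q" if "q \<in> B" for q
    using A(2)[of "fst q" "snd q"] that \<open>\<epsilon> > 0\<close> by (intro infsumI) (auto simp: B_def abs_less_iff)
  ultimately have "continuous_on B f" by simp
  moreover have "(x0, y0) \<in> interior B"
    using \<open>\<epsilon> > 0\<close> by (simp add: B_def interior_Times)
  ultimately show "isCont f (x0, y0)"
    using continuous_on_interior by blast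
qed

subsection \<open>Integral estimates\<close>

text \<open>An enumeration \<open>h\<close> turns the unordered sum into a series, and one majorant
  for all finite sums of norms controls both the pointwise series and the series of integrals. It
  serves with \<open>id\<close> for power series in \<open>s\<close> and with
  \<open>prod_decode\<close> for double series in \<open>a\<close> and \<open>d\<close>.\<close>

lemma has_sum_integral_dominated:
  fixes f :: "'i \<Rightarrow> 'a \<Rightarrow> complex" and h :: "nat \<Rightarrow> 'i"
  assumes h: "bij h"
    and meas [measurable]: "\<And>i. f i \<in> borel_measurable M"
    and g: "integrable M g"
    and bound: "\<And>J x. finite J \<Longrightarrow> (\<Sum>i\<in>J. norm (f i x)) \<le> g x"
    and F: "\<And>x. ((\<lambda>i. f i x) has_sum F x) UNIV"
  shows "((\<lambda>i. \<integral>x. f i x \<partial>M) has_sum (\<integral>x. F x \<partial>M)) UNIV"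
proof -
  have inj: "inj h" and h': "bij_betw h UNIV UNIV" using h by (auto simp: bij_def)
  have part: "(\<Sum>n<N. norm (f (h n) x)) \<le> g x" for N x
    using bound[of "h ` {..<N}" x] sum.reindex[OF inj_on_subset[OF inj], of "{..<N}" "\<lambda>i. norm (f i x)"] by simp
  have int: "integrable M (f (h n))" for n
    by (rule Bochner_Integration.integrable_bound[OF g])
       (use bound[of "{h n}"] in \<open>auto intro!: AE_I2 order_trans[OF _ abs_ge_self]\<close>)
  have sum1: "summable (\<lambda>n. norm (f (h n) x))" for x
    using part by (intro summableI_nonneg_bounded[where x = "g x"]) auto
  have sum2: "summable (\<lambda>n. \<integral>x. norm (f (h n) x) \<partial>M)"
  proof (rule summableI_nonneg_bounded[where x = "\<integral>x. g x \<partial>M"])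
    fix N
    have "(\<Sum>n<N. \<integral>x. norm (f (h n) x) \<partial>M) = (\<integral>x. (\<Sum>n<N. norm (f (h n) x)) \<partial>M)"
      using int by (subst Bochner_Integration.integral_sum) auto
    also have "\<dots> \<le> (\<integral>x. g x \<partial>M)"
      using int part by (intro integral_mono g) auto
    finally show "(\<Sum>n<N. \<integral>x. norm (f (h n) x) \<partial>M) \<le> (\<integral>x. g x \<partial>M)" .
  qed simp
  have F': "(\<Sum>n. f (h n) x) = F x" for x
    using F[of x] has_sum_reindex_bij_betw[OF h', of "\<lambda>i. f i x" "F x"]
    by (metis has_sum_imp_sums sums_unique)
  have "(\<lambda>n. \<integral>x. f (h n) x \<partial>M) sums (\<integral>x. F x \<partial>M)"
    using sums_integral[of M "\<lambda>n. f (h n)", OF int _ sum2] sum1 by (simp add: F')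
  moreover have "summable (\<lambda>n. norm (\<integral>x. f (h n) x \<partial>M))"
    by (rule summable_comparison_test'[OF sum2]) (auto simp: integral_norm_bound)
  ultimately have "((\<lambda>n. \<integral>x. f (h n) x \<partial>M) has_sum (\<integral>x. F x \<partial>M)) UNIV"
    by (intro norm_summable_imp_has_sum)
  then show ?thesis
    using has_sum_reindex_bij_betw[OF h', of "\<lambda>i. \<integral>x. f i x \<partial>M"] by simp
qed

text \<open>After taking logarithms this is \<tau> ln x \<le> x. It trades the exponential decay of
  the kernel for a power, with constant 1.\<close>

lemma exp_minus_le_powr:
  fixes x \<tau> :: real
  assumes "x > 0" "0 \<le> \<tau>" "\<tau> \<le> 1"
  shows "exp (- x) \<le> x powr (- \<tau>)"
proof -
  have "\<tau> * ln x \<le> x"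
  proof (cases "x \<le> 1")
    case True
    then have "\<tau> * ln x \<le> 0" using assms by (intro mult_nonneg_nonpos) auto
    then show ?thesis using assms by linarith
  next
    case False
    then have "\<tau> * ln x \<le> 1 * ln x" using assms by (intro mult_right_mono) auto
    then show ?thesis using ln_le_minus_one[OF assms(1)] by linarith
  qed
  then show ?thesis using assms by (simp add: powr_def)
qed

text \<open>The hypotheses amount to |ln t - ln x| \<le> ln K; multiplying by p, of either sign,
  costs at most the factor \<open>K powr \<bar>p\<bar>\<close>.\<close>

lemma powr_le_powr_of_ratio:
  fixes K x t p :: real
  assumes "1 \<le> K" "0 < x" "x / K \<le> t" "t \<le> K * x"
  shows "t powr p \<le> K powr \<bar>p\<bar> * x powr p"
proof -
  have "x / K > 0" using assms by simp
  then have t: "t > 0" using assms(3) by linarith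
  have "ln (x / K) \<le> ln t" "ln t \<le> ln (K * x)"
    using ln_mono[OF assms(3)] ln_mono[OF assms(4)] t \<open>x / K > 0\<close> by blast+
  then have "\<bar>ln t - ln x\<bar> \<le> ln K" using assms by (simp add: ln_div ln_mult)
  then have "\<bar>p\<bar> * \<bar>ln t - ln x\<bar> \<le> \<bar>p\<bar> * ln K" by (intro mult_left_mono) auto
  moreover have "p * (ln t - ln x) \<le> \<bar>p\<bar> * \<bar>ln t - ln x\<bar>" by (metis abs_ge_self abs_mult)
  ultimately have "p * ln t \<le> \<bar>p\<bar> * ln K + p * ln x" by (simp add: algebra_simps)
  then show ?thesis using assms t by (simp add: powr_def flip: exp_add)
qed

lemma powr_le_exp:
  fixes \<mu> p :: real
  assumes "\<mu> > 0"
  obtains C where "C > 0" "\<And>y. (1 + \<bar>y\<bar>) powr p \<le> C * exp (\<mu> * \<bar>y\<bar>)"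
proof
  \<comment> \<open>This makes |p| \<epsilon> \<le> \<mu>, and the added 1 covers
    \<open>p = 0\<close>. The bound then comes from ln u \<le> u - 1 at u = \<epsilon> (1 +
    |y|).\<close>
  define \<epsilon> where "\<epsilon> = \<mu> / (\<bar>p\<bar> + 1)"
  have \<epsilon>: "\<epsilon> > 0" "\<bar>p\<bar> * \<epsilon> \<le> \<mu>" using assms by (auto simp: \<epsilon>_def divide_simps mult_ac)
  show "exp (\<mu> + \<bar>p\<bar> * \<bar>ln \<epsilon>\<bar>) > 0" by simp
  fix y :: real
  have "ln (\<epsilon> * (1 + \<bar>y\<bar>)) \<le> \<epsilon> * (1 + \<bar>y\<bar>) - 1" using \<epsilon> by (intro ln_le_minus_one) auto
  then have "ln (1 + \<bar>y\<bar>) \<le> \<epsilon> * (1 + \<bar>y\<bar>) + \<bar>ln \<epsilon>\<bar>" using \<epsilon> by (simp add: ln_mult_pos)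
  then have "\<bar>p\<bar> * ln (1 + \<bar>y\<bar>) \<le> \<bar>p\<bar> * (\<epsilon> * (1 + \<bar>y\<bar>) + \<bar>ln \<epsilon>\<bar>)" by (intro mult_left_mono) auto
  also have "\<dots> = \<bar>p\<bar> * \<epsilon> * (1 + \<bar>y\<bar>) + \<bar>p\<bar> * \<bar>ln \<epsilon>\<bar>" by (simp add: algebra_simps)
  also have "\<dots> \<le> \<mu> * (1 + \<bar>y\<bar>) + \<bar>p\<bar> * \<bar>ln \<epsilon>\<bar>" using \<epsilon> by (intro add_mono mult_right_mono) auto
  finally have "\<bar>p\<bar> * ln (1 + \<bar>y\<bar>) \<le> \<mu> * (1 + \<bar>y\<bar>) + \<bar>p\<bar> * \<bar>ln \<epsilon>\<bar>" .
  moreover have "p * ln (1 + \<bar>y\<bar>) \<le> \<bar>p\<bar> * ln (1 + \<bar>y\<bar>)" by (intro mult_right_mono) auto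
  ultimately show "(1 + \<bar>y\<bar>) powr p \<le> exp (\<mu> + \<bar>p\<bar> * \<bar>ln \<epsilon>\<bar>) * exp (\<mu> * \<bar>y\<bar>)"
    by (simp add: powr_def algebra_simps flip: exp_add)
qed

lemma integrable_lborel_abs:
  fixes f :: "real \<Rightarrow> real"
  assumes "set_integrable lborel {0..} f"
  shows "integrable lborel (\<lambda>y. f \<bar>y\<bar>)"
proof -
  have "set_integrable lborel {0..} (\<lambda>y. f \<bar>y\<bar>)"
    using assms by (rule set_integrable_cong[THEN iffD1, rotated 3]) auto
  moreover have "integrable lborel (\<lambda>y. indicat_real {0..} (0 + (-1) * y) *\<^sub>R f (0 + (-1) * y))"
    using assms unfolding set_integrable_def by (rule lborel_integrable_real_affine) simp
  then have "set_integrable lborel {..<0} (\<lambda>y. f \<bar>y\<bar>)"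
  proof -
    assume "integrable lborel (\<lambda>y. indicat_real {0..} (0 + (-1) * y) *\<^sub>R f (0 + (-1) * y))"
    then have "set_integrable lborel {..0} (\<lambda>y. f \<bar>y\<bar>)"
      unfolding set_integrable_def by (rule Bochner_Integration.integrable_cong[THEN iffD1, rotated 2])
         (auto simp: indicator_def)
    then show ?thesis by (rule set_integrable_subset) auto
  qed
  ultimately have "set_integrable lborel ({0..} \<union> {..<0}) (\<lambda>y. f \<bar>y\<bar>)"
    by (rule set_integrable_Un) auto
  moreover have "{0..} \<union> {..<0} = (UNIV :: real set)" by auto
  ultimately show ?thesis by (simp add: set_integrable_def)
qed

lemma set_integrable_lborel_nonneg:
  fixes f :: "real \<Rightarrow> real"
  assumes "f integrable_on S" "\<And>x. x \<in> S \<Longrightarrow> f x \<ge> 0" "S \<in> sets borel" "f \<in> borel_measurable borel"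
  shows "set_integrable lborel S f"
proof -
  have "f absolutely_integrable_on S"
    using assms by (intro nonnegative_absolutely_integrable_1) auto
  then show ?thesis
    unfolding set_integrable_def using assms by (subst (asm) integrable_completion) auto
qed

lemma integrable_exp_minus_abs:
  assumes "\<mu> > 0"
  shows "integrable lborel (\<lambda>y::real. exp (- \<mu> * \<bar>y\<bar>))"
  using integrable_on_exp_minus_to_infinity[OF assms]
  by (intro integrable_lborel_abs set_integrable_lborel_nonneg) auto

lemma integrable_powr_minus_abs:
  assumes "p > 1"
  shows "integrable lborel (\<lambda>y::real. (1 + \<bar>y\<bar>) powr (- p))"
proof (rule integrable_lborel_abs)
  have "set_integrable lborel {1..} (\<lambda>y::real. y powr (- p))"
    using has_integral_powr_to_inf[of "-p" 1] assms
    by (intro set_integrable_lborel_nonneg) (auto simp: integrable_on_def)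
  then have "integrable lborel (\<lambda>y. indicat_real {1..} (1 + 1 * y) *\<^sub>R (1 + 1 * y) powr (- p))"
    unfolding set_integrable_def by (rule lborel_integrable_real_affine) simp
  then show "set_integrable lborel {0..} (\<lambda>y::real. (1 + y) powr (- p))"
    unfolding set_integrable_def
    by (rule Bochner_Integration.integrable_cong[THEN iffD1, rotated 2]) (auto simp: indicator_def)
qed

lemma integrable_powr_exp_minus_abs:
  assumes "\<mu> > 0"
  shows "integrable lborel (\<lambda>y::real. (1 + \<bar>y\<bar>) powr p * exp (- \<mu> * \<bar>y\<bar>))"
proof -
  \<comment> \<open>Half of the exponential rate absorbs the power, and the other half remains for
    integrability.\<close>
  obtain C where C: "C > 0" "\<And>y. (1 + \<bar>y\<bar>) powr p \<le> C * exp (\<mu> / 2 * \<bar>y\<bar>)"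
    using powr_le_exp[of "\<mu> / 2" p] assms by auto
  show ?thesis
  proof (rule Bochner_Integration.integrable_bound)
    show "integrable lborel (\<lambda>y::real. C * exp (- (\<mu> / 2) * \<bar>y\<bar>))"
      using assms by (intro integrable_mult_right integrable_exp_minus_abs) auto
    show "AE y in lborel. norm ((1 + \<bar>y\<bar>) powr p * exp (- \<mu> * \<bar>y\<bar>)) \<le> norm (C * exp (- (\<mu> / 2) * \<bar>y\<bar>))"
    proof (rule AE_I2)
      fix y :: real
      have "(1 + \<bar>y\<bar>) powr p * exp (- \<mu> * \<bar>y\<bar>) \<le> (C * exp (\<mu> / 2 * \<bar>y\<bar>)) * exp (- \<mu> * \<bar>y\<bar>)"
        using C(2) by (intro mult_right_mono) auto
      also have "\<dots> = C * exp (- (\<mu> / 2) * \<bar>y\<bar>)" by (simp flip: exp_add)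
      finally show "norm ((1 + \<bar>y\<bar>) powr p * exp (- \<mu> * \<bar>y\<bar>)) \<le> norm (C * exp (- (\<mu> / 2) * \<bar>y\<bar>))"
        using C(1) by (simp add: abs_mult)
    qed
  qed measurable
qed

section \<open>Complex powers on vertical lines, and the size of the kernel\<close>

lemma norm_powr_Complex_le:
  "d > 0 \<Longrightarrow> cmod (Complex d y powr s) \<le> exp (pi * \<bar>Im s\<bar>) * cmod (Complex d y) powr Re s"
proof -
  have "- (Im s) * Arg (Complex d y) \<le> \<bar>Im s\<bar> * \<bar>Arg (Complex d y)\<bar>"
    by (metis abs_ge_self abs_minus_cancel abs_mult)
  also have "\<dots> \<le> \<bar>Im s\<bar> * pi"
    using mpi_less_Arg[of "Complex d y"] Arg_le_pi[of "Complex d y"] by (intro mult_left_mono) auto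
  finally have "exp (- (Im s) * Arg (Complex d y)) \<le> exp (pi * \<bar>Im s\<bar>)" by (simp add: mult.commute)
  then show ?thesis
    unfolding norm_powr_complex by (subst mult.commute) (intro mult_right_mono, auto)
qed

text \<open>On a strip of real parts away from 0 and infinity, the modulus is comparable to 1 + |y|
  with one constant for all \<open>d\<close>. \<open>K\<close> exceeds 1 + d2, from d + |y| \<le> (1
  + d2)(1 + |y|), and 1 + 1/d1, from |d + i y| \<ge> d1.\<close>

lemma cmod_Complex_bounds:
  assumes "0 < d1" "d1 \<le> d" "d \<le> d2"
  defines "K \<equiv> 2 + d2 + 1 / d1"
  shows "(1 + \<bar>y\<bar>) / K \<le> cmod (Complex d y)" "cmod (Complex d y) \<le> K * (1 + \<bar>y\<bar>)" "1 \<le> K"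
proof -
  have d: "d > 0" "d2 > 0" using assms by auto
  have K: "K \<ge> 2 + d2" "K \<ge> 1 + 1 / d1" using assms d by (auto simp: K_def)
  show "1 \<le> K" using K d by linarith
  have "cmod (Complex d y) \<le> d + \<bar>y\<bar>"
    using cmod_le[of "Complex d y"] d by simp
  also have "\<dots> \<le> (1 + d2) * (1 + \<bar>y\<bar>)" 
  proof -
    have "(1 + d2) * (1 + \<bar>y\<bar>) = 1 + d2 + \<bar>y\<bar> + d2 * \<bar>y\<bar>" by algebra
    moreover have "d2 * \<bar>y\<bar> \<ge> 0" using d by simp
    ultimately show ?thesis using assms by linarith
  qed
  also have "\<dots> \<le> K * (1 + \<bar>y\<bar>)" using K by (intro mult_right_mono) auto
  finally show "cmod (Complex d y) \<le> K * (1 + \<bar>y\<bar>)" .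
  have "d \<le> cmod (Complex d y)" "\<bar>y\<bar> \<le> cmod (Complex d y)"
    using abs_Re_le_cmod[of "Complex d y"] abs_Im_le_cmod[of "Complex d y"] d by auto
  then have "1 \<le> 1 / d1 * cmod (Complex d y)" "\<bar>y\<bar> \<le> cmod (Complex d y)"
    using assms by (auto simp: field_simps)
  then have "1 + \<bar>y\<bar> \<le> (1 + 1 / d1) * cmod (Complex d y)" by (simp add: algebra_simps)
  also have "\<dots> \<le> K * cmod (Complex d y)" using K by (intro mult_right_mono) auto
  finally show "(1 + \<bar>y\<bar>) / K \<le> cmod (Complex d y)"
    using \<open>1 \<le> K\<close> by (simp add: divide_simps mult_ac)
qed

lemma norm_powr_Complex_le_uniform:
  assumes "0 < d1"
  obtains C where "C > 0" "\<And>d y. d1 \<le> d \<Longrightarrow> d \<le> d2 \<Longrightarrow> cmod (Complex d y powr s) \<le> C * (1 + \<bar>y\<bar>) powr Re s"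
proof
  \<comment> \<open>The absolute value keeps \<open>K\<close> at least 1 when \<open>d2\<close> is
    negative and the range of \<open>d\<close> is empty.\<close>
  define K where "K = 2 + \<bar>d2\<bar> + 1 / d1"
  have "K \<ge> 1" using assms by (simp add: K_def add_increasing2)
  then show "exp (pi * \<bar>Im s\<bar>) * K powr \<bar>Re s\<bar> > 0" by simp
  fix d y assume d: "d1 \<le> d" "d \<le> d2"
  have "cmod (Complex d y powr s) \<le> exp (pi * \<bar>Im s\<bar>) * cmod (Complex d y) powr Re s"
    using d assms by (intro norm_powr_Complex_le) auto
  also have "\<dots> \<le> exp (pi * \<bar>Im s\<bar>) * (K powr \<bar>Re s\<bar> * (1 + \<bar>y\<bar>) powr Re s)"
    using cmod_Complex_bounds(1,2)[of d1 d "\<bar>d2\<bar>" y] d assms \<open>K \<ge> 1\<close>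
    by (intro mult_left_mono powr_le_powr_of_ratio) (auto simp: K_def)
  finally show "cmod (Complex d y powr s) \<le> exp (pi * \<bar>Im s\<bar>) * K powr \<bar>Re s\<bar> * (1 + \<bar>y\<bar>) powr Re s"
    by (simp add: mult_ac)
qed

lemma continuous_on_powr_Complex: "d > 0 \<Longrightarrow> continuous_on UNIV (\<lambda>y. Complex d y powr s)"
  unfolding Complex_eq by (intro continuous_intros) (auto simp: complex_nonpos_Reals_iff complex_eq_iff)

lemma borel_measurable_powr_Complex: "d > 0 \<Longrightarrow> (\<lambda>y. Complex d y powr s) \<in> borel_measurable borel"
  by (intro borel_measurable_continuous_onI continuous_on_powr_Complex)

text \<open>The summation kernel on the lines \<open>Re z = \<plusminus> 1/2\<close>, up to a constant of modulus one.\<close>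

definition kern :: "real \<Rightarrow> real \<Rightarrow> real" where
  "kern a y = exp (- 2 * pi * a * y) / (1 + exp (- 2 * pi * y))"

lemma kern_pos: "kern a y > 0"
  by (simp add: kern_def add_pos_pos)

lemma borel_measurable_kern [measurable]: "kern a \<in> borel_measurable borel"
  unfolding kern_def by measurable

text \<open>Reflection in the real axis exchanges \<open>a\<close> and \<open>1 - a\<close>, so that
  bounds for one sign of y carry over to the other.\<close>

lemma kern_minus: "kern a (- y) = kern (1 - a) y"
proof -
  have "exp (2 * pi * y) * exp (- 2 * pi * y) = 1" by (simp flip: exp_add)
  then have "exp (- 2 * pi * (1 - a) * y) * (1 + exp (2 * pi * y)) = exp (2 * pi * a * y) * (1 + exp (- 2 * pi * y))"
    by (simp add: algebra_simps flip: exp_add)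
  moreover have "1 + exp (2 * pi * y) > 0" "1 + exp (- 2 * pi * y) > 0" by (auto simp: add_pos_pos)
  ultimately show ?thesis by (simp add: kern_def divide_simps mult_ac)
qed

lemma kern_le_exp_nonneg: "kern a y \<le> exp (- 2 * pi * a * y)"
  by (simp add: kern_def divide_le_eq add_pos_pos)

lemma kern_le_exp_neg: "kern a y \<le> exp (2 * pi * (1 - a) * y)"
  using kern_le_exp_nonneg[of "1 - a" "- y"] kern_minus[of "1 - a" y] by simp

lemma kern_le_exp_abs:
  assumes "\<mu> \<le> a" "a \<le> 1 - \<mu>"
  shows "kern a y \<le> exp (- (2 * pi * \<mu>) * \<bar>y\<bar>)"
proof (cases "y \<ge> 0")
  case True
  then have "\<mu> * y \<le> a * y" using assms by (intro mult_right_mono) auto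
  then show ?thesis using kern_le_exp_nonneg[of a y] True
    by (intro order_trans[OF kern_le_exp_nonneg]) (simp add: mult.assoc)
next
  case False
  then have "(1 - a) * y \<le> \<mu> * y" using assms by (intro mult_right_mono_neg) auto
  then show ?thesis using False
    by (intro order_trans[OF kern_le_exp_neg]) (simp add: mult.assoc)
qed

text \<open>A bound that survives a -> 0 and a -> 1. In each exponential exp(-2 pi b |y|), where b
  is a or 1 - a, the height |y| is replaced by 1 + |y| at the cost of exp(2 pi). Then exp(-x) \<le>
  x^(-\<tau>) at x = b (1 + |y|) separates the parameter from the height.\<close>

lemma kern_le_powr:
  assumes "0 < a" "a < 1" "0 \<le> \<tau>" "\<tau> \<le> 1"
  shows "kern a y \<le> exp (2 * pi) * (a powr (- \<tau>) + (1 - a) powr (- \<tau>)) * (1 + \<bar>y\<bar>) powr (- \<tau>)"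
proof -
  have *: "exp (- 2 * pi * b * \<bar>y\<bar>) \<le> exp (2 * pi) * (b powr (- \<tau>) * (1 + \<bar>y\<bar>) powr (- \<tau>))"
    if b: "0 < b" "b < 1" for b
  proof -
    have "exp (- 2 * pi * b * \<bar>y\<bar>) = exp (2 * pi * b) * exp (- (2 * pi * (b * (1 + \<bar>y\<bar>))))"
      by (simp add: algebra_simps flip: exp_add)
    also have "\<dots> \<le> exp (2 * pi) * exp (- (b * (1 + \<bar>y\<bar>)))"
    proof (intro mult_mono)
      have "1 * (b * (1 + \<bar>y\<bar>)) \<le> (2 * pi) * (b * (1 + \<bar>y\<bar>))"
        using b pi_gt3 by (intro mult_right_mono) auto
      then show "exp (- (2 * pi * (b * (1 + \<bar>y\<bar>)))) \<le> exp (- (b * (1 + \<bar>y\<bar>)))" by simp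
    qed (use b in auto)
    also have "exp (- (b * (1 + \<bar>y\<bar>))) \<le> (b * (1 + \<bar>y\<bar>)) powr (- \<tau>)"
      using b assms by (intro exp_minus_le_powr) auto
    also have "(b * (1 + \<bar>y\<bar>)) powr (- \<tau>) = b powr (- \<tau>) * (1 + \<bar>y\<bar>) powr (- \<tau>)"
      using b by (simp add: powr_mult)
    finally show ?thesis by simp
  qed
  have "kern a y \<le> exp (- 2 * pi * a * \<bar>y\<bar>) + exp (- 2 * pi * (1 - a) * \<bar>y\<bar>)"
    using kern_le_exp_nonneg[of a y] kern_le_exp_neg[of a y]
    by (cases "y \<ge> 0") (auto intro: order_trans add_increasing add_increasing2)
  then show ?thesis
    using *[of a] *[of "1 - a"] assms by (simp add: algebra_simps)
qed

subsection \<open>The kernel integral\<close>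

lemma borel_measurable_Complex [measurable]: "Complex d \<in> borel_measurable borel"
  unfolding Complex_eq by (intro borel_measurable_continuous_onI continuous_intros)

text \<open>The kernel decays like exp(-2 pi min(a, 1 - a) |y|), so an exponential growth with
  \<open>q\<close> below that minimum is tolerated. A positive \<open>q\<close> is the room for
  perturbing \<open>a\<close> in the double power series.\<close>

lemma integrable_powr_kern:
  assumes "0 < a" "a < 1" "0 \<le> q" "q < a" "q < 1 - a"
  shows "integrable lborel (\<lambda>y. (1 + \<bar>y\<bar>) powr p * exp (2 * pi * q * \<bar>y\<bar>) * kern a y)"
proof (rule Bochner_Integration.integrable_bound)
  define \<mu> where "\<mu> = min a (1 - a)"
  have \<mu>: "\<mu> \<le> a" "a \<le> 1 - \<mu>" "\<mu> - q > 0" using assms by (auto simp: \<mu>_def)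
  show "integrable lborel (\<lambda>y::real. (1 + \<bar>y\<bar>) powr p * exp (- (2 * pi * (\<mu> - q)) * \<bar>y\<bar>))"
    using \<mu> by (intro integrable_powr_exp_minus_abs) auto
  show "AE y in lborel. norm ((1 + \<bar>y\<bar>) powr p * exp (2 * pi * q * \<bar>y\<bar>) * kern a y)
      \<le> norm ((1 + \<bar>y\<bar>) powr p * exp (- (2 * pi * (\<mu> - q)) * \<bar>y\<bar>))"
  proof (rule AE_I2)
    fix y
    have "(1 + \<bar>y\<bar>) powr p * exp (2 * pi * q * \<bar>y\<bar>) * kern a y
        \<le> (1 + \<bar>y\<bar>) powr p * exp (2 * pi * q * \<bar>y\<bar>) * exp (- (2 * pi * \<mu>) * \<bar>y\<bar>)"
      using kern_le_exp_abs[OF \<mu>(1,2)] by (intro mult_left_mono) auto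
    also have "\<dots> = (1 + \<bar>y\<bar>) powr p * exp (- (2 * pi * (\<mu> - q)) * \<bar>y\<bar>)"
      by (simp add: algebra_simps flip: exp_add)
    finally show "norm ((1 + \<bar>y\<bar>) powr p * exp (2 * pi * q * \<bar>y\<bar>) * kern a y)
      \<le> norm ((1 + \<bar>y\<bar>) powr p * exp (- (2 * pi * (\<mu> - q)) * \<bar>y\<bar>))"
      using kern_pos[of a y] by (simp add: abs_mult)
  qed
qed measurable

lemma integrable_kern: "0 < a \<Longrightarrow> a < 1 \<Longrightarrow> integrable lborel (kern a)"
  using integrable_powr_kern[of a 0 0] by (simp add: add_nonneg_eq_0_iff)

lemma integrable_powr_Complex_kern:
  assumes "0 < a" "a < 1" "d > 0"
  shows "integrable lborel (\<lambda>y. Complex d y powr s * of_real (kern a y))"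
proof -
  note [measurable] = borel_measurable_powr_Complex[OF assms(3)]
  obtain C where C: "C > 0" "\<And>y. cmod (Complex d y powr s) \<le> C * (1 + \<bar>y\<bar>) powr Re s"
    by (rule norm_powr_Complex_le_uniform[OF assms(3), of d s]) blast
  show ?thesis
  proof (rule Bochner_Integration.integrable_bound)
    show "integrable lborel (\<lambda>y. C * ((1 + \<bar>y\<bar>) powr Re s * kern a y))"
      using integrable_powr_kern[of a 0 "Re s"] assms by (intro integrable_mult_right) simp
    show "AE y in lborel. norm (Complex d y powr s * of_real (kern a y)) \<le> norm (C * ((1 + \<bar>y\<bar>) powr Re s * kern a y))"
    proof (rule AE_I2)
      fix y
      show "norm (Complex d y powr s * of_real (kern a y)) \<le> norm (C * ((1 + \<bar>y\<bar>) powr Re s * kern a y))"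
        using mult_right_mono[OF C(2)[of y], of "kern a y"] kern_pos[of a y] C(1)
        by (simp add: norm_mult abs_mult mult_ac)
    qed
  qed measurable
qed

text \<open>\<open>d\<close> is the real part of c + z on the line of integration: Re z = -1/2 gives
  d = c - 1/2 and Re z = 1/2 gives d = c + 1/2. With \<open>c\<close> absorbed in \<open>d\<close>,
  both vertical lines give values of one function.\<close>

definition lerch_int :: "complex \<Rightarrow> real \<Rightarrow> real \<Rightarrow> complex" where
  "lerch_int s a d = (\<integral>y. Complex d y powr (- s) * of_real (kern a y) \<partial>lborel)"

lemma lerch_int_norm_le:
  assumes "0 < a" "a < 1" "d > 0" "integrable lborel g"
    and "\<And>y. norm (Complex d y powr (- s)) * kern a y \<le> g y"
  shows "norm (lerch_int s a d) \<le> (\<integral>y. g y \<partial>lborel)"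
proof -
  have "norm (lerch_int s a d) \<le> (\<integral>y. norm (Complex d y powr (- s) * of_real (kern a y)) \<partial>lborel)"
    unfolding lerch_int_def by (rule integral_norm_bound)
  also have "\<dots> \<le> (\<integral>y. g y \<partial>lborel)"
    using assms kern_pos
    by (intro integral_mono integrable_norm integrable_powr_Complex_kern) (auto simp: norm_mult less_imp_le)
  finally show ?thesis .
qed

text \<open>For \<open>a\<close> away from 0 and 1 the kernel decays exponentially at a fixed rate,
  which beats every power of y, whatever \<open>s\<close> is.\<close>

lemma lerch_int_bounded:
  assumes "0 < d1" "0 < \<mu>"
  obtains C where "C \<ge> 0" "\<And>a d. \<mu> \<le> a \<Longrightarrow> a \<le> 1 - \<mu> \<Longrightarrow> d1 \<le> d \<Longrightarrow> d \<le> d2 \<Longrightarrow> norm (lerch_int s a d) \<le> C"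
proof -
  obtain C where C: "C > 0" "\<And>d y. d1 \<le> d \<Longrightarrow> d \<le> d2 \<Longrightarrow> cmod (Complex d y powr (- s)) \<le> C * (1 + \<bar>y\<bar>) powr Re (- s)"
    using norm_powr_Complex_le_uniform[OF assms(1), of d2 "- s"] by blast
  define g where "g = (\<lambda>y. C * ((1 + \<bar>y\<bar>) powr Re (- s) * exp (- (2 * pi * \<mu>) * \<bar>y\<bar>)))"
  have g: "integrable lborel g"
    unfolding g_def using assms by (intro integrable_mult_right integrable_powr_exp_minus_abs) auto
  show thesis
  proof (rule that)
    show "(\<integral>y. g y \<partial>lborel) \<ge> 0" using C(1) by (intro integral_nonneg_AE) (auto simp: g_def)
    fix a d assume *: "\<mu> \<le> a" "a \<le> 1 - \<mu>" "d1 \<le> d" "d \<le> d2"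
    show "norm (lerch_int s a d) \<le> (\<integral>y. g y \<partial>lborel)"
    proof (rule lerch_int_norm_le[OF _ _ _ g])
      fix y
      have "cmod (Complex d y powr (- s)) * kern a y \<le>
          (C * (1 + \<bar>y\<bar>) powr Re (- s)) * exp (- (2 * pi * \<mu>) * \<bar>y\<bar>)"
        using * C kern_pos[of a y] by (intro mult_mono kern_le_exp_abs) (auto simp: less_imp_le)
      then show "cmod (Complex d y powr (- s)) * kern a y \<le> g y" by (simp add: g_def mult_ac)
    qed (use * assms in auto)
  qed
qed

lemma lerch_int_le_powr:
  assumes "0 < d1" "Re s > 0"
  obtains C \<tau> where "C \<ge> 0" "\<tau> < 1"
    "\<And>a d. 0 < a \<Longrightarrow> a < 1 \<Longrightarrow> d1 \<le> d \<Longrightarrow> d \<le> d2 \<Longrightarrow>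
       norm (lerch_int s a d) \<le> C * (a powr (- \<tau>) + (1 - a) powr (- \<tau>))"
proof -
  obtain C where C: "C > 0" "\<And>d y. d1 \<le> d \<Longrightarrow> d \<le> d2 \<Longrightarrow> cmod (Complex d y powr (- s)) \<le> C * (1 + \<bar>y\<bar>) powr Re (- s)"
    using norm_powr_Complex_le_uniform[OF assms(1), of d2 "- s"] by blast
  \<comment> \<open>Two conditions are met: \<tau> < 1 makes the bound integrable in
    \<open>a\<close>, and Re s + \<tau> > 1 makes the integral over y converge. Here Re s + \<tau> =
    1 + (Re s)^2 / (1 + Re s).\<close>
  define \<tau> where "\<tau> = 1 / (1 + Re s)"
  have \<tau>: "0 \<le> \<tau>" "\<tau> < 1" "Re s + \<tau> > 1"
    using assms by (auto simp: \<tau>_def field_simps)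
  define g where "g = (\<lambda>y::real. (1 + \<bar>y\<bar>) powr (- (Re s + \<tau>)))"
  have g: "integrable lborel g"
    unfolding g_def using \<tau> by (intro integrable_powr_minus_abs) auto
  show thesis
  proof (rule that)
    show "C * exp (2 * pi) * (\<integral>y. g y \<partial>lborel) \<ge> 0"
      using C(1) by (intro mult_nonneg_nonneg integral_nonneg_AE) (auto simp: g_def)
    show "\<tau> < 1" by fact
    fix a d :: real assume *: "0 < a" "a < 1" "d1 \<le> d" "d \<le> d2"
    define B where "B = a powr (- \<tau>) + (1 - a) powr (- \<tau>)"
    have "norm (lerch_int s a d) \<le> (\<integral>y. (C * exp (2 * pi) * B) * g y \<partial>lborel)"
    proof (rule lerch_int_norm_le)
      show "integrable lborel (\<lambda>y. (C * exp (2 * pi) * B) * g y)" using g by (intro integrable_mult_right)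
      fix y
      have "cmod (Complex d y powr (- s)) * kern a y \<le>
          (C * (1 + \<bar>y\<bar>) powr Re (- s)) * (exp (2 * pi) * B * (1 + \<bar>y\<bar>) powr (- \<tau>))"
        unfolding B_def
        using * C kern_pos[of a y] \<tau> by (intro mult_mono kern_le_powr) (auto simp: less_imp_le)
      also have "\<dots> = (C * exp (2 * pi) * B) * g y" 
        by (simp add: g_def powr_diff powr_minus field_simps)
      finally show "cmod (Complex d y powr (- s)) * kern a y \<le> (C * exp (2 * pi) * B) * g y" .
    qed (use * assms in auto)
    then show "norm (lerch_int s a d) \<le> C * exp (2 * pi) * (\<integral>y. g y \<partial>lborel) * (a powr (- \<tau>) + (1 - a) powr (- \<tau>))"
      by (simp add: B_def mult_ac)
  qed
qed

text \<open>On the line with real part d + n the base has modulus at least d + n, so the power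
  contributes a constant times (d + n)^(-Re s) uniformly in y, and the kernel remains as a fixed
  integrable factor.\<close>

lemma lerch_int_tendsto_0:
  assumes "0 < a" "a < 1" "d > 0" "Re s > 0"
  shows "(\<lambda>n. lerch_int s a (d + real n)) \<longlonglongrightarrow> 0"
proof (rule Lim_null_comparison)
  let ?B = "\<lambda>n. exp (pi * \<bar>Im s\<bar>) * (d + real n) powr (- Re s)"
  have "norm (lerch_int s a (d + real n)) \<le> ?B n * (\<integral>y. kern a y \<partial>lborel)" for n
  proof -
    have "norm (lerch_int s a (d + real n)) \<le> (\<integral>y. ?B n * kern a y \<partial>lborel)"
    proof (rule lerch_int_norm_le)
      show "integrable lborel (\<lambda>y. ?B n * kern a y)"
        using assms by (intro integrable_mult_right integrable_kern)
      fix y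
      have "cmod (Complex (d + real n) y powr (- s)) \<le> exp (pi * \<bar>Im (- s)\<bar>) * cmod (Complex (d + real n) y) powr Re (- s)"
        using assms by (intro norm_powr_Complex_le) auto
      also have "\<dots> \<le> exp (pi * \<bar>Im (- s)\<bar>) * (d + real n) powr Re (- s)"
        using assms abs_Re_le_cmod[of "Complex (d + real n) y"] by (intro mult_left_mono powr_mono2') auto
      finally show "cmod (Complex (d + real n) y powr (- s)) * kern a y \<le> ?B n * kern a y"
        using kern_pos[of a y] by (intro mult_right_mono) auto
    qed (use assms in auto)
    then show ?thesis by simp
  qed
  then show "\<forall>\<^sub>F n in sequentially. norm (lerch_int s a (d + real n)) \<le> ?B n * (\<integral>y. kern a y \<partial>lborel)"
    by (intro always_eventually allI)
  have "filterlim (\<lambda>n. d + real n) at_top sequentially"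
    by (intro filterlim_tendsto_add_at_top[OF tendsto_const] filterlim_real_sequentially)
  then have "(\<lambda>n. (d + real n) powr (- Re s)) \<longlonglongrightarrow> 0"
    using assms by (intro tendsto_neg_powr) auto
  then show "(\<lambda>n. ?B n * (\<integral>y. kern a y \<partial>lborel)) \<longlonglongrightarrow> 0"
    by (intro tendsto_mult_left_zero tendsto_mult_right_zero)
qed

lemma sum_power_div_fact_le_exp:
  fixes x :: real
  assumes "x \<ge> 0" "finite J"
  shows "(\<Sum>n\<in>J. x ^ n / fact n) \<le> exp x"
  using sum_le_suminf[OF summable_exp_generic[of x] assms(2)] assms
  by (simp add: exp_def divide_inverse mult.commute scaleR_conv_of_real)

text \<open>Expanding the power as the sum of (-s L)^n / n!, with L = Ln (d + i y), under the
  integral gives a power series in \<open>s\<close> that converges everywhere. A majorant exists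
  because |L| is at most ln(1 + |y|) plus a constant, so exp(|s| |L|) grows only
  polynomially.\<close>

lemma lerch_int_entire:
  assumes "0 < a" "a < 1" "d > 0"
  shows "(\<lambda>s. lerch_int s a d) holomorphic_on UNIV"
proof -
  note [measurable] = borel_measurable_powr_Complex[OF assms(3)]
  define L where "L = (\<lambda>y. Ln (Complex d y))"
  have cont: "continuous_on UNIV L"
    unfolding L_def Complex_eq using assms
    by (intro continuous_intros) (auto simp: complex_nonpos_Reals_iff complex_eq_iff)
  then have [measurable]: "L \<in> borel_measurable borel"
    by (intro borel_measurable_continuous_onI)
  define A where "A = (\<lambda>n. \<integral>y. (- L y) ^ n / fact n * of_real (kern a y) \<partial>lborel)"
  have "((\<lambda>n. A n * s ^ n) has_sum lerch_int s a d) UNIV" for s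
  proof -
    define K where "K = 2 + d + 1 / d"
    have K: "1 \<le> K" "\<And>y. (1 + \<bar>y\<bar>) / K \<le> cmod (Complex d y)" "\<And>y. cmod (Complex d y) \<le> K * (1 + \<bar>y\<bar>)"
      unfolding K_def using cmod_Complex_bounds[of d d d] assms by auto
    define g where "g = (\<lambda>y. exp (cmod s * pi) * K powr cmod s * ((1 + \<bar>y\<bar>) powr cmod s * kern a y))"
    have L: "exp (cmod s * cmod (L y)) \<le> exp (cmod s * pi) * K powr cmod s * (1 + \<bar>y\<bar>) powr cmod s" for y
    proof -
      have nz: "Complex d y \<noteq> 0" using assms by (auto simp: complex_eq_iff)
      then have z: "cmod (Complex d y) > 0" by simp
      have "cmod (L y) \<le> \<bar>Re (L y)\<bar> + \<bar>Im (L y)\<bar>" by (rule cmod_le)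
      moreover have "\<bar>Im (L y)\<bar> \<le> pi"
        using mpi_less_Im_Ln[OF nz] Im_Ln_le_pi[OF nz] by (auto simp: L_def)
      moreover have "Re (L y) = ln (cmod (Complex d y))" using nz by (simp add: L_def)
      moreover have "\<bar>ln (cmod (Complex d y))\<bar> \<le> ln K + ln (1 + \<bar>y\<bar>)"
      proof -
        have "ln (cmod (Complex d y)) \<le> ln (K * (1 + \<bar>y\<bar>))" using K(3) z by (intro ln_mono)
        moreover have "ln ((1 + \<bar>y\<bar>) / K) \<le> ln (cmod (Complex d y))"
          using K(1,2) by (intro ln_mono divide_pos_pos) auto
        moreover have "ln (1 + \<bar>y\<bar>) \<ge> 0" by simp
        moreover have "ln K \<ge> 0" using K(1) by simp
        moreover have "ln (K * (1 + \<bar>y\<bar>)) = ln K + ln (1 + \<bar>y\<bar>)"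
            "ln ((1 + \<bar>y\<bar>) / K) = ln (1 + \<bar>y\<bar>) - ln K"
          using K(1) by (auto intro: ln_mult_pos ln_divide_pos)
        ultimately show ?thesis by linarith
      qed
      ultimately have "cmod (L y) \<le> pi + ln K + ln (1 + \<bar>y\<bar>)" by linarith
      then have "cmod s * cmod (L y) \<le> cmod s * (pi + ln K + ln (1 + \<bar>y\<bar>))" by (intro mult_left_mono) auto
      then show ?thesis using K(1) by (simp add: powr_def distrib_left flip: exp_add)
    qed
    have "((\<lambda>n. \<integral>y. (s * (- L y)) ^ n / fact n * of_real (kern a y) \<partial>lborel) has_sum
        (\<integral>y. Complex d y powr (- s) * of_real (kern a y) \<partial>lborel)) UNIV"
    proof (rule has_sum_integral_dominated[where h = id and g = g])
      show "integrable lborel g"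
        unfolding g_def using integrable_powr_kern[of a 0 "cmod s"] assms by (intro integrable_mult_right) simp
      fix J :: "nat set" and y :: real assume J: "finite J"
      have "(\<Sum>n\<in>J. norm ((s * (- L y)) ^ n / fact n * of_real (kern a y))) =
          (\<Sum>n\<in>J. (cmod s * cmod (L y)) ^ n / fact n) * kern a y"
        using kern_pos[of a y] by (simp add: norm_mult norm_divide norm_power sum_distrib_right)
      also have "\<dots> \<le> exp (cmod s * cmod (L y)) * kern a y"
        using kern_pos[of a y] J by (intro mult_right_mono sum_power_div_fact_le_exp) auto
      also have "\<dots> \<le> (exp (cmod s * pi) * K powr cmod s * (1 + \<bar>y\<bar>) powr cmod s) * kern a y"
        using kern_pos[of a y] L by (intro mult_right_mono) auto
      finally show "(\<Sum>n\<in>J. norm ((s * (- L y)) ^ n / fact n * of_real (kern a y))) \<le> g y"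
        by (simp add: g_def mult_ac)
    next
      fix y
      have "((\<lambda>n. (s * (- L y)) ^ n /\<^sub>R fact n) has_sum exp (s * (- L y))) UNIV"
        using summable_norm_exp exp_converges by (rule norm_summable_imp_has_sum)
      moreover have "exp (s * (- L y)) = Complex d y powr (- s)"
        using assms by (auto simp: powr_def L_def complex_eq_iff)
      ultimately show "((\<lambda>n. (s * (- L y)) ^ n / fact n * of_real (kern a y)) has_sum
          Complex d y powr (- s) * of_real (kern a y)) UNIV"
        by (intro has_sum_cmult_left) (simp add: scaleR_conv_of_real divide_inverse mult.commute)
    next
      show "(\<lambda>y. (s * (- L y)) ^ n / fact n * of_real (kern a y)) \<in> borel_measurable lborel" for n
        by measurable
    qed simp
    moreover have "(\<integral>y. (s * (- L y)) ^ n / fact n * of_real (kern a y) \<partial>lborel) = A n * s ^ n" for n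
    proof -
      have "(\<integral>y. (s * (- L y)) ^ n / fact n * of_real (kern a y) \<partial>lborel) =
          (\<integral>y. s ^ n * ((- L y) ^ n / fact n * of_real (kern a y)) \<partial>lborel)"
        by (simp only: power_mult_distrib mult.assoc times_divide_eq_left times_divide_eq_right)
      then show ?thesis by (simp add: A_def mult.commute)
    qed
    ultimately show ?thesis by (simp add: lerch_int_def)
  qed
  then have "(\<lambda>n. A n * (s - 0) ^ n) sums lerch_int s a d" for s
    by (simp add: has_sum_imp_sums)
  then have "(\<lambda>s. lerch_int s a d) holomorphic_on ball 0 r" for r
    by (rule power_series_holomorphic)
  then have "(\<lambda>s. lerch_int s a d) field_differentiable at s" for s
    using holomorphic_on_imp_differentiable_at[of _ "ball 0 (norm s + 1)" s] by simp
  then show ?thesis unfolding holomorphic_on_def by simp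
qed

text \<open>Both factors lie in the right half plane, so their arguments add up to less than pi in
  modulus and the principal logarithm is additive on them.\<close>

lemma powr_Complex_add:
  assumes "d > 0" "\<bar>v\<bar> < d"
  shows "Complex (d + v) y powr s = (1 + of_real v / Complex d y) powr s * Complex d y powr s"
proof -
  have z: "Complex d y \<noteq> 0" using assms by (auto simp: complex_eq_iff)
  have "cmod (of_real v / Complex d y) < 1"
    using assms abs_Re_le_cmod[of "Complex d y"] z by (simp add: norm_divide divide_simps)
  then have re: "Re (1 + of_real v / Complex d y) > 0"
    using abs_Re_le_cmod[of "of_real v / Complex d y"] by auto
  then have nz: "1 + of_real v / Complex d y \<noteq> 0" by (metis less_irrefl zero_complex.sel(1))
  have eq: "Complex (d + v) y = (1 + of_real v / Complex d y) * Complex d y"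
    using z by (simp add: field_simps) (simp add: complex_eq_iff algebra_simps)
  have "\<bar>Im (Ln (1 + of_real v / Complex d y))\<bar> < pi / 2" "\<bar>Im (Ln (Complex d y))\<bar> < pi / 2"
    using Re_Ln_pos_lt_imp[OF re] Re_Ln_pos_lt_imp[of "Complex d y"] assms by simp_all
  then have lnadd: "Ln (Complex (d + v) y) = Ln (1 + of_real v / Complex d y) + Ln (Complex d y)"
    unfolding eq using z nz by (intro Ln_times_simple) auto
  have "Complex (d + v) y \<noteq> 0" using assms by (auto simp: complex_eq_iff)
  then show ?thesis
    using z nz by (simp only: powr_def lnadd if_False exp_add ring_distribs)
qed

lemma kern_add: "kern (a + u) y = exp (- 2 * pi * y * u) * kern a y"
proof -
  have "exp (- 2 * pi * (a + u) * y) = exp (- 2 * pi * y * u) * exp (- 2 * pi * a * y)"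
    unfolding exp_add[symmetric] by (rule arg_cong[of _ _ exp]) algebra
  then show ?thesis by (simp add: kern_def)
qed

lemma summable_norm_gchoose:
  fixes s :: complex
  shows "summable (\<lambda>k. norm (s gchoose k) * (1 / 2) ^ k)"
proof -
  have "ereal (norm (1 / 2 :: complex)) < conv_radius (\<lambda>k. s gchoose k)"
    by (simp add: conv_radius_gchoose norm_divide one_ereal_def)
  then show ?thesis
    using abs_summable_in_conv_radius by (fastforce simp: norm_mult norm_power norm_divide power_divide)
qed

text \<open>Moving a0 by u multiplies the kernel by exp(-2 pi y u); moving d0 by v multiplies the
  power by (1 + v/(d0 + i y))^(-s). The product of the exponential and the binomial series is
  integrated term by term.\<close>

lemma real_analytic2_on_lerch_int:
  "real_analytic2_on (\<lambda>(a, d). lerch_int s a d) ({0<..<1} \<times> {0<..})"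
proof (rule real_analytic2_onI)
  fix a0 d0 :: real assume "(a0, d0) \<in> {0<..<1} \<times> {0<..}"
  then have ad: "0 < a0" "a0 < 1" "0 < d0" by auto
  note [measurable] = borel_measurable_powr_Complex[OF ad(3)]
  define A where "A = (\<lambda>j k. \<integral>y. (of_real (- 2 * pi * y)) ^ j / fact j * ((- s gchoose k) * (1 / Complex d0 y) ^ k)
    * (Complex d0 y powr (- s) * of_real (kern a0 y)) \<partial>lborel)"
  \<comment> \<open>Half of the minimum keeps exp(2 pi \<epsilon> |y|) below the decay of the kernel
    at \<open>a0\<close> and gives |v/(d0 + i y)| \<le> 1/2, inside the disc of convergence of the
    binomial series.\<close>
  define \<epsilon> where "\<epsilon> = min (min a0 (1 - a0)) d0 / 2"
  have \<epsilon>: "0 < \<epsilon>" "\<epsilon> < a0" "\<epsilon> < 1 - a0" "\<epsilon> \<le> d0 / 2" using ad by (auto simp: \<epsilon>_def)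
  obtain C where C: "C > 0" "\<And>y. cmod (Complex d0 y powr (- s)) \<le> C * (1 + \<bar>y\<bar>) powr Re (- s)"
    by (rule norm_powr_Complex_le_uniform[OF ad(3), of d0 "- s"]) blast
  define B where "B = (\<Sum>k. norm (- s gchoose k) * (1 / 2) ^ k)"
  have B: "(\<Sum>k\<in>J. norm (- s gchoose k) * (1 / 2) ^ k) \<le> B" if "finite J" for J
    unfolding B_def by (rule sum_le_suminf[OF summable_norm_gchoose that]) simp
  show "\<exists>A \<epsilon>. \<epsilon> > 0 \<and> (\<forall>a d. \<bar>a - a0\<bar> < \<epsilon> \<and> \<bar>d - d0\<bar> < \<epsilon> \<longrightarrow>
     ((\<lambda>(j, k). A j k * of_real (a - a0) ^ j * of_real (d - d0) ^ k)
        has_sum (case (a, d) of (a, d) \<Rightarrow> lerch_int s a d)) UNIV)"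
  proof (intro exI conjI allI impI)
    fix a d assume *: "\<bar>a - a0\<bar> < \<epsilon> \<and> \<bar>d - d0\<bar> < \<epsilon>"
    define u v where "u = a - a0" and "v = d - d0"
    have uv: "\<bar>u\<bar> < \<epsilon>" "\<bar>v\<bar> < \<epsilon>" using * by (auto simp: u_def v_def)
    define E where "E = (\<lambda>j y. (of_real (- 2 * pi * y * u)) ^ j / fact j :: complex)"
    define G where "G = (\<lambda>k y. (- s gchoose k) * (of_real v / Complex d0 y) ^ k)"
    define P where "P = (\<lambda>y. Complex d0 y powr (- s) * of_real (kern a0 y))"
    define g where "g = (\<lambda>y. B * C * ((1 + \<bar>y\<bar>) powr Re (- s) * exp (2 * pi * \<epsilon> * \<bar>y\<bar>) * kern a0 y))"
    have q: "cmod (of_real v / Complex d0 y) \<le> 1 / 2" for y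
    proof -
      have "d0 \<le> cmod (Complex d0 y)" using abs_Re_le_cmod[of "Complex d0 y"] ad by simp
      then show ?thesis using uv \<epsilon> ad by (simp add: norm_divide divide_simps)
    qed
    have "((\<lambda>p. \<integral>y. (case p of (j, k) \<Rightarrow> E j y * G k y * P y) \<partial>lborel) has_sum
        (\<integral>y. Complex d y powr (- s) * of_real (kern a y) \<partial>lborel)) UNIV"
    proof (rule has_sum_integral_dominated[where h = prod_decode and g = g])
      show "integrable lborel g"
        unfolding g_def using \<epsilon> ad by (intro integrable_mult_right integrable_powr_kern) auto
      fix J :: "(nat \<times> nat) set" and y :: real assume J: "finite J"
      \<comment> \<open>Enlarging \<open>J\<close> to the product of its two projections makes the
        double sum factor.\<close>
      have "(\<Sum>p\<in>J. norm (case p of (j, k) \<Rightarrow> E j y * G k y * P y)) \<le>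
         (\<Sum>p\<in>fst ` J \<times> snd ` J. norm (case p of (j, k) \<Rightarrow> E j y * G k y * P y))"
        using J by (intro sum_mono2) force+
      also have "\<dots> = (\<Sum>j\<in>fst ` J. norm (E j y)) * (\<Sum>k\<in>snd ` J. norm (G k y)) * norm (P y)"
        by (simp add: sum_product sum.cartesian_product norm_mult case_prod_unfold flip: sum_distrib_right)
      also have "\<dots> \<le> exp (2 * pi * \<epsilon> * \<bar>y\<bar>) * B * (C * (1 + \<bar>y\<bar>) powr Re (- s) * kern a0 y)"
      proof (intro mult_mono mult_nonneg_nonneg sum_nonneg)
        have "(\<Sum>j\<in>fst ` J. norm (E j y)) = (\<Sum>j\<in>fst ` J. (2 * pi * \<bar>y\<bar> * \<bar>u\<bar>) ^ j / fact j)"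
          by (simp add: E_def norm_divide norm_power norm_mult abs_mult)
        also have "\<dots> \<le> exp (2 * pi * \<bar>y\<bar> * \<bar>u\<bar>)"
          using J by (intro sum_power_div_fact_le_exp) auto
        also have "\<dots> \<le> exp (2 * pi * \<epsilon> * \<bar>y\<bar>)"
          using uv mult_left_mono[of "\<bar>u\<bar>" \<epsilon> "2 * pi * \<bar>y\<bar>"] by (simp add: mult_ac)
        finally show "(\<Sum>j\<in>fst ` J. norm (E j y)) \<le> exp (2 * pi * \<epsilon> * \<bar>y\<bar>)" .
        have "(\<Sum>k\<in>snd ` J. norm (G k y)) \<le> (\<Sum>k\<in>snd ` J. norm (- s gchoose k) * (1 / 2) ^ k)"
          unfolding G_def norm_mult norm_power by (intro sum_mono mult_left_mono power_mono q) auto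
        also have "\<dots> \<le> B" using J by (intro B) auto
        finally show "(\<Sum>k\<in>snd ` J. norm (G k y)) \<le> B" .
        show "norm (P y) \<le> C * (1 + \<bar>y\<bar>) powr Re (- s) * kern a0 y"
          unfolding P_def norm_mult using C kern_pos[of a0 y] by (auto intro!: mult_right_mono)
        show "0 \<le> B" using B[of "{}"] by simp
      qed auto
      also have "\<dots> = g y" by (simp add: g_def mult_ac)
      finally show "(\<Sum>p\<in>J. norm (case p of (j, k) \<Rightarrow> E j y * G k y * P y)) \<le> g y" .
    next
      fix y
      have "((\<lambda>j. (of_real (- 2 * pi * y * u)) ^ j /\<^sub>R fact j) has_sum exp (complex_of_real (- 2 * pi * y * u))) UNIV"
        using summable_norm_exp exp_converges by (rule norm_summable_imp_has_sum)
      then have sumE: "((\<lambda>j. E j y) has_sum of_real (exp (- 2 * pi * y * u))) UNIV"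
        by (simp only: E_def scaleR_conv_of_real divide_inverse mult.commute exp_of_real of_real_inverse of_real_fact)
      have "summable (\<lambda>k. norm (G k y))"
        by (rule summable_comparison_test'[OF summable_norm_gchoose[of "- s"]])
           (auto simp: G_def norm_mult norm_power intro!: mult_left_mono power_mono q)
      moreover have "cmod (of_real v / Complex d0 y) < 1" using q[of y] by linarith
      then have "(\<lambda>k. G k y) sums (1 + of_real v / Complex d0 y) powr (- s)"
        unfolding G_def by (rule gen_binomial_complex)
      ultimately have sumG: "((\<lambda>k. G k y) has_sum (1 + of_real v / Complex d0 y) powr (- s)) UNIV"
        by (rule norm_summable_imp_has_sum)
      have d: "d = d0 + v" and a: "a = a0 + u" by (simp_all add: u_def v_def)
      have "Complex d y powr (- s) * of_real (kern a y) =
         of_real (exp (- 2 * pi * y * u)) * (1 + of_real v / Complex d0 y) powr (- s) * P y"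
        unfolding d a using uv \<epsilon> ad
        by (subst powr_Complex_add) (simp_all add: kern_add P_def)
      moreover have "((\<lambda>p. (case p of (j, k) \<Rightarrow> E j y * G k y) * P y) has_sum
         of_real (exp (- 2 * pi * y * u)) * (1 + of_real v / Complex d0 y) powr (- s) * P y) UNIV"
        using has_sum_mult_Times[OF sumE sumG] by (intro has_sum_cmult_left) simp
      ultimately show "((\<lambda>p. case p of (j, k) \<Rightarrow> E j y * G k y * P y) has_sum
          Complex d y powr (- s) * of_real (kern a y)) UNIV"
        by (simp add: case_prod_unfold)
    next
      show "(\<lambda>y. case p of (j, k) \<Rightarrow> E j y * G k y * P y) \<in> borel_measurable lborel" for p :: "nat \<times> nat"
        unfolding E_def G_def P_def case_prod_unfold by measurable
    qed (rule bij_prod_decode)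
    moreover have "(\<integral>y. E j y * G k y * P y \<partial>lborel) = A j k * of_real u ^ j * of_real v ^ k" for j k
    proof -
      have *: "complex_of_real (- 2 * pi * y * u) ^ j = of_real u ^ j * of_real (- 2 * pi * y) ^ j" for y
        by (metis mult.commute of_real_mult power_mult_distrib)
      have "E j y * G k y * P y = (of_real u ^ j * of_real v ^ k) *
        ((of_real (- 2 * pi * y)) ^ j / fact j * ((- s gchoose k) * (1 / Complex d0 y) ^ k)
          * (Complex d0 y powr (- s) * of_real (kern a0 y)))" for y
        unfolding E_def * by (simp add: G_def P_def power_divide)
      then have "(\<integral>y. E j y * G k y * P y \<partial>lborel) = (of_real u ^ j * of_real v ^ k) * A j k"
        by (simp only: A_def integral_mult_right_zero)
      then show ?thesis by (simp only: mult_ac)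
    qed
    ultimately show "((\<lambda>(j, k). A j k * of_real (a - a0) ^ j * of_real (d - d0) ^ k)
        has_sum (case (a, d) of (a, d) \<Rightarrow> lerch_int s a d)) UNIV"
      unfolding case_prod_unfold fst_conv snd_conv by (simp only: lerch_int_def u_def v_def)
  qed (rule \<epsilon>(1))
qed

subsection \<open>Shifting the line of integration\<close>

text \<open>Contour integrals over segments are gauge integrals over intervals, while
  \<open>lerch_int\<close> is a Lebesgue integral over the line; this limit connects them.\<close>

lemma tendsto_integral_symmetric_interval:
  fixes g :: "real \<Rightarrow> complex"
  assumes g: "integrable lborel g"
  shows "(\<lambda>n. integral {- real n..real n} g) \<longlonglongrightarrow> (\<integral>y. g y \<partial>lborel)"
proof -
  have [measurable]: "g \<in> borel_measurable lborel" using g by auto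
  have "set_integrable lborel {- real n..real n} g" for n
    using g unfolding set_integrable_def by (intro integrable_mult_indicator) auto
  then have "integral {- real n..real n} g = (\<integral>y. indicator {- real n..real n} y *\<^sub>R g y \<partial>lborel)" for n
    using set_borel_integral_eq_integral(2) unfolding set_lebesgue_integral_def by metis
  moreover have "(\<lambda>n. \<integral>y. indicator {- real n..real n} y *\<^sub>R g y \<partial>lborel) \<longlonglongrightarrow> (\<integral>y. g y \<partial>lborel)"
  proof (rule integral_dominated_convergence[where w = "\<lambda>y. norm (g y)"])
    show "AE y in lborel. (\<lambda>n. indicator {- real n..real n} y *\<^sub>R g y) \<longlonglongrightarrow> g y"
    proof (rule AE_I2)
      fix y :: real
      have "\<forall>\<^sub>F n in sequentially. real n \<ge> \<bar>y\<bar>"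
        using filterlim_real_sequentially by (simp add: filterlim_at_top)
      then have "\<forall>\<^sub>F n in sequentially. indicator {- real n..real n} y *\<^sub>R g y = g y"
        by eventually_elim (auto simp: indicator_def)
      then show "(\<lambda>n. indicator {- real n..real n} y *\<^sub>R g y) \<longlonglongrightarrow> g y"
        by (rule tendsto_eventually)
    qed
  qed (use g in \<open>auto simp: indicator_def intro!: AE_I2\<close>)
  ultimately show ?thesis by simp
qed

lemma contour_integral_rectpath:
  assumes "continuous_on (path_image (rectpath z1 z3)) f" "Re z1 \<le> Re z3" "Im z1 \<le> Im z3"
  defines "z2 \<equiv> Complex (Re z3) (Im z1)" and "z4 \<equiv> Complex (Re z1) (Im z3)"
  shows "contour_integral (rectpath z1 z3) f =
    contour_integral (linepath z1 z2) f + contour_integral (linepath z2 z3) f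
    + contour_integral (linepath z3 z4) f + contour_integral (linepath z4 z1) f"
proof -
  have eq: "rectpath z1 z3 = linepath z1 z2 +++ linepath z2 z3 +++ linepath z3 z4 +++ linepath z4 z1"
    by (simp add: rectpath_def Let_def z2_def z4_def)
  have "f contour_integrable_on linepath z1 z2" "f contour_integrable_on linepath z2 z3"
     "f contour_integrable_on linepath z3 z4" "f contour_integrable_on linepath z4 z1"
    using assms(1) unfolding eq
    by (auto intro!: contour_integrable_continuous_linepath elim!: continuous_on_subset simp: path_image_join)
  then show ?thesis
    unfolding eq by (simp add: contour_integrable_joinI)
qed

text \<open>The denominator has simple zeros at the integers, and the residue at an integer n > -c
  is exp(2 pi i n a) (c + n)^(-s) / (2 pi i). Only n = 0 will be enclosed.\<close>

definition lerch_integrand :: "complex \<Rightarrow> real \<Rightarrow> real \<Rightarrow> complex \<Rightarrow> complex" where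
  "lerch_integrand s a c z =
     (of_real c + z) powr (- s) * exp (2 * pi * \<i> * a * z) / (exp (2 * pi * \<i> * z) - 1)"

lemma exp_2pi_i_eq_1_iff: "exp (2 * of_real pi * \<i> * z) = 1 \<longleftrightarrow> z \<in> \<int>"
proof
  assume "exp (2 * of_real pi * \<i> * z) = 1"
  then obtain n :: int where "Im z = 0" "2 * pi * Re z = of_int (2 * n) * pi"
    by (auto simp: exp_eq_1)
  then have "z = of_int n" by (simp add: complex_eq_iff)
  then show "z \<in> \<int>" by simp
next
  assume "z \<in> \<int>"
  then obtain n where "z = of_int n" by (auto elim: Ints_cases)
  then show "exp (2 * of_real pi * \<i> * z) = 1"
    by (auto simp: exp_eq_1)
qed

text \<open>The condition -c < Re z keeps c + z off the branch cut, and |Re z| < 1 leaves 0 as the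
  only zero of the denominator.\<close>

lemma lerch_integrand_holomorphic:
  "lerch_integrand s a c holomorphic_on {z. \<bar>Re z\<bar> < 1 \<and> - c < Re z} - {0}"
proof -
  have "z = 0" if "\<bar>Re z\<bar> < 1" "z \<in> \<int>" for z :: complex
    using that by (auto elim!: Ints_cases simp flip: of_int_abs)
  then show ?thesis
    unfolding lerch_integrand_def
    by (intro holomorphic_intros) (auto simp: complex_nonpos_Reals_iff exp_2pi_i_eq_1_iff)
qed

lemma residue_lerch_integrand:
  assumes "c > 0"
  shows "residue (lerch_integrand s a c) 0 = of_real c powr (- s) / (2 * pi * \<i>)"
proof (rule residue_simple')
  let ?S = "{z. \<bar>Re z\<bar> < 1 \<and> - c < Re z}"
  show "open ?S"
    by (intro open_Collect_conj open_Collect_less continuous_intros)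
  show "0 \<in> ?S" using assms by simp
  show "lerch_integrand s a c holomorphic_on ?S - {0}" by (rule lerch_integrand_holomorphic)
  have "((\<lambda>z. exp (2 * pi * \<i> * z)) has_field_derivative (2 * pi * \<i>)) (at 0)"
    by (auto intro!: derivative_eq_intros)
  then have l1: "((\<lambda>z. (exp (2 * pi * \<i> * z) - 1) / z) \<longlongrightarrow> 2 * pi * \<i>) (at 0)"
    by (simp add: has_field_derivative_iff)
  have l2: "((\<lambda>z. (of_real c + z) powr (- s) * exp (2 * pi * \<i> * a * z)) \<longlongrightarrow>
      (of_real c + 0) powr (- s) * exp (2 * pi * \<i> * a * 0)) (at 0)"
    using assms by (intro tendsto_intros) (auto simp: complex_nonpos_Reals_iff)
  show "((\<lambda>z. lerch_integrand s a c z * (z - 0)) \<longlongrightarrow> of_real c powr (- s) / (2 * pi * \<i>)) (at 0)"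
    using tendsto_divide[OF l2 l1] by (simp add: lerch_integrand_def)
qed

text \<open>On Re z = -1/2 one has exp(2 pi i z) = -exp(-2 pi y), so the denominator is -(1 + exp(-2
  pi y)) and cannot vanish. The real part of z also produces the constant phase
  \<open>cis (- pi * a)\<close>.\<close>

lemma lerch_integrand_left:
  "lerch_integrand s a c (Complex (- 1 / 2) y) = - (cis (- pi * a) * (Complex (c - 1 / 2) y powr (- s) * of_real (kern a y)))"
proof -
  have "exp (2 * pi * \<i> * Complex (- 1 / 2) y) = of_real (exp (- 2 * pi * y)) * cis (- pi)"
    by (simp add: complex_eq_iff Re_exp Im_exp)
  then have 1: "exp (2 * pi * \<i> * Complex (- 1 / 2) y) - 1 = - of_real (1 + exp (- 2 * pi * y))"
    by (simp add: complex_eq_iff)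
  have 2: "exp (2 * pi * \<i> * a * Complex (- 1 / 2) y) = of_real (exp (- 2 * pi * a * y)) * cis (- pi * a)"
    by (simp add: complex_eq_iff Re_exp Im_exp mult_ac)
  have 3: "of_real c + Complex (- 1 / 2) y = Complex (c - 1 / 2) y" by (simp add: complex_eq_iff)
  show ?thesis unfolding lerch_integrand_def 1 2 3 kern_def
    by (simp only: of_real_divide divide_minus_right times_divide_eq_right mult_ac)
qed

lemma lerch_integrand_right:
  "lerch_integrand s a c (Complex (1 / 2) y) = - (cis (pi * a) * (Complex (c + 1 / 2) y powr (- s) * of_real (kern a y)))"
proof -
  have "exp (2 * pi * \<i> * Complex (1 / 2) y) = of_real (exp (- 2 * pi * y)) * cis pi"
    by (simp add: complex_eq_iff Re_exp Im_exp)
  then have 1: "exp (2 * pi * \<i> * Complex (1 / 2) y) - 1 = - of_real (1 + exp (- 2 * pi * y))"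
    by (simp add: complex_eq_iff)
  have 2: "exp (2 * pi * \<i> * a * Complex (1 / 2) y) = of_real (exp (- 2 * pi * a * y)) * cis (pi * a)"
    by (simp add: complex_eq_iff Re_exp Im_exp mult_ac)
  have 3: "of_real c + Complex (1 / 2) y = Complex (c + 1 / 2) y" by (simp add: complex_eq_iff)
  show ?thesis unfolding lerch_integrand_def 1 2 3 kern_def
    by (simp only: of_real_divide divide_minus_right times_divide_eq_right mult_ac)
qed

text \<open>For the horizontal sides. With q = |exp(2 pi i z)|, the inequality |q - 1| \<ge> (1 +
  q)/2 holds exactly when q \<le> 1/3 or q \<ge> 3, and |y| \<ge> 1 ensures one of the two because
  exp(2 pi) \<ge> 3. This controls the denominator for every real part \<open>x\<close>.\<close>

lemma norm_lerch_integrand_le: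
  assumes "\<bar>y\<bar> \<ge> 1"
  shows "norm (lerch_integrand s a c (Complex x y)) \<le> cmod (Complex (c + x) y powr (- s)) * (2 * kern a y)"
proof -
  define q where "q = exp (- 2 * pi * y)"
  have exp3: "exp (2 * pi) \<ge> 3" using exp_ge_add_one_self[of "2 * pi"] pi_gt3 by linarith
  have "q \<le> 1 / 3 \<or> q \<ge> 3"
  proof (cases "y \<ge> 0")
    case True
    then have "q \<le> exp (- (2 * pi))" using assms by (simp add: q_def)
    also have "\<dots> \<le> 1 / 3" using exp3 by (simp add: exp_minus divide_simps)
    finally show ?thesis by simp
  next
    case False
    then have "q \<ge> exp (2 * pi)"
      using assms mult_left_mono[of 1 "- y" pi] by (simp add: q_def)
    then show ?thesis using exp3 by linarith
  qed
  moreover have q: "q > 0" by (simp add: q_def)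
  ultimately have "(1 + q) / 2 \<le> \<bar>q - 1\<bar>" by (auto simp: abs_if field_simps)
  also have "norm (exp (2 * pi * \<i> * Complex x y)) = q" by (simp add: q_def)
  then have "\<bar>q - 1\<bar> \<le> norm (exp (2 * pi * \<i> * Complex x y) - 1)"
    by (metis norm_one norm_triangle_ineq3)
  finally have "(1 + q) / 2 \<le> norm (exp (2 * pi * \<i> * Complex x y) - 1)" .
  then have "exp (- 2 * pi * a * y) / norm (exp (2 * pi * \<i> * Complex x y) - 1) \<le> exp (- 2 * pi * a * y) / ((1 + q) / 2)"
    using q by (intro divide_left_mono mult_pos_pos) (auto intro: less_le_trans[rotated])
  also have "\<dots> = 2 * kern a y" by (simp add: kern_def q_def)
  finally have f1: "exp (- 2 * pi * a * y) / norm (exp (2 * pi * \<i> * Complex x y) - 1) \<le> 2 * kern a y" .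
  have f2: "norm (exp (2 * pi * \<i> * a * Complex x y)) = exp (- 2 * pi * a * y)" by (simp add: mult_ac)
  have f3: "of_real c + Complex x y = Complex (c + x) y" by (simp add: complex_eq_iff)
  show ?thesis
    unfolding lerch_integrand_def norm_mult norm_divide f2 f3
    using mult_left_mono[OF f1, of "cmod (Complex (c + x) y powr (- s))"] by simp
qed

lemma powr_kern_tendsto_0:
  assumes "0 < a" "a < 1"
  shows "((\<lambda>y. (1 + \<bar>y\<bar>) powr p * kern a y) \<longlongrightarrow> 0) at_infinity"
proof -
  define \<mu> where "\<mu> = 2 * pi * min a (1 - a)"
  have \<mu>: "\<mu> > 0" using assms by (simp add: \<mu>_def)
  obtain C where C: "C > 0" "\<And>y. (1 + \<bar>y\<bar>) powr p \<le> C * exp (\<mu> / 2 * \<bar>y\<bar>)"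
    using powr_le_exp[of "\<mu> / 2" p] \<mu> by auto
  have "norm ((1 + \<bar>y\<bar>) powr p * kern a y) \<le> C * exp (- (\<mu> / 2) * \<bar>y\<bar>)" for y
  proof -
    have "(1 + \<bar>y\<bar>) powr p * kern a y \<le> (C * exp (\<mu> / 2 * \<bar>y\<bar>)) * exp (- \<mu> * \<bar>y\<bar>)"
      unfolding \<mu>_def by (intro mult_mono C(2)[unfolded \<mu>_def] kern_le_exp_abs) (use C kern_pos[of a y] in auto)
    also have "\<dots> = C * exp (- (\<mu> / 2) * \<bar>y\<bar>)" by (simp flip: exp_add)
    finally show ?thesis using kern_pos[of a y] by (simp add: abs_mult)
  qed
  then have *: "\<forall>\<^sub>F y in at_infinity. norm ((1 + \<bar>y\<bar>) powr p * kern a y) \<le> C * exp (- (\<mu> / 2) * norm y)"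
    by simp
  have "((\<lambda>t. C * exp (- (\<mu> / 2) * t)) \<longlongrightarrow> 0) at_top"
    using \<mu> by real_asymp
  then have "((\<lambda>y::real. C * exp (- (\<mu> / 2) * norm y)) \<longlongrightarrow> 0) at_infinity"
    by (rule filterlim_compose[OF _ filterlim_norm_at_top])
  with * show ?thesis by (rule Lim_null_comparison)
qed

text \<open>Residue theorem on the rectangle between the lines Re z = -1/2 and Re z = 1/2 and the
  heights -t and t, which encloses only the pole at 0; the horizontal sides vanish in the limit. The
  condition \<open>c > 1 / 2\<close> gives c + z a positive real part on the left line too.\<close>

lemma lerch_int_shift:
  assumes a: "0 < a" "a < 1" and c: "c > 1 / 2"
  shows "\<i> * (cis (- pi * a) * lerch_int s a (c - 1 / 2) - cis (pi * a) * lerch_int s a (c + 1 / 2))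
    = of_real c powr (- s)"
proof -
  define f where "f = lerch_integrand s a c"
  define S where "S = {z. \<bar>Re z\<bar> < 1 \<and> - c < Re z}"
  define l where "l = (\<lambda>t. Complex (- 1 / 2) t)"
  define r where "r = (\<lambda>t. Complex (1 / 2) t)"
  have S: "open S" "connected S"
  proof -
    show "open S" unfolding S_def by (intro open_Collect_conj open_Collect_less continuous_intros)
    have "S = {z. Re z < 1} \<inter> {z. Re z > - 1} \<inter> {z. Re z > - c}" by (auto simp: S_def)
    then show "connected S"
      by (auto intro!: convex_connected convex_Int convex_halfspace_Re_lt convex_halfspace_Re_gt)
  qed
  have holo: "f holomorphic_on S - {0}"
    unfolding f_def S_def by (rule lerch_integrand_holomorphic)
  have rect: "contour_integral (rectpath (l (- t)) (r t)) f = of_real c powr (- s)"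
    and path: "path_image (rectpath (l (- t)) (r t)) \<subseteq> S - {0}" if t: "t > 0" for t
  proof -
    have cb: "cbox (l (- t)) (r t) \<subseteq> S" using c by (auto simp: S_def l_def r_def in_cbox_complex_iff)
    have zb: "0 \<in> box (l (- t)) (r t)" using t by (simp add: l_def r_def in_box_complex_iff)
    show path: "path_image (rectpath (l (- t)) (r t)) \<subseteq> S - {0}"
      using cb zb t by (subst path_image_rectpath_cbox_minus_box) (auto simp: l_def r_def)
    have "contour_integral (rectpath (l (- t)) (r t)) f =
        2 * pi * \<i> * (\<Sum>p\<in>{0}. winding_number (rectpath (l (- t)) (r t)) p * residue f p)"
    proof (rule Residue_theorem)
      show "\<forall>z. z \<notin> S \<longrightarrow> winding_number (rectpath (l (- t)) (r t)) z = 0"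
        using cb t by (intro allI impI winding_number_rectpath_outside) (auto simp: l_def r_def)
    qed (use S holo path in auto)
    then show "contour_integral (rectpath (l (- t)) (r t)) f = of_real c powr (- s)"
      using winding_number_rectpath[OF zb] residue_lerch_integrand[of c s a] c by (simp add: f_def)
  qed
  define V where "V = (\<lambda>d y. Complex d y powr (- s) * of_real (kern a y))"
  define H where "H = (\<lambda>t. contour_integral (linepath (l t) (r t)) f)"
  have V: "integrable lborel (V (c - 1 / 2))" "integrable lborel (V (c + 1 / 2))"
    unfolding V_def using a c by (auto intro!: integrable_powr_Complex_kern)
  \<comment> \<open>The four sides written out: \<open>H (- t)\<close> is the bottom and
    \<open>- H t\<close> the top, while the vertical sides carry the factor i from dz = i
    dy.\<close>
  have eq: "H (- t) - \<i> * cis (pi * a) * integral {- t..t} (V (c + 1 / 2)) - H t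
      + \<i> * cis (- pi * a) * integral {- t..t} (V (c - 1 / 2)) = of_real c powr (- s)" if t: "t > 0" for t
  proof -
    have "continuous_on (path_image (rectpath (l (- t)) (r t))) f"
      using holomorphic_on_imp_continuous_on[OF holo] path[OF t] continuous_on_subset by blast
    then have "contour_integral (rectpath (l (- t)) (r t)) f =
        contour_integral (linepath (l (- t)) (r (- t))) f + contour_integral (linepath (r (- t)) (r t)) f
        + contour_integral (linepath (r t) (l t)) f + contour_integral (linepath (l t) (l (- t))) f"
      by (subst contour_integral_rectpath) (use t in \<open>auto simp: l_def r_def\<close>)
    moreover have "contour_integral (linepath (r t) (l t)) f = - H t"
      unfolding H_def by (metis contour_integral_reversepath reversepath_linepath valid_path_linepath)
    moreover have "contour_integral (linepath (l t) (l (- t))) f = - contour_integral (linepath (l (- t)) (l t)) f"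
      by (metis contour_integral_reversepath reversepath_linepath valid_path_linepath)
    moreover have "contour_integral (linepath (l (- t)) (l t)) f = - (\<i> * cis (- pi * a) * integral {- t..t} (V (c - 1 / 2)))"
    proof -
      have "contour_integral (linepath (l (- t)) (l t)) f = \<i> * integral {- t..t} (\<lambda>y. f (Complex (- 1 / 2) y))"
        using t by (intro contour_integral_linepath_same_Re) (auto simp: l_def)
      also have "(\<lambda>y. f (Complex (- 1 / 2) y)) = (\<lambda>y. - cis (- pi * a) * V (c - 1 / 2) y)"
        unfolding f_def lerch_integrand_left V_def by simp
      finally show ?thesis by simp
    qed
    moreover have "contour_integral (linepath (r (- t)) (r t)) f = - (\<i> * cis (pi * a) * integral {- t..t} (V (c + 1 / 2)))"
    proof -
      have "contour_integral (linepath (r (- t)) (r t)) f = \<i> * integral {- t..t} (\<lambda>y. f (Complex (1 / 2) y))"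
        using t by (intro contour_integral_linepath_same_Re) (auto simp: r_def)
      also have "(\<lambda>y. f (Complex (1 / 2) y)) = (\<lambda>y. - cis (pi * a) * V (c + 1 / 2) y)"
        unfolding f_def lerch_integrand_right V_def by simp
      finally show ?thesis by simp
    qed
    ultimately show ?thesis using rect[OF t] by (simp add: H_def)
  qed
  obtain C where C: "C > 0" "\<And>d y. c - 1 / 2 \<le> d \<Longrightarrow> d \<le> c + 1 / 2 \<Longrightarrow>
      cmod (Complex d y powr (- s)) \<le> C * (1 + \<bar>y\<bar>) powr Re (- s)"
    using norm_powr_Complex_le_uniform[of "c - 1 / 2" "c + 1 / 2" "- s"] c by auto
  have bound: "norm (H t) \<le> 2 * C * ((1 + \<bar>t\<bar>) powr Re (- s) * kern a t)" if t: "\<bar>t\<bar> \<ge> 1" for t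
  proof -
    have seg: "z = Complex (Re z) t \<and> Re z \<in> {- 1 / 2..1 / 2}" if "z \<in> closed_segment (l t) (r t)" for z
      using that by (subst (asm) closed_segment_same_Im) (auto simp: l_def r_def complex_eq_iff closed_segment_eq_real_ivl)
    have "norm (H t) \<le> 2 * C * ((1 + \<bar>t\<bar>) powr Re (- s) * kern a t) * norm (r t - l t)"
      unfolding H_def
    proof (rule contour_integral_bound_linepath)
      have "S - {0} \<supseteq> closed_segment (l t) (r t)"
      proof
        fix z assume "z \<in> closed_segment (l t) (r t)"
        then have z: "Im z = t" "Re z \<in> {- 1 / 2..1 / 2}" using seg[of z] by (metis complex.sel(2), blast)
        then show "z \<in> S - {0}" using t c by (auto simp: S_def)
      qed
      then show "f contour_integrable_on linepath (l t) (r t)"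
        using holomorphic_on_imp_continuous_on[OF holo] continuous_on_subset
        by (blast intro: contour_integrable_continuous_linepath)
      show "0 \<le> 2 * C * ((1 + \<bar>t\<bar>) powr Re (- s) * kern a t)"
        using C(1) kern_pos[of a t] by simp
      fix z assume "z \<in> closed_segment (l t) (r t)"
      then obtain x where z: "z = Complex x t" "x \<in> {- 1 / 2..1 / 2}" using seg by blast
      have "norm (f z) \<le> cmod (Complex (c + x) t powr (- s)) * (2 * kern a t)"
        unfolding z f_def by (rule norm_lerch_integrand_le[OF t])
      also have "\<dots> \<le> C * (1 + \<bar>t\<bar>) powr Re (- s) * (2 * kern a t)"
        using z kern_pos[of a t] by (intro mult_right_mono C) auto
      finally show "norm (f z) \<le> 2 * C * ((1 + \<bar>t\<bar>) powr Re (- s) * kern a t)" by (simp add: mult_ac)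
    qed
    also have "r t - l t = 1" by (simp add: r_def l_def complex_eq_iff)
    finally show ?thesis by simp
  qed
  have "((\<lambda>t. 2 * C * ((1 + \<bar>t\<bar>) powr Re (- s) * kern a t)) \<longlongrightarrow> 0) at_infinity"
    using powr_kern_tendsto_0[OF a] by (rule tendsto_mult_right_zero)
  moreover have "\<forall>\<^sub>F t::real in at_infinity. 1 \<le> \<bar>t\<bar>"
    unfolding eventually_at_infinity by (auto intro!: exI[of _ 1])
  then have "\<forall>\<^sub>F t in at_infinity. norm (H t) \<le> 2 * C * ((1 + \<bar>t\<bar>) powr Re (- s) * kern a t)"
    by eventually_elim (rule bound)
  ultimately have H: "(H \<longlongrightarrow> 0) at_infinity"
    by (rule Lim_null_comparison[rotated])
  have "filterlim (\<lambda>n. - real n) at_bot sequentially"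
    using filterlim_real_sequentially by (simp add: filterlim_uminus_at_top)
  then have inf: "filterlim (\<lambda>n. - real n) at_infinity sequentially" "filterlim real at_infinity sequentially"
    using filterlim_at_bot_imp_at_infinity filterlim_at_top_imp_at_infinity filterlim_real_sequentially by blast+
  have lim: "(\<lambda>n. H (- real n) - \<i> * cis (pi * a) * integral {- real n..real n} (V (c + 1 / 2)) - H (real n)
      + \<i> * cis (- pi * a) * integral {- real n..real n} (V (c - 1 / 2)))
     \<longlonglongrightarrow> 0 - \<i> * cis (pi * a) * (\<integral>y. V (c + 1 / 2) y \<partial>lborel) - 0 + \<i> * cis (- pi * a) * (\<integral>y. V (c - 1 / 2) y \<partial>lborel)"
    by (intro tendsto_intros filterlim_compose[OF H] inf tendsto_integral_symmetric_interval V)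
  have ev: "\<forall>\<^sub>F n in sequentially. H (- real n) - \<i> * cis (pi * a) * integral {- real n..real n} (V (c + 1 / 2)) - H (real n)
      + \<i> * cis (- pi * a) * integral {- real n..real n} (V (c - 1 / 2)) = of_real c powr (- s)"
    using eventually_gt_at_top[of 0] by eventually_elim (rule eq, simp)
  have "0 - \<i> * cis (pi * a) * (\<integral>y. V (c + 1 / 2) y \<partial>lborel) - 0 + \<i> * cis (- pi * a) * (\<integral>y. V (c - 1 / 2) y \<partial>lborel)
      = of_real c powr (- s)"
    using LIMSEQ_unique[OF Lim_transform_eventually[OF lim ev] tendsto_const] .
  then show ?thesis by (simp add: V_def lerch_int_def algebra_simps)
qed

subsection \<open>The Lerch functions as entire continuations\<close>

text \<open>
  The term \<open>n = 0\<close> is split off, which moves the line to \<open>Re z = 1/2\<close>: the representation is then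
  valid for all \<open>c > 0\<close>.
\<close>

definition lerch_phi :: "complex \<Rightarrow> real \<Rightarrow> real \<Rightarrow> complex" where
  "lerch_phi s a c = of_real c powr (- s) + \<i> * cis (pi * a) * lerch_int s a (c + 1 / 2)"

text \<open>The shift of the line is applied at \<open>c + 1\<close>, which exceeds 1/2 for every
  positive \<open>c\<close>. On the level of the series it removes the first term, but here
  \<open>s\<close> is arbitrary.\<close>

lemma lerch_phi_rec:
  assumes "0 < a" "a < 1" "c > 0"
  shows "lerch_phi s a c = of_real c powr (- s) + e2pi a * lerch_phi s a (c + 1)"
proof -
  have "\<i> * (cis (- pi * a) * lerch_int s a (c + 1 / 2) - cis (pi * a) * lerch_int s a (c + 3 / 2)) = of_real (c + 1) powr (- s)"
    using lerch_int_shift[of a "c + 1" s] assms by (simp add: add.commute)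
  then have "e2pi a * (of_real (c + 1) powr (- s) + \<i> * cis (pi * a) * lerch_int s a (c + 3 / 2)) =
      e2pi a * (\<i> * cis (- pi * a) * lerch_int s a (c + 1 / 2))"
    by (simp add: algebra_simps)
  also have "\<dots> = \<i> * (e2pi a * cis (- pi * a)) * lerch_int s a (c + 1 / 2)" by (simp add: mult_ac)
  also have "e2pi a * cis (- pi * a) = cis (pi * a)" by (simp add: cis_mult algebra_simps)
  finally show ?thesis by (simp add: lerch_phi_def add.commute)
qed

text \<open>Iterating the recurrence N times leaves a unimodular multiple of
  \<open>lerch_phi s a (c + real N)\<close> as remainder; for \<open>Re s > 0\<close> both the power
  and the integral in it tend to 0.\<close>

lemma lerch_phi_sums:
  assumes "0 < a" "a < 1" "c > 0" "Re s > 0"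
  shows "(\<lambda>n. e2pi (real n * a) * of_real (real n + c) powr (- s)) sums lerch_phi s a c"
proof -
  have part: "(\<Sum>n<N. e2pi (real n * a) * of_real (real n + c) powr (- s)) =
      lerch_phi s a c - e2pi (real N * a) * lerch_phi s a (c + real N)" for N
  proof (induction N)
    case (Suc N)
    have "lerch_phi s a (c + real N) = of_real (real N + c) powr (- s) + e2pi a * lerch_phi s a (c + real (Suc N))"
      using lerch_phi_rec[of a "c + real N" s] assms by (simp add: add_ac)
    moreover have "e2pi (real (Suc N) * a) = e2pi (real N * a) * e2pi a" by (simp add: cis_mult algebra_simps)
    ultimately show ?case using Suc by (simp add: algebra_simps)
  qed simp
  have "filterlim (\<lambda>n. c + real n) at_top sequentially"
    by (intro filterlim_tendsto_add_at_top[OF tendsto_const] filterlim_real_sequentially)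
  then have "(\<lambda>n. (c + real n) powr (- Re s)) \<longlonglongrightarrow> 0"
    using assms by (intro tendsto_neg_powr) auto
  then have "(\<lambda>n. complex_of_real (c + real n) powr (- s)) \<longlonglongrightarrow> 0"
    by (rule Lim_null_comparison[rotated])
       (use assms in \<open>auto simp: norm_powr_real_powr intro!: always_eventually simp del: of_real_add\<close>)
  moreover have "(\<lambda>n. lerch_int s a (c + 1 / 2 + real n)) \<longlonglongrightarrow> 0"
    using assms by (intro lerch_int_tendsto_0) auto
  ultimately have "(\<lambda>n. complex_of_real (c + real n) powr (- s) + \<i> * cis (pi * a) * lerch_int s a (c + 1 / 2 + real n)) \<longlonglongrightarrow> 0 + \<i> * cis (pi * a) * 0"
    by (intro tendsto_intros)
  then have "(\<lambda>n. lerch_phi s a (c + real n)) \<longlonglongrightarrow> 0"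
    by (simp add: lerch_phi_def add_ac)
  then have "(\<lambda>n. e2pi (real n * a) * lerch_phi s a (c + real n)) \<longlonglongrightarrow> 0"
    by (rule tendsto_norm_zero_cancel[OF Lim_null_comparison[rotated, OF tendsto_norm_zero]]) (auto simp: norm_mult)
  then show ?thesis
    unfolding sums_def part using tendsto_diff[OF tendsto_const] by fastforce
qed

lemma lerch_phi_entire:
  assumes "0 < a" "a < 1" "c > 0"
  shows "(\<lambda>s. lerch_phi s a c) holomorphic_on UNIV"
proof -
  have "(\<lambda>s. complex_of_real c powr (- s)) holomorphic_on UNIV"
    using assms unfolding powr_def by (auto intro!: holomorphic_intros)
  moreover have "(\<lambda>s. lerch_int s a (c + 1 / 2)) holomorphic_on UNIV"
    using assms by (intro lerch_int_entire) auto
  ultimately show ?thesis unfolding lerch_phi_def by (intro holomorphic_intros)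
qed

text \<open>The weight \<open>w\<close> of the negative arguments is \<open>1\<close> for \<open>L\<^sup>+\<close> and \<open>- 1\<close> for \<open>L\<^sup>-\<close>.\<close>

definition lerch_term :: "complex \<Rightarrow> complex \<Rightarrow> real \<Rightarrow> real \<Rightarrow> int \<Rightarrow> complex" where
  "lerch_term w s a c n =
     (if of_int n + c > 0 then 1 else w) * e2pi (of_int n * a) * of_real \<bar>of_int n + c\<bar> powr (- s)"

text \<open>The second summand is the sum over negative indices when 0 < c < 1: for n = -k - 1 one
  has |n + c| = k + (1 - c) and \<open>e2pi\<close> of n a is \<open>e2pi\<close> of -a times
  \<open>e2pi\<close> of k (1 - a), which is again a one-sided series, with \<open>a\<close> and
  \<open>c\<close> reflected.\<close>

definition lerch_base :: "complex \<Rightarrow> complex \<Rightarrow> real \<Rightarrow> real \<Rightarrow> complex" where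
  "lerch_base w s a c = lerch_phi s a c + w * e2pi (- a) * lerch_phi s (1 - a) (1 - c)"

lemma e2pi_add_int: "e2pi (x + of_int n) = e2pi x"
proof -
  have "2 * pi * (x + of_int n) = 2 * pi * x + 2 * pi * of_int n" by (simp add: distrib_left)
  then show ?thesis by (simp add: complex_eq_iff cos_add sin_add)
qed

lemma e2pi_mult: "e2pi x * e2pi y = e2pi (x + y)"
  by (simp add: cis_mult distrib_left)

lemma filterlim_uminus_int_at_top:
  fixes p :: "'a \<Rightarrow> int"
  assumes "filterlim p at_bot F"
  shows "filterlim (\<lambda>N. - p N) at_top F"
  unfolding filterlim_at_top
proof
  fix Z
  have "\<forall>\<^sub>F N in F. p N \<le> - Z" using assms by (simp add: filterlim_at_bot)
  then show "\<forall>\<^sub>F N in F. Z \<le> - p N" by eventually_elim simp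
qed

lemma filterlim_int_add_const:
  fixes p :: "'a \<Rightarrow> int"
  shows "filterlim p at_top F \<Longrightarrow> filterlim (\<lambda>N. p N + k) at_top F"
    and "filterlim p at_bot F \<Longrightarrow> filterlim (\<lambda>N. p N + k) at_bot F"
proof -
  show "filterlim p at_top F \<Longrightarrow> filterlim (\<lambda>N. p N + k) at_top F"
    unfolding filterlim_at_top
  proof
    fix Z assume "\<forall>Z. \<forall>\<^sub>F N in F. Z \<le> p N"
    then have "\<forall>\<^sub>F N in F. Z - k \<le> p N" by blast
    then show "\<forall>\<^sub>F N in F. Z \<le> p N + k" by eventually_elim simp
  qed
  show "filterlim p at_bot F \<Longrightarrow> filterlim (\<lambda>N. p N + k) at_bot F"
    unfolding filterlim_at_bot
  proof
    fix Z assume "\<forall>Z. \<forall>\<^sub>F N in F. p N \<le> Z"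
    then have "\<forall>\<^sub>F N in F. p N \<le> Z - k" by blast
    then show "\<forall>\<^sub>F N in F. p N + k \<le> Z" by eventually_elim simp
  qed
qed

lemma filterlim_uminus_int_at_bot: "filterlim (\<lambda>N. - int N) at_bot sequentially"
  unfolding filterlim_at_bot
proof
  fix Z
  have "\<forall>\<^sub>F N in sequentially. - Z \<le> int N"
    using filterlim_int_sequentially by (simp add: filterlim_at_top)
  then show "\<forall>\<^sub>F N in sequentially. - int N \<le> Z" by eventually_elim simp
qed

text \<open>The two one-sided series converge separately, so the ends \<open>p\<close> and
  \<open>q\<close> may move independently. This freedom absorbs the shift of the index by the
  integer part of \<open>c\<close> and the stretching of the range by \<open>m\<close>.\<close>

lemma lerch_term_tendsto:
  assumes "0 < a" "a < 1" "0 < c" "c < 1" "Re s > 0"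
    and p: "filterlim p at_bot sequentially" and q: "filterlim q at_top sequentially"
  shows "(\<lambda>N. \<Sum>n\<in>{p N..<q N}. lerch_term w s a c n) \<longlonglongrightarrow> lerch_base w s a c"
proof -
  define A where "A = (\<lambda>N. \<Sum>n<N. e2pi (real n * a) * of_real (real n + c) powr (- s))"
  define B where "B = (\<lambda>N. \<Sum>n<N. e2pi (real n * (1 - a)) * of_real (real n + (1 - c)) powr (- s))"
  have A: "A \<longlonglongrightarrow> lerch_phi s a c"
    unfolding A_def using lerch_phi_sums[of a c s] assms by (simp add: sums_def)
  have B: "B \<longlonglongrightarrow> lerch_phi s (1 - a) (1 - c)"
    unfolding B_def using lerch_phi_sums[of "1 - a" "1 - c" s] assms by (simp add: sums_def)
  have pos: "(\<Sum>n\<in>{0..<int N}. lerch_term w s a c n) = A N" for N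
  proof -
    have "(\<Sum>n\<in>{0..<int N}. lerch_term w s a c n) = (\<Sum>n<N. lerch_term w s a c (int n))"
      by (rule sum.reindex_bij_witness[of _ int nat]) auto
    also have "\<dots> = A N"
      unfolding A_def using assms by (intro sum.cong) (auto simp: lerch_term_def add_nonneg_pos)
    finally show ?thesis .
  qed
  have neg: "(\<Sum>n\<in>{- int N..<0}. lerch_term w s a c n) = w * e2pi (- a) * B N" for N
  proof -
    have "(\<Sum>n\<in>{- int N..<0}. lerch_term w s a c n) = (\<Sum>n<N. lerch_term w s a c (- int n - 1))"
      by (rule sum.reindex_bij_witness[of _ "\<lambda>n. - int n - 1" "\<lambda>n. nat (- n - 1)"]) auto
    also have "\<dots> = (\<Sum>n<N. w * e2pi (- a) * (e2pi (real n * (1 - a)) * of_real (real n + (1 - c)) powr (- s)))"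
    proof (intro sum.cong refl)
      fix n
      have "e2pi (- a) * e2pi (real n * (1 - a)) = e2pi (of_int (- int n - 1) * a + of_int (int n))"
        unfolding e2pi_mult by (rule arg_cong[of _ _ e2pi]) (simp add: algebra_simps)
      then have "e2pi (- a) * e2pi (real n * (1 - a)) = e2pi (of_int (- int n - 1) * a)"
        by (simp only: e2pi_add_int)
      moreover have "\<not> of_int (- int n - 1) + c > 0" "\<bar>of_int (- int n - 1) + c\<bar> = real n + (1 - c)"
        using assms by auto
      ultimately show "lerch_term w s a c (- int n - 1) =
          w * e2pi (- a) * (e2pi (real n * (1 - a)) * of_real (real n + (1 - c)) powr (- s))"
        unfolding lerch_term_def by (simp only: if_False mult.assoc[symmetric]) (simp add: mult.assoc)
    qed
    also have "\<dots> = w * e2pi (- a) * B N" by (simp add: B_def sum_distrib_left)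
    finally show ?thesis .
  qed
  have "filterlim (\<lambda>N. nat (q N)) at_top sequentially"
    by (rule filterlim_compose[OF filterlim_nat_sequentially q])
  moreover have "filterlim (\<lambda>N. nat (- p N)) at_top sequentially"
    by (rule filterlim_compose[OF filterlim_nat_sequentially]) (rule filterlim_uminus_int_at_top[OF p])
  ultimately have "(\<lambda>N. A (nat (q N)) + w * e2pi (- a) * B (nat (- p N))) \<longlonglongrightarrow> lerch_base w s a c"
    unfolding lerch_base_def by (intro tendsto_intros filterlim_compose[OF A] filterlim_compose[OF B])
  \<comment> \<open>Once \<open>p N\<close> \<le> 0 \<le> \<open>q N\<close>, the range splits at 0
    and the conversions by \<open>nat\<close> are exact.\<close>
  moreover have "\<forall>\<^sub>F N in sequentially. p N \<le> 0 \<and> q N \<ge> 0"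
    using p q by (simp add: filterlim_at_bot filterlim_at_top eventually_conj)
  then have "\<forall>\<^sub>F N in sequentially. A (nat (q N)) + w * e2pi (- a) * B (nat (- p N)) = (\<Sum>n\<in>{p N..<q N}. lerch_term w s a c n)"
  proof eventually_elim
    case (elim N)
    then have "{p N..<q N} = {- int (nat (- p N))..<0} \<union> {0..<int (nat (q N))}" by auto
    then show ?case using pos[of "nat (q N)"] neg[of "nat (- p N)"]
      by (simp only:) (subst sum.union_disjoint, auto)
  qed
  ultimately show ?thesis by (rule Lim_transform_eventually)
qed

text \<open>The extension of \<open>lerch_base\<close> from the open unit square by the expected
  quasi-periodicity. The weights 1 and -1 will be identified with \<open>Lplus\<close> and
  \<open>Lminus\<close>.\<close>

definition lerch_fun :: "complex \<Rightarrow> complex \<Rightarrow> real \<Rightarrow> real \<Rightarrow> complex" where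
  "lerch_fun w s a c = e2pi (- (of_int \<lfloor>c\<rfloor> * a)) * lerch_base w s (frac a) (frac c)"

lemma frac_bounds: "x \<notin> \<int> \<Longrightarrow> 0 < frac x" "frac x < 1"
  by (auto simp: frac_gt_0_iff frac_lt_1)

lemma lerch_term_frac:
  "lerch_term w s a c n = e2pi (- (of_int \<lfloor>c\<rfloor> * a)) * lerch_term w s (frac a) (frac c) (n + \<lfloor>c\<rfloor>)"
proof -
  have "of_int (n + \<lfloor>c\<rfloor>) + frac c = of_int n + c" by (simp add: frac_def)
  moreover have "e2pi (- (of_int \<lfloor>c\<rfloor> * a)) * e2pi (of_int (n + \<lfloor>c\<rfloor>) * frac a) =
     e2pi (of_int n * a + of_int (- (n + \<lfloor>c\<rfloor>) * \<lfloor>a\<rfloor>))"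
    unfolding e2pi_mult by (rule arg_cong[of _ _ e2pi]) (simp add: frac_def algebra_simps)
  then have "e2pi (of_int n * a) = e2pi (- (of_int \<lfloor>c\<rfloor> * a)) * e2pi (of_int (n + \<lfloor>c\<rfloor>) * frac a)"
    by (simp only: e2pi_add_int)
  ultimately show ?thesis unfolding lerch_term_def by (simp only: mult_ac)
qed

lemma lerch_fun_tendsto:
  assumes "a \<notin> \<int>" "c \<notin> \<int>" "Re s > 0"
    and p: "filterlim p at_bot sequentially" and q: "filterlim q at_top sequentially"
  shows "(\<lambda>N. \<Sum>n\<in>{p N..<q N}. lerch_term w s a c n) \<longlonglongrightarrow> lerch_fun w s a c"
proof -
  have "(\<lambda>N. e2pi (- (of_int \<lfloor>c\<rfloor> * a)) * (\<Sum>n\<in>{p N + \<lfloor>c\<rfloor>..<q N + \<lfloor>c\<rfloor>}. lerch_term w s (frac a) (frac c) n)) \<longlonglongrightarrow> lerch_fun w s a c"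
    unfolding lerch_fun_def using assms frac_bounds
    by (intro tendsto_mult_left lerch_term_tendsto filterlim_int_add_const p q) auto
  moreover have "(\<Sum>n\<in>{p N + \<lfloor>c\<rfloor>..<q N + \<lfloor>c\<rfloor>}. lerch_term w s (frac a) (frac c) n) =
      (\<Sum>n\<in>{p N..<q N}. lerch_term w s (frac a) (frac c) (n + \<lfloor>c\<rfloor>))" for N
    by (rule sum.reindex_bij_witness[of _ "\<lambda>n. n + \<lfloor>c\<rfloor>" "\<lambda>n. n - \<lfloor>c\<rfloor>"]) auto
  ultimately show ?thesis
    by (simp add: lerch_term_frac[of w s a c] sum_distrib_left)
qed

lemma lerch_fun_entire:
  assumes "a \<notin> \<int>" "c \<notin> \<int>"
  shows "(\<lambda>s. lerch_fun w s a c) holomorphic_on UNIV"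
  unfolding lerch_fun_def lerch_base_def using frac_bounds assms
  by (intro holomorphic_intros lerch_phi_entire) auto

text \<open>Entire functions with the same limits agree on the half plane Re z > 0 and hence, by the
  identity theorem, everywhere. This resolves the definite descriptions in \<open>Lplus\<close> and
  \<open>Lminus\<close>.\<close>

lemma the_entire_extension_eq:
  assumes "f holomorphic_on UNIV" "\<And>z. Re z > 0 \<Longrightarrow> (\<lambda>N. g N z) \<longlonglongrightarrow> f z"
  shows "(THE f. f holomorphic_on UNIV \<and> (\<forall>z. Re z > 0 \<longrightarrow> (\<lambda>N. g N z) \<longlonglongrightarrow> f z)) = f"
proof (rule the_equality)
  fix h assume h: "h holomorphic_on UNIV \<and> (\<forall>z. Re z > 0 \<longrightarrow> (\<lambda>N. g N z) \<longlonglongrightarrow> h z)"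
  show "h = f"
  proof
    fix z
    show "h z = f z"
    proof (rule analytic_continuation_open[of "{z. Re z > 0}" UNIV h f])
      show "h w = f w" if "w \<in> {z. Re z > 0}" for w
        using h assms(2)[of w] that LIMSEQ_unique by blast
      show "{z. Re z > 0} \<noteq> {}" by (auto intro!: exI[of _ 1])
    qed (use h assms in \<open>auto simp: open_halfspace_Re_gt\<close>)
  qed
qed (use assms in auto)

lemma Lplus_eq:
  assumes "a \<notin> \<int>" "c \<notin> \<int>"
  shows "Lplus s a c = lerch_fun 1 s a c"
proof -
  have "(\<lambda>N. Lplus_partial N z a c) \<longlonglongrightarrow> lerch_fun 1 z a c" if "Re z > 0" for z
  proof -
    \<comment> \<open>The closed symmetric range from -N to N is the half-open one ending at N +
      1.\<close>
    have "(\<lambda>N. \<Sum>n\<in>{- int N..<int N + 1}. lerch_term 1 z a c n) \<longlonglongrightarrow> lerch_fun 1 z a c"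
      using assms that
      by (intro lerch_fun_tendsto filterlim_uminus_int_at_bot filterlim_int_add_const filterlim_int_sequentially)
    then show ?thesis
      by (simp add: Lplus_partial_def lerch_term_def atLeastLessThanPlusOne_atLeastAtMost_int)
  qed
  then show ?thesis
    unfolding Lplus_def using the_entire_extension_eq[OF lerch_fun_entire[OF assms, of 1], of "\<lambda>N z. Lplus_partial N z a c"]
    by simp
qed

lemma Lminus_eq:
  assumes "a \<notin> \<int>" "c \<notin> \<int>"
  shows "Lminus s a c = lerch_fun (- 1) s a c"
proof -
  have "(\<lambda>N. Lminus_partial N z a c) \<longlonglongrightarrow> lerch_fun (- 1) z a c" if "Re z > 0" for z
  proof -
    \<comment> \<open>As \<open>c\<close> is not an integer, \<open>sgn\<close> takes only the
      values 1 and -1, which are the weights in \<open>lerch_term (- 1)\<close>.\<close>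
    have nz: "of_int n + c \<noteq> 0" for n
      using assms(2) by (metis Ints_minus Ints_of_int add_eq_0_iff2 minus_minus)
    have "(\<lambda>N. \<Sum>n\<in>{- int N..<int N + 1}. lerch_term (- 1) z a c n) \<longlonglongrightarrow> lerch_fun (- 1) z a c"
      using assms that
      by (intro lerch_fun_tendsto filterlim_uminus_int_at_bot filterlim_int_add_const filterlim_int_sequentially)
    moreover have "of_real (sgn (of_int n + c)) * e2pi (of_int n * a) * of_real \<bar>of_int n + c\<bar> powr (- z) = lerch_term (- 1) z a c n" for n
      using nz[of n] by (auto simp: lerch_term_def sgn_if)
    ultimately show ?thesis
      by (simp add: Lminus_partial_def atLeastLessThanPlusOne_atLeastAtMost_int)
  qed
  then show ?thesis
    unfolding Lminus_def using the_entire_extension_eq[OF lerch_fun_entire[OF assms, of "- 1"], of "\<lambda>N z. Lminus_partial N z a c"]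
    by simp
qed

subsection \<open>Quasi-periodicity, analyticity and growth\<close>

lemma lerch_fun_quasi_periodic:
  "lerch_fun w s (a + of_int n) c = lerch_fun w s a c"
  "lerch_fun w s a (c + of_int n) = e2pi (- (of_int n * a)) * lerch_fun w s a c"
proof -
  have [simp]: "frac (x + of_int n) = frac x" for x :: real by (simp add: frac_def)
  have "e2pi (- (of_int \<lfloor>c\<rfloor> * (a + of_int n))) = e2pi (- (of_int \<lfloor>c\<rfloor> * a) + of_int (- \<lfloor>c\<rfloor> * n))"
    by (rule arg_cong[of _ _ e2pi]) (simp add: algebra_simps)
  then show "lerch_fun w s (a + of_int n) c = lerch_fun w s a c"
    by (simp only: e2pi_add_int) (simp add: lerch_fun_def)
  have "e2pi (- (of_int \<lfloor>c + of_int n\<rfloor> * a)) = e2pi (- (of_int n * a)) * e2pi (- (of_int \<lfloor>c\<rfloor> * a))"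
    unfolding e2pi_mult by (rule arg_cong[of _ _ e2pi]) (simp add: algebra_simps)
  then show "lerch_fun w s a (c + of_int n) = e2pi (- (of_int n * a)) * lerch_fun w s a c"
    by (simp only: lerch_fun_def) simp
qed

lemma lerch_fun_eq_base: "0 < a \<Longrightarrow> a < 1 \<Longrightarrow> 0 < c \<Longrightarrow> c < 1 \<Longrightarrow> lerch_fun w s a c = lerch_base w s a c"
proof -
  assume "0 < a" "a < 1" "0 < c" "c < 1"
  then have "\<lfloor>c\<rfloor> = 0" "frac a = a" "frac c = c" by (auto simp: frac_eq floor_eq_iff)
  then show ?thesis by (simp add: lerch_fun_def)
qed

lemma real_analytic2_on_affine_snd:
  fixes p q :: real
  assumes "real_analytic2_on f T" "\<And>x y. (x, y) \<in> S \<Longrightarrow> (x, p * y + q) \<in> T" "\<bar>p\<bar> = 1"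
  shows "real_analytic2_on (\<lambda>(x, y). f (x, p * y + q)) S"
proof -
  have "real_analytic2_on (\<lambda>(x, y). f (y, x)) (prod.swap ` T)"
    by (rule real_analytic2_on_swap[OF assms(1)]) auto
  then have "real_analytic2_on (\<lambda>(x, y). case (p * x + q, y) of (x, y) \<Rightarrow> f (y, x)) (prod.swap ` S)"
    by (rule real_analytic2_on_affine_fst) (use assms in force)+
  then have "real_analytic2_on (\<lambda>(x, y). case (y, x) of (x, y) \<Rightarrow> case (p * x + q, y) of (x, y) \<Rightarrow> f (y, x)) S"
    by (rule real_analytic2_on_swap) force
  then show ?thesis by simp
qed

lemma real_analytic2_on_e2pi_fst: "real_analytic2_on (\<lambda>(x, y). e2pi (q * x)) S"
proof -
  have "real_analytic2_on (\<lambda>(x, y). exp (\<i> * (2 * pi * q) * of_real x)) S"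
    by (rule real_analytic2_on_fst[where T = UNIV]) (auto intro!: holomorphic_intros)
  then show ?thesis by (simp add: cis_conv_exp mult_ac)
qed

lemma real_analytic2_on_powr_snd:
  "real_analytic2_on (\<lambda>(x, y). complex_of_real y powr s) ({0<..<1} \<times> {0<..})"
  by (rule real_analytic2_on_snd[where T = "{z. Re z > 0}"])
     (auto intro!: holomorphic_intros simp: open_halfspace_Re_gt complex_nonpos_Reals_iff)

lemma real_analytic2_on_lerch_phi:
  "real_analytic2_on (\<lambda>(a, c). lerch_phi s a c) ({0<..<1} \<times> {0<..})"
proof -
  have "real_analytic2_on (\<lambda>(a, c). case (a, 1 * c + 1 / 2) of (a, d) \<Rightarrow> lerch_int s a d) ({0<..<1} \<times> {0<..})"
    by (rule real_analytic2_on_affine_snd[OF real_analytic2_on_lerch_int]) auto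
  then have "real_analytic2_on (\<lambda>p. (case p of (a, c) \<Rightarrow> of_real c powr (- s)) + \<i> * ((case p of (a, c) \<Rightarrow> e2pi (1 / 2 * a)) *
      (case p of (a, c) \<Rightarrow> case (a, 1 * c + 1 / 2) of (a, d) \<Rightarrow> lerch_int s a d))) ({0<..<1} \<times> {0<..})"
    by (intro real_analytic2_on_add real_analytic2_on_mult real_analytic2_on_const
        real_analytic2_on_e2pi_fst real_analytic2_on_powr_snd)
  then show ?thesis by (simp add: lerch_phi_def case_prod_unfold mult_ac)
qed

lemma real_analytic2_on_lerch_base:
  "real_analytic2_on (\<lambda>(a, c). lerch_base w s a c) ({0<..<1} \<times> {0<..<1})"
proof -
  have phi: "real_analytic2_on (\<lambda>(a, c). lerch_phi s a c) ({0<..<1} \<times> {0<..<1})"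
    by (rule real_analytic2_on_subset[OF real_analytic2_on_lerch_phi]) auto
  have "real_analytic2_on (\<lambda>(a, c). case (- 1 * a + 1, c) of (a, c) \<Rightarrow> lerch_phi s a c) ({0<..<1} \<times> {0<..<1})"
    by (rule real_analytic2_on_affine_fst[OF phi]) auto
  then have "real_analytic2_on (\<lambda>(a, c). case (a, - 1 * c + 1) of (a, c) \<Rightarrow> case (- 1 * a + 1, c) of (a, c) \<Rightarrow> lerch_phi s a c) ({0<..<1} \<times> {0<..<1})"
    by (rule real_analytic2_on_affine_snd) auto
  then have "real_analytic2_on (\<lambda>p. (case p of (a, c) \<Rightarrow> lerch_phi s a c) + w * ((case p of (a, c) \<Rightarrow> e2pi (- 1 * a)) *
      (case p of (a, c) \<Rightarrow> case (a, - 1 * c + 1) of (a, c) \<Rightarrow> case (- 1 * a + 1, c) of (a, c) \<Rightarrow> lerch_phi s a c)))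
      ({0<..<1} \<times> {0<..<1})"
    by (intro real_analytic2_on_add real_analytic2_on_mult real_analytic2_on_const real_analytic2_on_e2pi_fst phi)
  then show ?thesis by (simp add: lerch_base_def case_prod_unfold mult_ac)
qed

text \<open>Analyticity is local: on the open unit cell \<open>T\<close> around the point both
  floors are constant, so the function is a translate of \<open>lerch_base\<close> times an
  exponential of a multiple of \<open>a\<close>.\<close>

lemma real_analytic2_on_lerch_fun: "real_analytic2_on (\<lambda>(a, c). lerch_fun w s a c) offgrid"
  unfolding real_analytic2_on_def
proof (rule ballI)
  fix p assume p: "p \<in> offgrid"
  define m n where "m = \<lfloor>fst p\<rfloor>" and "n = \<lfloor>snd p\<rfloor>"
  define T where "T = {of_int m<..<of_int m + 1 :: real} \<times> {of_int n<..<of_int n + 1 :: real}"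
  have "of_int \<lfloor>x\<rfloor> < x \<and> x < of_int \<lfloor>x\<rfloor> + 1" if "x \<notin> \<int>" for x :: real
    using frac_bounds[of x] that by (simp add: frac_def)
  then have pT: "{p} \<subseteq> T"
    using p by (auto simp: offgrid_def T_def m_def n_def)
  have "real_analytic2_on (\<lambda>(a, c). case (1 * a + of_int (- m), c) of (a, c) \<Rightarrow> lerch_base w s a c)
     ({of_int m<..<of_int m + 1} \<times> {0<..<1})"
    by (rule real_analytic2_on_affine_fst[OF real_analytic2_on_lerch_base]) auto
  then have "real_analytic2_on (\<lambda>(a, c). case (a, 1 * c + of_int (- n)) of (a, c) \<Rightarrow>
      case (1 * a + of_int (- m), c) of (a, c) \<Rightarrow> lerch_base w s a c) T"
    by (rule real_analytic2_on_affine_snd) (auto simp: T_def)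
  then have "real_analytic2_on (\<lambda>p. (case p of (a, c) \<Rightarrow> e2pi (- of_int n * a)) *
     (case p of (a, c) \<Rightarrow> case (a, 1 * c + of_int (- n)) of (a, c) \<Rightarrow>
      case (1 * a + of_int (- m), c) of (a, c) \<Rightarrow> lerch_base w s a c)) T"
    by (intro real_analytic2_on_mult real_analytic2_on_e2pi_fst)
  then have "real_analytic2_on (\<lambda>(a, c). lerch_fun w s a c) T"
  proof (rule real_analytic2_on_cong)
    show "open T" unfolding T_def by (intro open_Times) auto
    fix q assume "q \<in> T"
    then have "\<lfloor>fst q\<rfloor> = m" "\<lfloor>snd q\<rfloor> = n" by (auto simp: T_def floor_eq_iff)
    then show "(case q of (a, c) \<Rightarrow> e2pi (- of_int n * a)) * (case q of (a, c) \<Rightarrow> case (a, 1 * c + of_int (- n)) of (a, c) \<Rightarrow>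
      case (1 * a + of_int (- m), c) of (a, c) \<Rightarrow> lerch_base w s a c) = (case q of (a, c) \<Rightarrow> lerch_fun w s a c)"
      by (simp add: lerch_fun_def case_prod_unfold frac_def)
  qed simp
  then have "real_analytic2_on (\<lambda>(a, c). lerch_fun w s a c) {p}"
    using pT by (rule real_analytic2_on_subset)
  then show "case p of (x0, y0) \<Rightarrow> \<exists>A. \<exists>\<epsilon>>0. \<forall>x y. \<bar>x - x0\<bar> < \<epsilon> \<and> \<bar>y - y0\<bar> < \<epsilon> \<longrightarrow>
        ((\<lambda>(j, k). A j k * of_real (x - x0) ^ j * of_real (y - y0) ^ k) has_sum (case (x, y) of (a, c) \<Rightarrow> lerch_fun w s a c)) UNIV"
    by (simp add: real_analytic2_on_def)
qed

section \<open>Growth at the edges of the unit square, and parameter integrals\<close>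

definition edge_powr :: "real \<Rightarrow> real \<Rightarrow> real" where
  "edge_powr \<tau> x = x powr (- \<tau>) + (1 - x) powr (- \<tau>)"

lemma edge_powr_nonneg: "edge_powr \<tau> x \<ge> 0"
  by (simp add: edge_powr_def)

lemma edge_powr_reflect: "edge_powr \<tau> (1 - x) = edge_powr \<tau> x"
  by (simp add: edge_powr_def)

lemma edge_powr_integrable:
  assumes "\<tau> < 1"
  shows "set_integrable lborel {0<..<1} (edge_powr \<tau>)"
proof -
  have "set_integrable lborel {0..1} (\<lambda>x::real. x powr (- \<tau>))"
    using has_integral_powr_from_0[of "- \<tau>" 1] assms
    by (intro set_integrable_lborel_nonneg) (auto simp: integrable_on_def)
  then have 1: "set_integrable lborel {0<..<1} (\<lambda>x::real. x powr (- \<tau>))"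
    by (rule set_integrable_subset) auto
  then have "integrable lborel (\<lambda>x. indicat_real {0<..<1} (1 + (- 1) * x) *\<^sub>R (1 + (- 1) * x) powr (- \<tau>))"
    unfolding set_integrable_def by (rule lborel_integrable_real_affine) simp
  then have "set_integrable lborel {0<..<1} (\<lambda>x::real. (1 - x) powr (- \<tau>))"
    unfolding set_integrable_def
    by (rule Bochner_Integration.integrable_cong[THEN iffD1, rotated 2]) (auto simp: indicator_def)
  with 1 show ?thesis unfolding edge_powr_def by (rule set_integral_add(1))
qed

text \<open>For 0 < x \<le> 1, passing from \<tau> to its absolute value only enlarges the power and
  makes it nonincreasing in x, so both signs of \<tau> are treated at once.\<close>

lemma edge_powr_bounded:
  assumes "\<mu> > 0"
  obtains M where "M \<ge> 0" "\<And>x. \<mu> \<le> x \<Longrightarrow> x \<le> 1 - \<mu> \<Longrightarrow> edge_powr \<tau> x \<le> M"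
proof -
  have le: "x powr (- \<tau>) \<le> \<mu> powr (- \<bar>\<tau>\<bar>)" if x: "\<mu> \<le> x" "x \<le> 1" for x
  proof -
    have "x powr (- \<tau>) \<le> x powr (- \<bar>\<tau>\<bar>)" using x assms by (intro powr_mono') auto
    also have "\<dots> \<le> \<mu> powr (- \<bar>\<tau>\<bar>)" using x assms by (intro powr_mono2') auto
    finally show ?thesis .
  qed
  show thesis
  proof (rule that[of "\<mu> powr (- \<bar>\<tau>\<bar>) + \<mu> powr (- \<bar>\<tau>\<bar>)"])
    fix x assume "\<mu> \<le> x" "x \<le> 1 - \<mu>"
    then show "edge_powr \<tau> x \<le> \<mu> powr (- \<bar>\<tau>\<bar>) + \<mu> powr (- \<bar>\<tau>\<bar>)"
      unfolding edge_powr_def using assms by (intro add_mono le) auto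
  qed simp
qed

lemma lerch_phi_norm_le: "c > 0 \<Longrightarrow> norm (lerch_phi s a c) \<le> c powr (- Re s) + norm (lerch_int s a (c + 1 / 2))"
  unfolding lerch_phi_def
  by (rule order_trans[OF norm_triangle_ineq]) (simp add: norm_mult norm_powr_real_powr)

text \<open>\<open>edge_powr (Re s) c\<close> collects the terms that can be singular at the edges
  in \<open>c\<close>: n = 0 at c = 0 and n = -1 at c = 1. The rest is two kernel integrals, whose
  real parts c + 1/2 and 3/2 - c stay between 1/2 and 3/2.\<close>

lemma lerch_fun_norm_le:
  assumes "0 < a" "a < 1" "0 < c" "c < 1"
  shows "norm (lerch_fun w s a c) \<le> (1 + norm w) * (edge_powr (Re s) c +
     norm (lerch_int s a (c + 1 / 2)) + norm (lerch_int s (1 - a) (3 / 2 - c)))"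
proof -
  let ?X = "edge_powr (Re s) c + norm (lerch_int s a (c + 1 / 2)) + norm (lerch_int s (1 - a) (3 / 2 - c))"
  have "norm (lerch_phi s a c) \<le> ?X"
    using lerch_phi_norm_le[of c s a] assms powr_ge_zero[of "1 - c" "- Re s"]
      norm_ge_zero[of "lerch_int s (1 - a) (3 / 2 - c)"]
    unfolding edge_powr_def by linarith
  moreover have "norm (lerch_phi s (1 - a) (1 - c)) \<le> ?X"
  proof -
    have eq: "1 - c + 1 / 2 = 3 / 2 - c" by simp
    show ?thesis
      using lerch_phi_norm_le[of "1 - c" s "1 - a"] assms powr_ge_zero[of c "- Re s"]
        norm_ge_zero[of "lerch_int s a (c + 1 / 2)"]
      unfolding edge_powr_def eq by linarith
  qed
  then have "norm w * norm (lerch_phi s (1 - a) (1 - c)) \<le> norm w * ?X" by (intro mult_left_mono) auto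
  moreover have "norm (lerch_fun w s a c) \<le> norm (lerch_phi s a c) + norm w * norm (lerch_phi s (1 - a) (1 - c))"
    unfolding lerch_fun_eq_base[OF assms] lerch_base_def
    by (rule order_trans[OF norm_triangle_ineq]) (simp add: norm_mult)
  ultimately show ?thesis by (simp add: distrib_right)
qed

text \<open>Valid for every \<open>s\<close>, since the first argument stays away from 0 and 1. It
  handles the generators whose parameter may lie outside the half plane of convergence: the dual
  ones when Re s > 0, the direct ones when Re s < 1.\<close>

lemma lerch_fun_bound_inner:
  assumes "\<mu> > 0"
  obtains C where "C \<ge> 0" "\<And>a c. \<mu> \<le> a \<Longrightarrow> a \<le> 1 - \<mu> \<Longrightarrow> 0 < c \<Longrightarrow> c < 1 \<Longrightarrow>
      norm (lerch_fun w s a c) \<le> C * (1 + edge_powr (Re s) c)"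
proof -
  obtain C where C: "C \<ge> 0" "\<And>a d. \<mu> \<le> a \<Longrightarrow> a \<le> 1 - \<mu> \<Longrightarrow> 1 / 2 \<le> d \<Longrightarrow> d \<le> 3 / 2 \<Longrightarrow> norm (lerch_int s a d) \<le> C"
    using lerch_int_bounded[of "1 / 2" \<mu> "3 / 2" s] assms by auto
  show thesis
  proof (rule that)
    show "(1 + norm w) * (1 + 2 * C) \<ge> 0" using C(1) by simp
    fix a c :: real assume *: "\<mu> \<le> a" "a \<le> 1 - \<mu>" "0 < c" "c < 1"
    have "norm (lerch_fun w s a c) \<le> (1 + norm w) * (edge_powr (Re s) c +
       norm (lerch_int s a (c + 1 / 2)) + norm (lerch_int s (1 - a) (3 / 2 - c)))"
      using * assms by (intro lerch_fun_norm_le) auto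
    also have "\<dots> \<le> (1 + norm w) * ((1 + 2 * C) * (1 + edge_powr (Re s) c))"
    proof (rule mult_left_mono)
      have "norm (lerch_int s a (c + 1 / 2)) \<le> C" "norm (lerch_int s (1 - a) (3 / 2 - c)) \<le> C"
        using * by (auto intro!: C(2))
      moreover have "C * edge_powr (Re s) c \<ge> 0" using C(1) edge_powr_nonneg by simp
      moreover have "(1 + 2 * C) * (1 + edge_powr (Re s) c) = 1 + 2 * C + edge_powr (Re s) c + 2 * (C * edge_powr (Re s) c)"
        by algebra
      ultimately show "edge_powr (Re s) c + norm (lerch_int s a (c + 1 / 2)) + norm (lerch_int s (1 - a) (3 / 2 - c))
         \<le> (1 + 2 * C) * (1 + edge_powr (Re s) c)" by linarith
    qed simp
    finally show "norm (lerch_fun w s a c) \<le> (1 + norm w) * (1 + 2 * C) * (1 + edge_powr (Re s) c)"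
      by (simp only: mult.assoc)
  qed
qed

text \<open>Uniform up to all four edges. The singularities in \<open>a\<close> and in
  \<open>c\<close> are added, so the majorant is a sum of functions of one variable.\<close>

lemma lerch_fun_bound:
  assumes "Re s > 0"
  obtains C \<tau> where "C \<ge> 0" "\<tau> < 1" "\<And>a c. 0 < a \<Longrightarrow> a < 1 \<Longrightarrow> 0 < c \<Longrightarrow> c < 1 \<Longrightarrow>
      norm (lerch_fun w s a c) \<le> C * (edge_powr (Re s) c + edge_powr \<tau> a)"
proof -
  obtain C \<tau> where C: "C \<ge> 0" "\<tau> < 1" "\<And>a d. 0 < a \<Longrightarrow> a < 1 \<Longrightarrow> 1 / 2 \<le> d \<Longrightarrow> d \<le> 3 / 2 \<Longrightarrow>
       norm (lerch_int s a d) \<le> C * (a powr (- \<tau>) + (1 - a) powr (- \<tau>))"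
    using lerch_int_le_powr[of "1 / 2" s "3 / 2"] assms by auto
  show thesis
  proof (rule that)
    show "(1 + norm w) * (1 + 2 * C) \<ge> 0" "\<tau> < 1" using C(1,2) by simp_all
    fix a c :: real assume *: "0 < a" "a < 1" "0 < c" "c < 1"
    have "norm (lerch_fun w s a c) \<le> (1 + norm w) * (edge_powr (Re s) c +
       norm (lerch_int s a (c + 1 / 2)) + norm (lerch_int s (1 - a) (3 / 2 - c)))"
      using * by (intro lerch_fun_norm_le) auto
    also have "\<dots> \<le> (1 + norm w) * ((1 + 2 * C) * (edge_powr (Re s) c + edge_powr \<tau> a))"
    proof (rule mult_left_mono)
      have "norm (lerch_int s a (c + 1 / 2)) \<le> C * edge_powr \<tau> a"
        using * C(3)[of a "c + 1 / 2"] by (simp add: edge_powr_def)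
      moreover have "norm (lerch_int s (1 - a) (3 / 2 - c)) \<le> C * edge_powr \<tau> a"
        using * C(3)[of "1 - a" "3 / 2 - c"] by (simp add: edge_powr_def add.commute)
      moreover have "C * edge_powr (Re s) c \<ge> 0" using C(1) edge_powr_nonneg by simp
      moreover have "(1 + 2 * C) * (edge_powr (Re s) c + edge_powr \<tau> a) =
         edge_powr (Re s) c + edge_powr \<tau> a + 2 * (C * edge_powr (Re s) c) + 2 * (C * edge_powr \<tau> a)"
        by algebra
      ultimately show "edge_powr (Re s) c + norm (lerch_int s a (c + 1 / 2)) + norm (lerch_int s (1 - a) (3 / 2 - c))
         \<le> (1 + 2 * C) * (edge_powr (Re s) c + edge_powr \<tau> a)" using edge_powr_nonneg[of \<tau> a] by linarith
    qed simp
    finally show "norm (lerch_fun w s a c) \<le> (1 + norm w) * (1 + 2 * C) * (edge_powr (Re s) c + edge_powr \<tau> a)"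
      by (simp only: mult.assoc)
  qed
qed

text \<open>Continuity on the open interval is local, so a majorant for each [\<mu>, 1 - \<mu>]
  suffices. In the applications the integrand is in general singular at the edges in y as well,
  which rules out one majorant for all y.\<close>

lemma integral_continuous_dominated:
  fixes f :: "real \<times> real \<Rightarrow> complex"
  assumes cont: "continuous_on ({0<..<1} \<times> {0<..<1}) f"
    and dom: "\<And>\<mu>. \<mu> > 0 \<Longrightarrow> \<exists>g. set_integrable lborel {0<..<1} g \<and>
       (\<forall>x\<in>{0<..<1}. \<forall>y\<in>{\<mu>..1 - \<mu>}. norm (f (x, y)) \<le> g x)"
  shows "\<And>y. y \<in> {0<..<1} \<Longrightarrow> set_integrable lborel {0<..<1} (\<lambda>x. f (x, y))"
    and "continuous_on {0<..<1} (\<lambda>y. LINT x:{0<..<1}|lborel. f (x, y))"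
proof -
  have meas: "(\<lambda>x. indicator {0<..<1} x *\<^sub>R f (x, y)) \<in> borel_measurable lborel" if y: "y \<in> {0<..<1}" for y
  proof -
    have "continuous_on {0<..<1} (\<lambda>x. f (x, y))"
      by (rule continuous_on_compose2[OF cont]) (use y in \<open>auto intro!: continuous_intros\<close>)
    then have "(\<lambda>x. indicator {0<..<1} x *\<^sub>R f (x, y)) \<in> borel_measurable borel"
      by (intro borel_measurable_continuous_on_indicator) auto
    then show ?thesis by simp
  qed
  show int: "set_integrable lborel {0<..<1} (\<lambda>x. f (x, y))" if y: "y \<in> {0<..<1}" for y
  proof -
    define \<mu> where "\<mu> = min y (1 - y)"
    have \<mu>: "\<mu> > 0" "y \<in> {\<mu>..1 - \<mu>}" using y by (auto simp: \<mu>_def)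
    obtain g where "set_integrable lborel {0<..<1} g"
        "\<forall>x\<in>{0<..<1}. \<forall>y\<in>{\<mu>..1 - \<mu>}. norm (f (x, y)) \<le> g x"
      using dom[OF \<mu>(1)] by (elim exE conjE)
    with \<mu>(2) have g: "set_integrable lborel {0<..<1} g" "\<And>x. x \<in> {0<..<1} \<Longrightarrow> norm (f (x, y)) \<le> g x"
      by simp_all
    show ?thesis
      unfolding set_integrable_def
      by (rule Bochner_Integration.integrable_bound[OF g(1)[unfolded set_integrable_def] meas[OF y]])
         (use g(2) in \<open>auto simp: indicator_def intro!: AE_I2 order_trans[OF _ abs_ge_self]\<close>)
  qed
  have cont\<mu>: "continuous_on {\<mu>..1 - \<mu>} (\<lambda>y. LINT x:{0<..<1}|lborel. f (x, y))" if \<mu>: "\<mu> > 0" for \<mu>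
  proof -
    obtain g where g: "set_integrable lborel {0<..<1} g"
      and gb: "\<forall>x\<in>{0<..<1}. \<forall>y\<in>{\<mu>..1 - \<mu>}. norm (f (x, y)) \<le> g x"
      using dom[OF \<mu>] by (elim exE conjE)
    show ?thesis
      unfolding continuous_on_sequentially
    proof (intro allI ballI impI, elim conjE)
      fix u y assume y: "y \<in> {\<mu>..1 - \<mu>}" and u: "\<forall>n. u n \<in> {\<mu>..1 - \<mu>}" "u \<longlonglongrightarrow> y"
      have sub: "{\<mu>..1 - \<mu>} \<subseteq> {0<..<1}" using \<mu> by auto
      show "((\<lambda>y. LINT x:{0<..<1}|lborel. f (x, y)) \<circ> u) \<longlonglongrightarrow> (LINT x:{0<..<1}|lborel. f (x, y))"
        unfolding set_lebesgue_integral_def o_def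
      proof (rule integral_dominated_convergence[where w = "\<lambda>x. indicator {0<..<1} x *\<^sub>R g x"])
        show "integrable lborel (\<lambda>x. indicator {0<..<1} x *\<^sub>R g x)" using g by (simp add: set_integrable_def)
        show "(\<lambda>x. indicator {0<..<1} x *\<^sub>R f (x, y)) \<in> borel_measurable lborel"
          "(\<lambda>x. indicator {0<..<1} x *\<^sub>R f (x, u n)) \<in> borel_measurable lborel" for n
          using meas y u(1) sub by blast+
        show "AE x in lborel. norm (indicator {0<..<1} x *\<^sub>R f (x, u n)) \<le> indicator {0<..<1} x *\<^sub>R g x" for n
          using gb u(1) by (intro AE_I2) (simp add: indicator_def)
        show "AE x in lborel. (\<lambda>n. indicator {0<..<1} x *\<^sub>R f (x, u n)) \<longlonglongrightarrow> indicator {0<..<1} x *\<^sub>R f (x, y)"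
        proof (rule AE_I2)
          fix x :: real
          show "(\<lambda>n. indicator {0<..<1} x *\<^sub>R f (x, u n)) \<longlonglongrightarrow> indicator {0<..<1} x *\<^sub>R f (x, y)"
          proof (cases "x \<in> {0<..<1}")
            case True
            have "isCont f (x, y)"
              using True y sub by (intro continuous_on_interior[OF cont]) (auto simp: interior_Times)
            then have "(\<lambda>n. f (x, u n)) \<longlonglongrightarrow> f (x, y)"
              using u(2) by (intro isCont_tendsto_compose[of _ f] tendsto_Pair tendsto_const)
            then show ?thesis using True by simp
          qed simp
        qed
      qed
    qed
  qed
  show "continuous_on {0<..<1} (\<lambda>y. LINT x:{0<..<1}|lborel. f (x, y))"
  proof (rule continuous_at_imp_continuous_on, rule ballI)
    fix y :: real assume y: "y \<in> {0<..<1}"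
    \<comment> \<open>Halving puts \<open>y\<close> in the interior of [\<mu>, 1 - \<mu>], so that
      continuity there gives continuity at \<open>y\<close>.\<close>
    define \<mu> where "\<mu> = min y (1 - y) / 2"
    have "\<mu> > 0" "y \<in> interior {\<mu>..1 - \<mu>}" using y by (auto simp: \<mu>_def min_def field_simps)
    then show "isCont (\<lambda>y. LINT x:{0<..<1}|lborel. f (x, y)) y"
      using continuous_on_interior[OF cont\<mu>] by blast
  qed
qed

subsection \<open>Hecke identities\<close>

lemma e2pi_of_int [simp]: "e2pi (of_int n) = 1"
  using e2pi_add_int[of 0 n] by simp

lemma e2pi_of_nat [simp]: "e2pi (of_nat n) = 1"
  using e2pi_of_int[of "int n"] by simp

lemma e2pi_power: "e2pi x ^ k = e2pi (of_nat k * x)"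
  by (simp only: Complex.DeMoivre mult_ac)

text \<open>The summands are the powers of z = \<open>e2pi\<close> of n/m, and z = 1 exactly when m
  divides n; otherwise z^m = 1 makes the geometric sum vanish.\<close>

lemma sum_e2pi_roots:
  assumes m: "m \<ge> 1"
  shows "(\<Sum>k<m. e2pi (of_int n * of_nat k / of_nat m)) = (if int m dvd n then of_nat m else 0)"
proof -
  define z where "z = e2pi (of_int n / of_nat m)"
  have pow: "e2pi (of_int n * of_nat k / of_nat m) = z ^ k" for k
    unfolding z_def e2pi_power by (simp add: mult_ac)
  show ?thesis
  proof (cases "int m dvd n")
    case True
    then obtain l where "n = int m * l" by (elim dvdE)
    then have "z = 1" using m by (simp add: z_def)
    then show ?thesis using True unfolding pow by simp
  next
    case False
    have "z \<noteq> 1"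
    proof
      assume "z = 1"
      moreover have "z = exp (2 * of_real pi * \<i> * of_real (of_int n / of_nat m))"
        by (simp add: z_def cis_conv_exp mult_ac)
      ultimately have "complex_of_real (of_int n / of_nat m) \<in> \<int>"
        by (simp only: exp_2pi_i_eq_1_iff)
      then obtain l where "complex_of_real (of_int n / of_nat m) = of_real (of_int l)"
        by (metis Ints_cases of_real_of_int_eq)
      then have "of_int n / of_nat m = (of_int l :: real)" by (simp only: of_real_eq_iff)
      then have "of_int n = (of_int (int m * l) :: real)" using m by (simp add: field_simps)
      then have "n = int m * l" by (simp only: of_int_eq_iff)
      then show False using False by simp
    qed
    moreover have "of_nat m * (of_int n / of_nat m) = (of_int n :: real)" using m by simp
    then have "z ^ m = 1"
      unfolding z_def e2pi_power by (simp only: e2pi_of_int)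
    ultimately show ?thesis using False unfolding pow by (simp add: geometric_sum)
  qed
qed

lemma mult_of_nat_notin_Ints: "of_nat m * (x :: real) \<notin> \<int> \<Longrightarrow> x \<notin> \<int>"
  using Ints_mult[of "of_nat m" x] by auto

lemma divide_add_notin_Ints:
  assumes "m \<ge> 1" "(x :: real) \<notin> \<int>"
  shows "(x + of_nat k) / of_nat m \<notin> \<int>"
proof
  assume "(x + of_nat k) / of_nat m \<in> \<int>"
  then have "of_nat m * ((x + of_nat k) / of_nat m) - of_nat k \<in> \<int>" by (intro Ints_diff Ints_mult) auto
  then show False using assms by simp
qed

lemma Ints_one_minus_iff [simp]: "1 - x \<in> \<int> \<longleftrightarrow> (x :: real) \<in> \<int>"
  using Ints_diff[of 1 "1 - x"] Ints_diff[of 1 x] by auto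

lemma filterlim_mult_int:
  assumes "m \<ge> (1 :: nat)"
  shows "filterlim (\<lambda>N. int m * int N) at_top sequentially" "filterlim (\<lambda>N. - (int m * int N)) at_bot sequentially"
proof -
  have le: "int N \<le> int m * int N" for N
    using assms mult_right_mono[of 1 "int m" "int N"] by simp
  show "filterlim (\<lambda>N. int m * int N) at_top sequentially"
    by (rule filterlim_at_top_mono[OF filterlim_int_sequentially]) (use le in simp)
  show "filterlim (\<lambda>N. - (int m * int N)) at_bot sequentially"
    unfolding filterlim_at_bot
  proof
    fix Z
    have "\<forall>\<^sub>F N in sequentially. - Z \<le> int N"
      using filterlim_int_sequentially by (simp add: filterlim_at_top)
    then show "\<forall>\<^sub>F N in sequentially. - (int m * int N) \<le> Z"
    proof eventually_elim
      case (elim N)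
      then show ?case using le[of N] by linarith
    qed
  qed
qed

text \<open>Averaging over k keeps only the n divisible by m. For n = m l the exponential becomes
  that of l a, and |n + m c| = m |l + c| splits off the eigenvalue m^(-s).\<close>

lemma lerch_term_T:
  assumes m: "m \<ge> 1"
  shows "1 / of_nat m * (\<Sum>k<m. lerch_term w s ((a + of_nat k) / of_nat m) (of_nat m * c) n)
    = (if int m dvd n then of_real (of_nat m) powr (- s) * lerch_term w s a c (n div int m) else 0)"
proof -
  define W where "W = (if of_int n + of_nat m * c > 0 then 1 else w)"
  have split: "e2pi (of_int n * ((a + of_nat k) / of_nat m)) = e2pi (of_int n * a / of_nat m) * e2pi (of_int n * of_nat k / of_nat m)" for k
    unfolding e2pi_mult by (rule arg_cong[of _ _ e2pi]) (simp add: distrib_left add_divide_distrib)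
  have "(\<Sum>k<m. lerch_term w s ((a + of_nat k) / of_nat m) (of_nat m * c) n) =
      W * (e2pi (of_int n * a / of_nat m) * (\<Sum>k<m. e2pi (of_int n * of_nat k / of_nat m))) * of_real \<bar>of_int n + of_nat m * c\<bar> powr (- s)"
    unfolding lerch_term_def split W_def[symmetric] by (simp only: sum_distrib_left sum_distrib_right)
  also have "\<dots> = (if int m dvd n then of_nat m * (W * e2pi (of_int n * a / of_nat m) * of_real \<bar>of_int n + of_nat m * c\<bar> powr (- s)) else 0)"
    unfolding sum_e2pi_roots[OF m] by simp
  also have "1 / of_nat m * \<dots> = (if int m dvd n then W * e2pi (of_int n * a / of_nat m) * of_real \<bar>of_int n + of_nat m * c\<bar> powr (- s) else 0)"
    using m by simp
  finally have fin: "1 / of_nat m * (\<Sum>k<m. lerch_term w s ((a + of_nat k) / of_nat m) (of_nat m * c) n) =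
      (if int m dvd n then W * e2pi (of_int n * a / of_nat m) * of_real \<bar>of_int n + of_nat m * c\<bar> powr (- s) else 0)" .
  have "W * e2pi (of_int n * a / of_nat m) * of_real \<bar>of_int n + of_nat m * c\<bar> powr (- s) =
      of_real (of_nat m) powr (- s) * lerch_term w s a c (n div int m)" if dvd: "int m dvd n"
  proof -
    obtain l where l: "n = int m * l" using dvd by (elim dvdE)
    have m0: "real m > 0" using m by simp
    have e1: "of_int n + of_nat m * c = real m * (of_int l + c)" by (simp add: l algebra_simps)
    have e2: "of_int n * a / of_nat m = of_int l * a" using m by (simp add: l)
    have e3: "n div int m = l" using m by (simp add: l)
    have "complex_of_real \<bar>of_int n + of_nat m * c\<bar> powr (- s) = of_real (real m) powr (- s) * of_real \<bar>of_int l + c\<bar> powr (- s)"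
      unfolding e1 abs_mult using m0 by (simp add: powr_times_real_left)
    moreover have "W = (if of_int l + c > 0 then 1 else w)"
      unfolding W_def e1 using m0 by (simp add: zero_less_mult_iff)
    ultimately show ?thesis unfolding e2 e3 lerch_term_def by simp
  qed
  then show ?thesis unfolding fin by simp
qed

text \<open>The left side is summed over the range from -m N to m N, whose multiples of m are m
  times those from -N to N. The identity is thus exact for finite sums, and both sides
  converge.\<close>

lemma lerch_fun_T:
  assumes m: "m \<ge> 1" and a: "a \<notin> \<int>" and c: "of_nat m * c \<notin> \<int>" and s: "Re s > 0"
  shows "1 / of_nat m * (\<Sum>k<m. lerch_fun w s ((a + of_nat k) / of_nat m) (of_nat m * c)) =
    of_real (of_nat m) powr (- s) * lerch_fun w s a c"
proof (rule LIMSEQ_unique)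
  let ?I = "\<lambda>N. {- (int m * int N)..<int m * int N}"
  show "(\<lambda>N. 1 / of_nat m * (\<Sum>k<m. \<Sum>n\<in>?I N. lerch_term w s ((a + of_nat k) / of_nat m) (of_nat m * c) n))
     \<longlonglongrightarrow> 1 / of_nat m * (\<Sum>k<m. lerch_fun w s ((a + of_nat k) / of_nat m) (of_nat m * c))"
    by (intro tendsto_mult_left tendsto_sum lerch_fun_tendsto filterlim_mult_int divide_add_notin_Ints assms)
  have "1 / of_nat m * (\<Sum>k<m. \<Sum>n\<in>?I N. lerch_term w s ((a + of_nat k) / of_nat m) (of_nat m * c) n) =
      of_real (of_nat m) powr (- s) * (\<Sum>l\<in>{- int N..<int N}. lerch_term w s a c l)" for N
  proof -
    have "1 / of_nat m * (\<Sum>k<m. \<Sum>n\<in>?I N. lerch_term w s ((a + of_nat k) / of_nat m) (of_nat m * c) n) =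
       (\<Sum>n\<in>?I N. 1 / of_nat m * (\<Sum>k<m. lerch_term w s ((a + of_nat k) / of_nat m) (of_nat m * c) n))"
      by (subst sum.swap) (simp only: sum_distrib_left)
    also have "\<dots> = (\<Sum>n\<in>?I N. if int m dvd n then of_real (of_nat m) powr (- s) * lerch_term w s a c (n div int m) else 0)"
      unfolding lerch_term_T[OF m] ..
    also have "\<dots> = (\<Sum>n\<in>{n \<in> ?I N. int m dvd n}. of_real (of_nat m) powr (- s) * lerch_term w s a c (n div int m))"
      by (rule sum.inter_filter[symmetric]) simp
    also have "\<dots> = (\<Sum>l\<in>{- int N..<int N}. of_real (of_nat m) powr (- s) * lerch_term w s a c l)"
    proof (rule sum.reindex_bij_witness[of _ "\<lambda>l. int m * l" "\<lambda>n. n div int m"])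
      fix n assume "n \<in> {n \<in> ?I N. int m dvd n}"
      then obtain l where l: "n = int m * l" "- (int m * int N) \<le> int m * l" "int m * l < int m * int N"
        by (auto elim!: dvdE)
      have "int m * (- int N) \<le> int m * l" using l by simp
      then have "- int N \<le> l" "l < int N" using l(3) m by (simp_all only: mult_le_cancel_left_pos mult_less_cancel_left_pos of_nat_0_less_iff)
      then show "n div int m \<in> {- int N..<int N}" "int m * (n div int m) = n" using l m by auto
    next
      fix l assume "l \<in> {- int N..<int N}"
      then have "int m * (- int N) \<le> int m * l" "int m * l < int m * int N"
        using m by (auto intro: mult_left_mono simp del: mult_minus_right)
      then show "int m * l \<in> {n \<in> ?I N. int m dvd n}" "int m * l div int m = l" using m by auto
    qed simp
    finally show ?thesis by (simp only: sum_distrib_left)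
  qed
  moreover have "(\<lambda>N. of_real (of_nat m) powr (- s) * (\<Sum>l\<in>{- int N..<int N}. lerch_term w s a c l))
      \<longlonglongrightarrow> of_real (of_nat m) powr (- s) * lerch_fun w s a c"
    using a s mult_of_nat_notin_Ints[OF c]
    by (intro tendsto_mult_left lerch_fun_tendsto filterlim_uminus_int_at_bot filterlim_int_sequentially)
  ultimately show "(\<lambda>N. 1 / of_nat m * (\<Sum>k<m. \<Sum>n\<in>?I N. lerch_term w s ((a + of_nat k) / of_nat m) (of_nat m * c) n))
     \<longlonglongrightarrow> of_real (of_nat m) powr (- s) * lerch_fun w s a c"
    by simp
qed

text \<open>Since n + (c + k)/m = (m n + k + c)/m, the term is, up to a power of m, the term of (a,
  c) with index m n + k; the twist by \<open>e2pi\<close> of k a completes the exponential.\<close>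

lemma lerch_term_S:
  assumes m: "m \<ge> 1"
  shows "e2pi (of_nat k * a) * lerch_term w s (of_nat m * a) ((c + of_nat k) / of_nat m) n
    = of_real (of_nat m) powr s * lerch_term w s a c (int m * n + int k)"
proof -
  have m0: "real m > 0" using m by simp
  define x where "x = of_int (int m * n + int k) + c"
  have e1: "of_int n + (c + of_nat k) / of_nat m = inverse (real m) * x" using m0 by (simp add: x_def field_simps)
  have e2: "e2pi (of_nat k * a) * e2pi (of_int n * (of_nat m * a)) = e2pi (of_int (int m * n + int k) * a)"
    unfolding e2pi_mult by (rule arg_cong[of _ _ e2pi]) (simp add: algebra_simps)
  have "complex_of_real \<bar>inverse (real m) * x\<bar> powr (- s) = of_real (inverse (real m)) powr (- s) * of_real \<bar>x\<bar> powr (- s)"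
    unfolding abs_mult using m0 by (simp add: powr_times_real_left)
  also have "complex_of_real (inverse (real m)) powr (- s) = of_real (real m) powr s"
    using m0 by (simp add: powr_def Ln_of_real ln_inverse del: of_real_inverse of_real_of_nat_eq)
  finally have e3: "complex_of_real \<bar>inverse (real m) * x\<bar> powr (- s) = of_real (real m) powr s * of_real \<bar>x\<bar> powr (- s)" .
  have e4: "inverse (real m) * x > 0 \<longleftrightarrow> x > 0" using m0 by (simp add: zero_less_mult_iff)
  show ?thesis
    unfolding lerch_term_def e1 e3 e4 x_def[symmetric] e2[symmetric] by (simp only: mult_ac)
qed

text \<open>Division with remainder by m identifies the pairs (k, n) with -N \<le> n < N and the j
  with -m N \<le> j < m N, so the m sums merge into one. The prefactor 1/m turns m^s into
  m^(s-1).\<close>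

lemma lerch_fun_S:
  assumes m: "m \<ge> 1" and a: "of_nat m * a \<notin> \<int>" and c: "c \<notin> \<int>" and s: "Re s > 0"
  shows "1 / of_nat m * (\<Sum>k<m. e2pi (of_nat k * a) * lerch_fun w s (of_nat m * a) ((c + of_nat k) / of_nat m)) =
    of_real (of_nat m) powr (s - 1) * lerch_fun w s a c"
proof (rule LIMSEQ_unique)
  let ?t = "\<lambda>k. lerch_term w s (of_nat m * a) ((c + of_nat k) / of_nat m)"
  show "(\<lambda>N. 1 / of_nat m * (\<Sum>k<m. e2pi (of_nat k * a) * (\<Sum>n\<in>{- int N..<int N}. ?t k n)))
     \<longlonglongrightarrow> 1 / of_nat m * (\<Sum>k<m. e2pi (of_nat k * a) * lerch_fun w s (of_nat m * a) ((c + of_nat k) / of_nat m))"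
    by (intro tendsto_mult_left tendsto_sum lerch_fun_tendsto filterlim_uminus_int_at_bot filterlim_int_sequentially
        divide_add_notin_Ints assms)
  have "1 / of_nat m * (\<Sum>k<m. e2pi (of_nat k * a) * (\<Sum>n\<in>{- int N..<int N}. ?t k n)) =
      of_real (of_nat m) powr (s - 1) * (\<Sum>j\<in>{- (int m * int N)..<int m * int N}. lerch_term w s a c j)" for N
  proof -
    have "(\<Sum>k<m. e2pi (of_nat k * a) * (\<Sum>n\<in>{- int N..<int N}. ?t k n)) =
        (\<Sum>(k, n)\<in>{..<m} \<times> {- int N..<int N}. of_real (of_nat m) powr s * lerch_term w s a c (int m * n + int k))"
      by (simp only: sum_distrib_left lerch_term_S[OF m] sum.cartesian_product)
    also have "\<dots> = (\<Sum>j\<in>{- (int m * int N)..<int m * int N}. of_real (of_nat m) powr s * lerch_term w s a c j)"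
    proof (rule sum.reindex_bij_witness[of _ "\<lambda>j. (nat (j mod int m), j div int m)" "\<lambda>(k, n). int m * n + int k"])
      fix p assume "p \<in> {..<m} \<times> {- int N..<int N}"
      then obtain k n where p: "p = (k, n)" "k < m" "- int N \<le> n" "n < int N" by auto
      have "int m * (- int N) \<le> int m * n" using p by (intro mult_left_mono) auto
      moreover have "int m * (n + 1) \<le> int m * int N" using p by (intro mult_left_mono) auto
      ultimately show "(case p of (k, n) \<Rightarrow> int m * n + int k) \<in> {- (int m * int N)..<int m * int N}"
        using p by (simp add: algebra_simps)
      have "(int m * n + int k) div int m = n" "(int m * n + int k) mod int m = int k" using p by auto
      then show "(nat ((case p of (k, n) \<Rightarrow> int m * n + int k) mod int m), (case p of (k, n) \<Rightarrow> int m * n + int k) div int m) = p"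
        using p by simp
      show "of_real (of_nat m) powr s * lerch_term w s a c (case p of (k, n) \<Rightarrow> int m * n + int k) =
         (case p of (k, n) \<Rightarrow> of_real (of_nat m) powr s * lerch_term w s a c (int m * n + int k))"
        by (simp add: p)
    next
      fix j assume j: "j \<in> {- (int m * int N)..<int m * int N}"
      have m0: "int m > 0" using m by simp
      have eq: "int m * (j div int m) + j mod int m = j" by simp
      have md: "0 \<le> j mod int m" "j mod int m < int m" using m0 by simp_all
      then show "(case (nat (j mod int m), j div int m) of (k, n) \<Rightarrow> int m * n + int k) = j" by simp
      \<comment> \<open>As the remainder is below m, the lower bound on j becomes a strict
        inequality for the quotient plus one, which for integers means that the quotient is at least
        -N.\<close>
      have "int m * (- int N) < int m * (j div int m + 1)" 
        using j eq md unfolding distrib_left mult_minus_right mult_1_right atLeastLessThan_iff by linarith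
      then have "- int N < j div int m + 1" using m0 by (simp only: mult_less_cancel_left_pos)
      moreover have "int m * (j div int m) < int m * int N"
        using j eq md unfolding atLeastLessThan_iff by linarith
      then have "j div int m < int N" using m0 by (simp only: mult_less_cancel_left_pos)
      ultimately show "(nat (j mod int m), j div int m) \<in> {..<m} \<times> {- int N..<int N}"
        using md by (auto simp: nat_less_iff)
    qed
    also have "1 / of_nat m * \<dots> = 1 / of_nat m * of_real (of_nat m) powr s * (\<Sum>j\<in>{- (int m * int N)..<int m * int N}. lerch_term w s a c j)"
      by (simp only: sum_distrib_left mult.assoc)
    also have "1 / of_nat m * complex_of_real (of_nat m) powr s = of_real (of_nat m) powr (s - 1)"
      using m by (simp add: powr_diff)
    finally show ?thesis by simp
  qed
  moreover have "(\<lambda>N. of_real (of_nat m) powr (s - 1) * (\<Sum>j\<in>{- (int m * int N)..<int m * int N}. lerch_term w s a c j))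
      \<longlonglongrightarrow> of_real (of_nat m) powr (s - 1) * lerch_fun w s a c"
    using c s mult_of_nat_notin_Ints[OF a] m
    by (intro tendsto_mult_left lerch_fun_tendsto filterlim_mult_int)
  ultimately show "(\<lambda>N. 1 / of_nat m * (\<Sum>k<m. e2pi (of_nat k * a) * (\<Sum>n\<in>{- int N..<int N}. ?t k n)))
      \<longlonglongrightarrow> of_real (of_nat m) powr (s - 1) * lerch_fun w s a c"
    by simp
qed

subsection \<open>The space of Lerch functions\<close>

definition lerch_dual_fun :: "complex \<Rightarrow> complex \<Rightarrow> real \<times> real \<Rightarrow> complex" where
  "lerch_dual_fun w s = (\<lambda>(a, c). e2pi (- (a * c)) * lerch_fun w (1 - s) (1 - c) a)"

lemma on_offgrid_cong: "(\<And>p. p \<in> offgrid \<Longrightarrow> f p = g p) \<Longrightarrow> on_offgrid f = on_offgrid g"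
  by (auto simp: on_offgrid_def)

lemma lerch_space_eq_span:
  "lerch_space s = module.span fun_scale
     {on_offgrid (\<lambda>(a, c). lerch_fun 1 s a c), on_offgrid (\<lambda>(a, c). lerch_fun (- 1) s a c),
      on_offgrid (lerch_dual_fun 1 s), on_offgrid (lerch_dual_fun (- 1) s)}"
proof -
  have "on_offgrid (\<lambda>(a, c). Lplus s a c) = on_offgrid (\<lambda>(a, c). lerch_fun 1 s a c)"
    "on_offgrid (\<lambda>(a, c). Lminus s a c) = on_offgrid (\<lambda>(a, c). lerch_fun (- 1) s a c)"
    "on_offgrid (\<lambda>(a, c). e2pi (- (a * c)) * Lplus (1 - s) (1 - c) a) = on_offgrid (lerch_dual_fun 1 s)"
    "on_offgrid (\<lambda>(a, c). e2pi (- (a * c)) * Lminus (1 - s) (1 - c) a) = on_offgrid (lerch_dual_fun (- 1) s)"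
    by (auto intro!: on_offgrid_cong simp: offgrid_def Lplus_eq Lminus_eq lerch_dual_fun_def)
  then show ?thesis by (simp only: lerch_space_def)
qed


lemma module_fun_scale: "module fun_scale"
  by (simp add: module_iff_vector_space vector_space_fun_scale)

lemma lerch_space_scale: "F \<in> lerch_space s \<Longrightarrow> (\<lambda>p. z * F p) \<in> lerch_space s"
  using module.span_scale[OF module_fun_scale] unfolding lerch_space_def fun_scale_def by blast

text \<open>The generator cases are stated for an arbitrary weight \<open>w\<close>, so that the
  functions with weights 1 and -1 share one argument.\<close>

lemma lerch_space_induct [consumes 1, case_names zero add scale direct dual]:
  assumes "F \<in> lerch_space s"
    and zero: "P (\<lambda>p. 0)"
    and add: "\<And>F G. P F \<Longrightarrow> P G \<Longrightarrow> P (\<lambda>p. F p + G p)"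
    and scale: "\<And>z F. P F \<Longrightarrow> P (\<lambda>p. z * F p)"
    and direct: "\<And>w. P (on_offgrid (\<lambda>(a, c). lerch_fun w s a c))"
    and dual: "\<And>w. P (on_offgrid (lerch_dual_fun w s))"
  shows "P F"
  using assms(1) unfolding lerch_space_eq_span
proof (induction rule: module.span_induct_alt[OF module_fun_scale, consumes 1, case_names base step])
  case base
  then show ?case using zero by (simp add: zero_fun_def)
next
  case (step z G H)
  then have "P G" using direct dual by auto
  then have "P (\<lambda>p. z * G p + H p)" using step by (intro add scale)
  then show ?case by (simp add: fun_scale_def plus_fun_def)
qed

lemma lerch_space_outside: "F \<in> lerch_space s \<Longrightarrow> p \<notin> offgrid \<Longrightarrow> F p = 0"
  by (induction rule: lerch_space_induct) (auto simp: on_offgrid_def)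

lemma open_offgrid: "open offgrid"
proof -
  have "closed (\<int> :: real set)" by (rule closed_Ints)
  then show ?thesis unfolding offgrid_def by (intro open_Times) auto
qed

lemma real_analytic2_on_lerch_dual_fun: "real_analytic2_on (lerch_dual_fun w s) offgrid"
proof -
  have "real_analytic2_on (\<lambda>(x, y). case (- 1 * x + 1, y) of (a, c) \<Rightarrow> lerch_fun w (1 - s) a c) offgrid"
    by (rule real_analytic2_on_affine_fst[OF real_analytic2_on_lerch_fun]) (auto simp: offgrid_def)
  then have "real_analytic2_on (\<lambda>(x, y). case (y, x) of (x, y) \<Rightarrow> case (- 1 * x + 1, y) of (a, c) \<Rightarrow> lerch_fun w (1 - s) a c) offgrid"
    by (rule real_analytic2_on_swap) (auto simp: offgrid_def)
  then have "real_analytic2_on (\<lambda>p. (case p of (x, y) \<Rightarrow> exp (- (2 * pi * \<i>) * of_real x * of_real y)) *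
     (case p of (x, y) \<Rightarrow> case (y, x) of (x, y) \<Rightarrow> case (- 1 * x + 1, y) of (a, c) \<Rightarrow> lerch_fun w (1 - s) a c)) offgrid"
    by (intro real_analytic2_on_mult real_analytic2_on_exp_mult)
  then show ?thesis
    by (simp add: lerch_dual_fun_def case_prod_unfold cis_conv_exp mult_ac)
qed

lemma lerch_space_real_analytic: "F \<in> lerch_space s \<Longrightarrow> real_analytic2_on F offgrid"
proof (induction rule: lerch_space_induct)
  case (direct w)
  show ?case
    by (rule real_analytic2_on_cong[OF real_analytic2_on_lerch_fun open_offgrid]) (auto simp: on_offgrid_def)
next
  case (dual w)
  show ?case
    by (rule real_analytic2_on_cong[OF real_analytic2_on_lerch_dual_fun open_offgrid]) (auto simp: on_offgrid_def)
qed (auto intro: real_analytic2_on_const real_analytic2_on_add real_analytic2_on_mult)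

section \<open>Quasi-periodicity and integrable majorants for the whole space\<close>

lemma add_of_int_Ints_iff [simp]: "x + of_int n \<in> \<int> \<longleftrightarrow> (x :: real) \<in> \<int>"
  using Ints_diff[of "x + of_int n" "of_int n"] Ints_add[of x "of_int n"] by auto

text \<open>For a dual generator the roles change: a shift of \<open>a\<close> moves the second
  argument of \<open>lerch_fun\<close>, and its factor cancels against the change of the twist; a
  shift of \<open>c\<close> moves the first argument, a true period, so only the twist changes. On
  the grid both identities read 0 = 0.\<close>

lemma lerch_space_quasi_periodic:
  assumes "F \<in> lerch_space s"
  shows "F (a + of_int n, c) = F (a, c) \<and> F (a, c + of_int n) = e2pi (- (of_int n * a)) * F (a, c)"
  using assms
proof (induction rule: lerch_space_induct)
  case (direct w)
  show ?case by (simp add: on_offgrid_def offgrid_def lerch_fun_quasi_periodic)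
next
  case (dual w)
  have "e2pi (- ((a + of_int n) * c)) * e2pi (- (of_int n * (1 - c))) = e2pi (- (a * c) + of_int (- n))"
    unfolding e2pi_mult by (rule arg_cong[of _ _ e2pi]) (simp add: algebra_simps)
  then have 1: "e2pi (- ((a + of_int n) * c)) * e2pi (- (of_int n * (1 - c))) = e2pi (- (a * c))"
    by (simp only: e2pi_add_int)
  have 2: "e2pi (- (a * (c + of_int n))) = e2pi (- (of_int n * a)) * e2pi (- (a * c))"
    unfolding e2pi_mult by (rule arg_cong[of _ _ e2pi]) (simp add: algebra_simps)
  have 3: "1 - (c + of_int n) = 1 - c + of_int (- n)" by simp
  have "lerch_dual_fun w s (a + of_int n, c) = lerch_dual_fun w s (a, c)"
    unfolding lerch_dual_fun_def case_prod_conv lerch_fun_quasi_periodic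
    unfolding 1[symmetric] by (rule mult.assoc[symmetric])
  moreover have "lerch_dual_fun w s (a, c + of_int n) = e2pi (- (of_int n * a)) * lerch_dual_fun w s (a, c)"
    unfolding lerch_dual_fun_def case_prod_conv 2 3 lerch_fun_quasi_periodic by (rule mult.assoc)
  ultimately show ?case by (simp add: on_offgrid_def offgrid_def)
qed (auto simp: algebra_simps)

text \<open>\<open>G\<close> is a class of majorants closed under sums and nonnegative multiples. It
  will consist of integrable functions of \<open>a\<close>, of \<open>c\<close>, or of sums of the
  two. The twist of a dual generator has modulus 1 and drops out.\<close>

lemma lerch_space_dominated:
  assumes "F \<in> lerch_space s"
    and zero: "(\<lambda>p. 0) \<in> G"
    and add: "\<And>g h. g \<in> G \<Longrightarrow> h \<in> G \<Longrightarrow> (\<lambda>p. g p + h p) \<in> G"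
    and scale: "\<And>r g. r \<ge> 0 \<Longrightarrow> g \<in> G \<Longrightarrow> (\<lambda>p. r * g p) \<in> G"
    and direct: "\<And>w. \<exists>g\<in>G. \<forall>(a, c)\<in>S. norm (lerch_fun w s a c) \<le> g (a, c)"
    and dual: "\<And>w. \<exists>g\<in>G. \<forall>(a, c)\<in>S. norm (lerch_fun w (1 - s) (1 - c) a) \<le> g (a, c)"
  shows "\<exists>g\<in>G. \<forall>p\<in>S. norm (F p) \<le> g p"
  using assms(1)
proof (induction rule: lerch_space_induct)
  case zero
  show ?case using assms(2) by (intro bexI[of _ "\<lambda>p. 0"]) auto
next
  case (add F1 F2)
  then obtain g1 g2 where g: "g1 \<in> G" "\<forall>p\<in>S. norm (F1 p) \<le> g1 p" "g2 \<in> G" "\<forall>p\<in>S. norm (F2 p) \<le> g2 p"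
    by (elim bexE)
  show ?case
    using g by (intro bexI[OF _ assms(3)[OF g(1,3)]]) (auto intro: norm_triangle_mono)
next
  case (scale z F)
  then obtain g where g: "g \<in> G" "\<forall>p\<in>S. norm (F p) \<le> g p" by (elim bexE)
  show ?case
    using g by (intro bexI[OF _ assms(4)[OF norm_ge_zero[of z] g(1)]]) (auto simp: norm_mult intro: mult_left_mono)
next
  case (direct w)
  obtain g where g: "g \<in> G" "\<forall>(a, c)\<in>S. norm (lerch_fun w s a c) \<le> g (a, c)" using assms(5)[of w] by (elim bexE)
  have "norm (on_offgrid (\<lambda>(a, c). lerch_fun w s a c) (a, c)) \<le> norm (lerch_fun w s a c)" for a c
    by (simp add: on_offgrid_def)
  then show ?case using g(2) by (intro bexI[OF _ g(1)]) (fastforce intro: order_trans)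
next
  case (dual w)
  obtain g where g: "g \<in> G" "\<forall>(a, c)\<in>S. norm (lerch_fun w (1 - s) (1 - c) a) \<le> g (a, c)" using assms(6)[of w] by (elim bexE)
  have "norm (on_offgrid (lerch_dual_fun w s) (a, c)) \<le> norm (lerch_fun w (1 - s) (1 - c) a)" for a c
    by (simp add: on_offgrid_def lerch_dual_fun_def norm_mult)
  then show ?case using g(2) by (intro bexI[OF _ g(1)]) (fastforce intro: order_trans)
qed

lemma set_integrable_const_unit: "set_integrable lborel {0<..<1 :: real} (\<lambda>x. r :: real)"
  unfolding set_integrable_def by (intro integrable_scaleR_left) simp

text \<open>With \<open>c\<close> in [\<mu>, 1 - \<mu>], a direct generator is singular only in
  \<open>a\<close>, with an exponent below 1 because Re s > 0. In a dual generator \<open>a\<close>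
  is the second argument, so the exponent is Re (1 - s), again below 1.\<close>

lemma lerch_space_dominated_fst:
  assumes F: "F \<in> lerch_space s" and s: "Re s > 0" and \<mu>: "\<mu> > 0"
  shows "\<exists>g. set_integrable lborel {0<..<1} g \<and> (\<forall>a\<in>{0<..<1}. \<forall>c\<in>{\<mu>..1 - \<mu>}. norm (F (a, c)) \<le> g a)"
proof -
  define G where "G = {(\<lambda>p. g (fst p)) :: real \<times> real \<Rightarrow> real | g. set_integrable lborel {0<..<1} g}"
  have G: "set_integrable lborel {0<..<1} g \<Longrightarrow> (\<lambda>p. g (fst p)) \<in> G" for g by (auto simp: G_def)
  have "\<exists>g\<in>G. \<forall>p\<in>{0<..<1} \<times> {\<mu>..1 - \<mu>}. norm (F p) \<le> g p"
  proof (rule lerch_space_dominated[OF F])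
    show "(\<lambda>p. 0) \<in> G" using G[OF set_integrable_const_unit] .
    show "(\<lambda>p. g p + h p) \<in> G" if gh: "g \<in> G" "h \<in> G" for g h
    proof -
      obtain g1 h1 where eq: "g = (\<lambda>p. g1 (fst p))" "h = (\<lambda>p. h1 (fst p))"
        and int: "set_integrable lborel {0<..<1} g1" "set_integrable lborel {0<..<1} h1"
        using gh unfolding G_def by blast
      show ?thesis unfolding eq using G[OF set_integral_add(1)[OF int]] .
    qed
    show "(\<lambda>p. r * g p) \<in> G" if g: "g \<in> G" for r g
    proof -
      obtain g1 where eq: "g = (\<lambda>p. g1 (fst p))" and int: "set_integrable lborel {0<..<1} g1"
        using g unfolding G_def by blast
      show ?thesis unfolding eq using int by (intro G set_integrable_mult_right)
    qed
    fix w
    show "\<exists>g\<in>G. \<forall>(a, c)\<in>{0<..<1} \<times> {\<mu>..1 - \<mu>}. norm (lerch_fun w s a c) \<le> g (a, c)"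
    proof -
      obtain C \<tau> where C: "C \<ge> 0" "\<tau> < 1" "\<And>a c. 0 < a \<Longrightarrow> a < 1 \<Longrightarrow> 0 < c \<Longrightarrow> c < 1 \<Longrightarrow>
          norm (lerch_fun w s a c) \<le> C * (edge_powr (Re s) c + edge_powr \<tau> a)"
        using lerch_fun_bound[OF s] by metis
      obtain M where M: "\<And>x. \<mu> \<le> x \<Longrightarrow> x \<le> 1 - \<mu> \<Longrightarrow> edge_powr (Re s) x \<le> M"
        using edge_powr_bounded[OF \<mu>] by metis
      have "set_integrable lborel {0<..<1} (\<lambda>a. C * (M + edge_powr \<tau> a))"
        by (intro set_integrable_mult_right set_integral_add(1) set_integrable_const_unit edge_powr_integrable C(2))
      moreover have "norm (lerch_fun w s a c) \<le> C * (M + edge_powr \<tau> a)" if "a \<in> {0<..<1}" "c \<in> {\<mu>..1 - \<mu>}" for a c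
        using that \<mu> C(1) M[of c] by (intro order_trans[OF C(3)] mult_left_mono add_right_mono) auto
      ultimately show ?thesis by (intro bexI[OF _ G]) auto
    qed
    show "\<exists>g\<in>G. \<forall>(a, c)\<in>{0<..<1} \<times> {\<mu>..1 - \<mu>}. norm (lerch_fun w (1 - s) (1 - c) a) \<le> g (a, c)"
    proof -
      obtain C where C: "C \<ge> 0" "\<And>a c. \<mu> \<le> a \<Longrightarrow> a \<le> 1 - \<mu> \<Longrightarrow> 0 < c \<Longrightarrow> c < 1 \<Longrightarrow>
          norm (lerch_fun w (1 - s) a c) \<le> C * (1 + edge_powr (Re (1 - s)) c)"
        using lerch_fun_bound_inner[OF \<mu>] by metis
      have "set_integrable lborel {0<..<1} (\<lambda>a. C * (1 + edge_powr (Re (1 - s)) a))"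
        using s by (intro set_integrable_mult_right set_integral_add(1) set_integrable_const_unit edge_powr_integrable) auto
      then show ?thesis using C(2) by (intro bexI[OF _ G]) auto
    qed
  qed
  then show ?thesis by (auto simp: G_def)
qed

text \<open>The mirror image: the direct generators need only the inner bound, with exponent Re s <
  1 in \<open>c\<close>, while the dual ones use the uniform bound at 1 - s.\<close>

lemma lerch_space_dominated_snd:
  assumes F: "F \<in> lerch_space s" and s: "Re s < 1" and \<mu>: "\<mu> > 0"
  shows "\<exists>g. set_integrable lborel {0<..<1} g \<and> (\<forall>c\<in>{0<..<1}. \<forall>a\<in>{\<mu>..1 - \<mu>}. norm (F (a, c)) \<le> g c)"
proof -
  define G where "G = {(\<lambda>p. g (snd p)) :: real \<times> real \<Rightarrow> real | g. set_integrable lborel {0<..<1} g}"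
  have G: "set_integrable lborel {0<..<1} g \<Longrightarrow> (\<lambda>p. g (snd p)) \<in> G" for g by (auto simp: G_def)
  have "\<exists>g\<in>G. \<forall>p\<in>{\<mu>..1 - \<mu>} \<times> {0<..<1}. norm (F p) \<le> g p"
  proof (rule lerch_space_dominated[OF F])
    show "(\<lambda>p. 0) \<in> G" using G[OF set_integrable_const_unit] .
    show "(\<lambda>p. g p + h p) \<in> G" if gh: "g \<in> G" "h \<in> G" for g h
    proof -
      obtain g1 h1 where eq: "g = (\<lambda>p. g1 (snd p))" "h = (\<lambda>p. h1 (snd p))"
        and int: "set_integrable lborel {0<..<1} g1" "set_integrable lborel {0<..<1} h1"
        using gh unfolding G_def by blast
      show ?thesis unfolding eq using G[OF set_integral_add(1)[OF int]] .
    qed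
    show "(\<lambda>p. r * g p) \<in> G" if g: "g \<in> G" for r g
    proof -
      obtain g1 where eq: "g = (\<lambda>p. g1 (snd p))" and int: "set_integrable lborel {0<..<1} g1"
        using g unfolding G_def by blast
      show ?thesis unfolding eq using int by (intro G set_integrable_mult_right)
    qed
    fix w
    show "\<exists>g\<in>G. \<forall>(a, c)\<in>{\<mu>..1 - \<mu>} \<times> {0<..<1}. norm (lerch_fun w s a c) \<le> g (a, c)"
    proof -
      obtain C where C: "C \<ge> 0" "\<And>a c. \<mu> \<le> a \<Longrightarrow> a \<le> 1 - \<mu> \<Longrightarrow> 0 < c \<Longrightarrow> c < 1 \<Longrightarrow>
          norm (lerch_fun w s a c) \<le> C * (1 + edge_powr (Re s) c)"
        using lerch_fun_bound_inner[OF \<mu>] by metis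
      have "set_integrable lborel {0<..<1} (\<lambda>c. C * (1 + edge_powr (Re s) c))"
        using s by (intro set_integrable_mult_right set_integral_add(1) set_integrable_const_unit edge_powr_integrable) auto
      then show ?thesis using C(2) by (intro bexI[OF _ G]) auto
    qed
    show "\<exists>g\<in>G. \<forall>(a, c)\<in>{\<mu>..1 - \<mu>} \<times> {0<..<1}. norm (lerch_fun w (1 - s) (1 - c) a) \<le> g (a, c)"
    proof -
      have s': "Re (1 - s) > 0" using s by simp
      obtain C \<tau> where C: "C \<ge> 0" "\<tau> < 1" "\<And>a c. 0 < a \<Longrightarrow> a < 1 \<Longrightarrow> 0 < c \<Longrightarrow> c < 1 \<Longrightarrow>
          norm (lerch_fun w (1 - s) a c) \<le> C * (edge_powr (Re (1 - s)) c + edge_powr \<tau> a)"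
        using lerch_fun_bound[OF s'] by metis
      obtain M where M: "\<And>x. \<mu> \<le> x \<Longrightarrow> x \<le> 1 - \<mu> \<Longrightarrow> edge_powr (Re (1 - s)) x \<le> M"
        using edge_powr_bounded[OF \<mu>] by metis
      have "set_integrable lborel {0<..<1} (\<lambda>c. C * (M + edge_powr \<tau> c))"
        by (intro set_integrable_mult_right set_integral_add(1) set_integrable_const_unit edge_powr_integrable C(2))
      moreover have "norm (lerch_fun w (1 - s) (1 - c) a) \<le> C * (M + edge_powr \<tau> c)" if "a \<in> {\<mu>..1 - \<mu>}" "c \<in> {0<..<1}" for a c
        using that \<mu> C(1) M[of a] edge_powr_reflect[of \<tau> c]
        by (intro order_trans[OF C(3)] mult_left_mono add_mono) auto
      ultimately show ?thesis by (intro bexI[OF _ G]) auto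
    qed
  qed
  then show ?thesis by (auto simp: G_def)
qed

text \<open>In the open strip both s and 1 - s have positive real part, so the uniform bound applies
  to all generators, and every exponent of an edge singularity is below 1.\<close>

lemma lerch_space_dominated_square:
  assumes F: "F \<in> lerch_space s" and s: "0 < Re s" "Re s < 1"
  shows "\<exists>g h. set_integrable lborel {0<..<1} g \<and> set_integrable lborel {0<..<1} h \<and>
    (\<forall>a\<in>{0<..<1}. \<forall>c\<in>{0<..<1}. norm (F (a, c)) \<le> g a + h c)"
proof -
  define G where "G = {(\<lambda>p. g (fst p) + h (snd p)) :: real \<times> real \<Rightarrow> real | g h.
    set_integrable lborel {0<..<1} g \<and> set_integrable lborel {0<..<1} h}"
  have G: "set_integrable lborel {0<..<1} g \<Longrightarrow> set_integrable lborel {0<..<1} h \<Longrightarrow> (\<lambda>p. g (fst p) + h (snd p)) \<in> G" for g h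
    by (auto simp: G_def)
  have "\<exists>g\<in>G. \<forall>p\<in>{0<..<1} \<times> {0<..<1}. norm (F p) \<le> g p"
  proof (rule lerch_space_dominated[OF F])
    show "(\<lambda>p. 0) \<in> G" using G[OF set_integrable_const_unit[of 0] set_integrable_const_unit[of 0]] by simp
    show "(\<lambda>p. g p + h p) \<in> G" if gh: "g \<in> G" "h \<in> G" for g h
    proof -
      obtain g1 g2 h1 h2 where eq: "g = (\<lambda>p. g1 (fst p) + g2 (snd p))" "h = (\<lambda>p. h1 (fst p) + h2 (snd p))"
        and int: "set_integrable lborel {0<..<1} g1" "set_integrable lborel {0<..<1} g2"
          "set_integrable lborel {0<..<1} h1" "set_integrable lborel {0<..<1} h2"
        using gh unfolding G_def by blast
      have "(\<lambda>p. (g1 (fst p) + h1 (fst p)) + (g2 (snd p) + h2 (snd p))) \<in> G"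
        using int by (intro G set_integral_add(1))
      then show ?thesis by (simp add: eq add_ac)
    qed
    show "(\<lambda>p. r * g p) \<in> G" if g: "g \<in> G" for r g
    proof -
      obtain g1 g2 where eq: "g = (\<lambda>p. g1 (fst p) + g2 (snd p))"
        and int: "set_integrable lborel {0<..<1} g1" "set_integrable lborel {0<..<1} g2"
        using g unfolding G_def by blast
      have "(\<lambda>p. r * g1 (fst p) + r * g2 (snd p)) \<in> G"
        using int by (intro G set_integrable_mult_right)
      then show ?thesis by (simp add: eq distrib_left)
    qed
    fix w
    show "\<exists>g\<in>G. \<forall>(a, c)\<in>{0<..<1} \<times> {0<..<1}. norm (lerch_fun w s a c) \<le> g (a, c)"
    proof -
      obtain C \<tau> where C: "C \<ge> 0" "\<tau> < 1" "\<And>a c. 0 < a \<Longrightarrow> a < 1 \<Longrightarrow> 0 < c \<Longrightarrow> c < 1 \<Longrightarrow>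
          norm (lerch_fun w s a c) \<le> C * (edge_powr (Re s) c + edge_powr \<tau> a)"
        using lerch_fun_bound[OF s(1)] by metis
      have int: "set_integrable lborel {0<..<1} (\<lambda>a. C * edge_powr \<tau> a)" "set_integrable lborel {0<..<1} (\<lambda>c. C * edge_powr (Re s) c)"
        using s C(2) by (auto intro!: set_integrable_mult_right edge_powr_integrable)
      then show ?thesis using C(3) by (intro bexI[OF _ G[OF int]]) (auto simp: distrib_left add.commute)
    qed
    show "\<exists>g\<in>G. \<forall>(a, c)\<in>{0<..<1} \<times> {0<..<1}. norm (lerch_fun w (1 - s) (1 - c) a) \<le> g (a, c)"
    proof -
      have s': "Re (1 - s) > 0" using s by simp
      obtain C \<tau> where C: "C \<ge> 0" "\<tau> < 1" "\<And>a c. 0 < a \<Longrightarrow> a < 1 \<Longrightarrow> 0 < c \<Longrightarrow> c < 1 \<Longrightarrow>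
          norm (lerch_fun w (1 - s) a c) \<le> C * (edge_powr (Re (1 - s)) c + edge_powr \<tau> a)"
        using lerch_fun_bound[OF s'] by metis
      have int: "set_integrable lborel {0<..<1} (\<lambda>a. C * edge_powr (Re (1 - s)) a)" "set_integrable lborel {0<..<1} (\<lambda>c. C * edge_powr \<tau> c)"
        using s C(2) by (auto intro!: set_integrable_mult_right edge_powr_integrable)
      have "norm (lerch_fun w (1 - s) (1 - c) a) \<le> C * edge_powr (Re (1 - s)) a + C * edge_powr \<tau> c"
        if "a \<in> {0<..<1}" "c \<in> {0<..<1}" for a c
        using C(3)[of "1 - c" a] that unfolding edge_powr_reflect distrib_left by simp
      then show ?thesis by (intro bexI[OF _ G[OF int]]) auto
    qed
  qed
  then show ?thesis by (auto simp: G_def) blast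
qed

section \<open>Integrability on the square and Fourier coefficients\<close>

lemma integrable_lborel_mult_fst_snd:
  fixes G H :: "real \<Rightarrow> real"
  assumes G: "integrable lborel G" and H: "integrable lborel H"
  shows "integrable lborel (\<lambda>p. G (fst p) * H (snd p))"
proof -
  have [measurable]: "G \<in> borel_measurable lborel" "H \<in> borel_measurable lborel" using G H by auto
  have "integrable (lborel \<Otimes>\<^sub>M lborel) (\<lambda>p. G (fst p) * H (snd p))"
  proof (rule lborel_pair.Fubini_integrable)
    show "(\<lambda>p. G (fst p) * H (snd p)) \<in> borel_measurable (lborel \<Otimes>\<^sub>M lborel)" by measurable
    show "integrable lborel (\<lambda>x. \<integral>y. norm (G (fst (x, y)) * H (snd (x, y))) \<partial>lborel)"
      using integrable_mult_left[OF integrable_norm[OF G], of "\<integral>y. norm (H y) \<partial>lborel"] by (simp add: abs_mult)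
    show "AE x in lborel. integrable lborel (\<lambda>y. G (fst (x, y)) * H (snd (x, y)))"
      using H by (auto intro!: AE_I2 integrable_mult_right)
  qed
  then show ?thesis by (simp only: lborel_prod)
qed

lemma lerch_space_continuous_on: "F \<in> lerch_space s \<Longrightarrow> continuous_on offgrid F"
  by (intro real_analytic2_on_imp_continuous_on lerch_space_real_analytic)

lemma unit_square_subset_offgrid: "{0<..<1} \<times> {0<..<1} \<subseteq> offgrid"
proof -
  have "x \<notin> \<int>" if "0 < x" "x < 1" for x :: real
    using that by (auto elim!: Ints_cases)
  then show ?thesis by (auto simp: offgrid_def)
qed

lemma lerch_space_integrable_square:
  assumes F: "F \<in> lerch_space s" and s: "0 < Re s" "Re s < 1"
  shows "set_integrable lborel ({0..1} \<times> {0..1}) F"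
proof -
  let ?I = "{0<..<1} :: real set" and ?Q = "{0<..<1} \<times> {0<..<1} :: (real \<times> real) set"
  obtain g h where g: "set_integrable lborel ?I g" and h: "set_integrable lborel ?I h"
    and bound: "\<forall>a\<in>?I. \<forall>c\<in>?I. norm (F (a, c)) \<le> g a + h c"
    using lerch_space_dominated_square[OF assms] by blast
  define D where "D = (\<lambda>p::real \<times> real. (indicator ?I (fst p) *\<^sub>R g (fst p)) * indicator ?I (snd p)
     + indicator ?I (fst p) * (indicator ?I (snd p) *\<^sub>R h (snd p)))"
  have I: "integrable lborel (indicat_real ?I)" by simp
  have D: "integrable lborel D"
    unfolding D_def using g h I unfolding set_integrable_def
    by (intro Bochner_Integration.integrable_add integrable_lborel_mult_fst_snd)
  have cont: "continuous_on ?Q F"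
    by (rule continuous_on_subset[OF lerch_space_continuous_on[OF F] unit_square_subset_offgrid])
  have "(\<lambda>p. indicator ?Q p *\<^sub>R F p) \<in> borel_measurable borel"
    by (rule borel_measurable_continuous_on_indicator[OF _ cont]) (intro borel_open open_Times open_greaterThanLessThan)
  then have "integrable lborel (\<lambda>p. indicator ?Q p *\<^sub>R F p)"
    by (intro Bochner_Integration.integrable_bound[OF D])
       (use bound in \<open>auto simp: D_def indicator_def intro!: AE_I2 order_trans[OF _ abs_ge_self]\<close>)
  \<comment> \<open>The closed and the open square differ only in grid points, where the extension
    by zero makes \<open>F\<close> vanish.\<close>
  moreover have "indicator ({0..1} \<times> {0..1}) p *\<^sub>R F p = indicator ?Q p *\<^sub>R F p" for p
  proof (cases "p \<in> offgrid")
    case True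
    then have "fst p \<noteq> 0" "fst p \<noteq> 1" "snd p \<noteq> 0" "snd p \<noteq> 1" by (auto simp: offgrid_def)
    then show ?thesis by (cases p) (auto simp: indicator_def)
  qed (simp add: lerch_space_outside[OF F])
  ultimately show ?thesis unfolding set_integrable_def by (simp only:)
qed

lemma lerch_space_fst:
  assumes F: "F \<in> lerch_space s" and s: "Re s > 0"
  shows "c \<notin> \<int> \<Longrightarrow> set_integrable lborel {0<..<1} (\<lambda>a. F (a, c))"
    and "continuous_on {0<..<1} (\<lambda>c. LINT a:{0<..<1}|lborel. F (a, c) * e2pi (- (of_int n * a)))"
proof -
  define f where "f = (\<lambda>k::int. \<lambda>(x, y). F (x, y) * e2pi (- (of_int k * x)))"
  have "continuous_on ({0<..<1} \<times> {0<..<1}) F"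
    by (rule continuous_on_subset[OF lerch_space_continuous_on[OF F] unit_square_subset_offgrid])
  then have cont: "continuous_on ({0<..<1} \<times> {0<..<1}) (f k)" for k
    unfolding f_def case_prod_unfold cis_conv_exp by (auto intro!: continuous_intros)
  have dom: "\<exists>g. set_integrable lborel {0<..<1} g \<and> (\<forall>x\<in>{0<..<1}. \<forall>y\<in>{\<mu>..1 - \<mu>}. norm (f k (x, y)) \<le> g x)" if "\<mu> > 0" for \<mu> k
    using lerch_space_dominated_fst[OF F s that] by (simp add: f_def norm_mult)
  show "continuous_on {0<..<1} (\<lambda>c. LINT a:{0<..<1}|lborel. F (a, c) * e2pi (- (of_int n * a)))"
    using integral_continuous_dominated(2)[OF cont dom, of n] by (simp add: f_def)
  assume c: "c \<notin> \<int>"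
  \<comment> \<open>The factor relating F(a, c) to F(a, frac c) is the Fourier character of index
    -\<lfloor>c\<rfloor> in \<open>a\<close>, so a general noninteger \<open>c\<close> reduces to
    the interval (0, 1) with a twisted integrand.\<close>
  have "set_integrable lborel {0<..<1} (\<lambda>a. f \<lfloor>c\<rfloor> (a, frac c))"
    using integral_continuous_dominated(1)[OF cont dom, of "frac c"] frac_bounds[of c] c by simp
  moreover have "f \<lfloor>c\<rfloor> (a, frac c) = F (a, c)" for a
    using lerch_space_quasi_periodic[OF F, of a 0 "frac c"] lerch_space_quasi_periodic[OF F, of a "\<lfloor>c\<rfloor>" "frac c"]
    by (simp add: f_def frac_def mult.commute)
  ultimately show "set_integrable lborel {0<..<1} (\<lambda>a. F (a, c))" by simp
qed

lemma lerch_space_snd: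
  assumes F: "F \<in> lerch_space s" and s: "Re s < 1"
  shows "a \<notin> \<int> \<Longrightarrow> set_integrable lborel {0<..<1} (\<lambda>c. e2pi (a * c) * F (a, c))"
    and "continuous_on {0<..<1} (\<lambda>a. LINT c:{0<..<1}|lborel. e2pi (a * c) * F (a, c) * e2pi (- (of_int n * c)))"
proof -
  define f where "f = (\<lambda>k::int. \<lambda>(x, y). e2pi (y * x) * F (y, x) * e2pi (- (of_int k * x)))"
  have "continuous_on ({0<..<1} \<times> {0<..<1}) F"
    by (rule continuous_on_subset[OF lerch_space_continuous_on[OF F] unit_square_subset_offgrid])
  then have "continuous_on ({0<..<1} \<times> {0<..<1}) (\<lambda>p. F (snd p, fst p))"
    by (rule continuous_on_compose2) (auto intro!: continuous_intros)
  then have cont: "continuous_on ({0<..<1} \<times> {0<..<1}) (f k)" for k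
    unfolding f_def case_prod_unfold cis_conv_exp by (auto intro!: continuous_intros)
  have dom: "\<exists>g. set_integrable lborel {0<..<1} g \<and> (\<forall>x\<in>{0<..<1}. \<forall>y\<in>{\<mu>..1 - \<mu>}. norm (f k (x, y)) \<le> g x)" if "\<mu> > 0" for \<mu> k
    using lerch_space_dominated_snd[OF F s that] by (simp add: f_def norm_mult)
  show "continuous_on {0<..<1} (\<lambda>a. LINT c:{0<..<1}|lborel. e2pi (a * c) * F (a, c) * e2pi (- (of_int n * c)))"
    using integral_continuous_dominated(2)[OF cont dom, of n] by (simp add: f_def)
  assume a: "a \<notin> \<int>"
  \<comment> \<open>\<open>F\<close> itself has period 1 in \<open>a\<close>; the character in
    \<open>c\<close> now comes from the factor \<open>e2pi (a * c)\<close>, which is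
    \<open>e2pi (frac a * c)\<close> times \<open>e2pi\<close> of \<lfloor>a\<rfloor> c.\<close>
  have "set_integrable lborel {0<..<1} (\<lambda>c. f (- \<lfloor>a\<rfloor>) (c, frac a))"
    using integral_continuous_dominated(1)[OF cont dom, of "frac a"] frac_bounds[of a] a by simp
  moreover have "f (- \<lfloor>a\<rfloor>) (c, frac a) = e2pi (a * c) * F (a, c)" for c
  proof -
    have "e2pi (frac a * c) * e2pi (- (of_int (- \<lfloor>a\<rfloor>) * c)) = e2pi (a * c)"
      unfolding e2pi_mult by (rule arg_cong[of _ _ e2pi]) (simp add: frac_def algebra_simps)
    moreover have "F (frac a, c) = F (a, c)"
      using lerch_space_quasi_periodic[OF F, of "frac a" "\<lfloor>a\<rfloor>" c] by (simp add: frac_def)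
    ultimately show ?thesis by (simp add: f_def mult.commute mult.left_commute del: of_int_minus)
  qed
  ultimately show "set_integrable lborel {0<..<1} (\<lambda>c. e2pi (a * c) * F (a, c))" by simp
qed

section \<open>Eigenvalues of the Hecke operators on the whole space\<close>

lemma lerch_space_T:
  assumes F: "F \<in> lerch_space s" and s: "0 < Re s" "Re s < 1" and m: "m \<ge> 1" and p: "p \<in> T_domain m"
  shows "hecke_T m F p = of_real (of_nat m) powr (- s) * F p"
  using F
proof (induction rule: lerch_space_induct)
  case zero
  then show ?case by (simp add: hecke_T_def case_prod_unfold)
next
  case (add F G)
  then show ?case by (simp add: hecke_T_def case_prod_unfold sum.distrib distrib_left)
next
  case (scale z F)
  have "hecke_T m (\<lambda>p. z * F p) p = z * hecke_T m F p"
    by (simp only: hecke_T_def case_prod_unfold sum_distrib_left mult_ac)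
  then show ?case using scale by (simp add: mult.left_commute)
next
  case (direct w)
  obtain a c where p': "p = (a, c)" "a \<notin> \<int>" "of_nat m * c \<notin> \<int>" using p by (auto simp: T_domain_def)
  show ?case
    using lerch_fun_T[OF m p'(2,3) s(1), of w] mult_of_nat_notin_Ints[OF p'(3)] p' divide_add_notin_Ints[OF m p'(2)]
    by (simp add: hecke_T_def on_offgrid_def offgrid_def)
next
  case (dual w)
  obtain a c where p': "p = (a, c)" "a \<notin> \<int>" "of_nat m * c \<notin> \<int>" using p by (auto simp: T_domain_def)
  have c: "c \<notin> \<int>" using p' mult_of_nat_notin_Ints by blast
  have mc: "of_nat m * (1 - c) \<notin> \<int>"
    using p'(3) Ints_diff[of "of_nat m" "of_nat m * (1 - c)"] by (auto simp: algebra_simps)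
  have s': "Re (1 - s) > 0" using s by simp
  \<comment> \<open>The summand of \<open>hecke_S m\<close> at the point (1 - c, a) for the
    parameter 1 - s. It arises because \<open>e2pi\<close> takes the same value at -k c and k (1 -
    c), and because 1 - m c differs from m (1 - c) by the integer 1 - m, a period of the first
    argument.\<close>
  let ?f = "\<lambda>k. e2pi (of_nat k * (1 - c)) * lerch_fun w (1 - s) (of_nat m * (1 - c)) ((a + of_nat k) / of_nat m)"
  have eq: "lerch_dual_fun w s ((a + of_nat k) / of_nat m, of_nat m * c) = e2pi (- (a * c)) * ?f k" for k
  proof -
    have "(a + of_nat k) / of_nat m * (of_nat m * c) = (a + of_nat k) * c" using m by simp
    then have "e2pi (- ((a + of_nat k) / of_nat m * (of_nat m * c))) = e2pi (- (a * c) + of_nat k * (1 - c) + of_int (- int k))"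
      by (intro arg_cong[of _ _ e2pi]) (simp add: algebra_simps)
    then have 1: "e2pi (- ((a + of_nat k) / of_nat m * (of_nat m * c))) = e2pi (- (a * c)) * e2pi (of_nat k * (1 - c))"
      by (simp only: e2pi_add_int e2pi_mult)
    have 2: "1 - of_nat m * c = of_nat m * (1 - c) + of_int (1 - int m)" by (simp add: algebra_simps)
    show ?thesis
      unfolding lerch_dual_fun_def case_prod_conv 1 2 lerch_fun_quasi_periodic by (rule mult.assoc)
  qed
  have "hecke_T m (lerch_dual_fun w s) p = 1 / of_nat m * (\<Sum>k<m. e2pi (- (a * c)) * ?f k)"
    unfolding hecke_T_def p'(1) case_prod_conv eq ..
  also have "\<dots> = e2pi (- (a * c)) * (1 / of_nat m * (\<Sum>k<m. ?f k))"
    by (simp only: sum_distrib_left[symmetric] mult.left_commute)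
  also have "\<dots> = of_real (of_nat m) powr (- s) * lerch_dual_fun w s p"
    unfolding lerch_fun_S[OF m mc p'(2) s'] by (simp add: lerch_dual_fun_def p'(1))
  finally show ?case
    using p' c divide_add_notin_Ints[OF m p'(2)] by (simp add: hecke_T_def on_offgrid_def offgrid_def)
qed

lemma sum_lessThan_reflect: "(\<Sum>k<m. f (m - Suc k)) = (\<Sum>k<m. f k)" for f :: "nat \<Rightarrow> complex"
  by (rule sum.nat_diff_reindex)

text \<open>On a dual generator the weight \<open>e2pi (of_nat k * a)\<close> cancels against the
  twist, and 1 - (c + k)/m = (1 - c + (m - 1 - k))/m. What remains is the sum of
  \<open>hecke_T m\<close> at (1 - c, a) for the parameter 1 - s, in reverse order.\<close>

lemma lerch_space_S:
  assumes F: "F \<in> lerch_space s" and s: "0 < Re s" "Re s < 1" and m: "m \<ge> 1" and p: "p \<in> S_domain m"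
  shows "hecke_S m F p = of_real (of_nat m) powr (s - 1) * F p"
  using F
proof (induction rule: lerch_space_induct)
  case zero
  then show ?case by (simp add: hecke_S_def case_prod_unfold)
next
  case (add F G)
  then show ?case by (simp add: hecke_S_def case_prod_unfold sum.distrib distrib_left)
next
  case (scale z F)
  have "hecke_S m (\<lambda>p. z * F p) p = z * hecke_S m F p"
    by (simp only: hecke_S_def case_prod_unfold sum_distrib_left mult_ac)
  then show ?case using scale by (simp add: mult.left_commute)
next
  case (direct w)
  obtain a c where p': "p = (a, c)" "of_nat m * a \<notin> \<int>" "c \<notin> \<int>" using p by (auto simp: S_domain_def)
  show ?case
    using lerch_fun_S[OF m p'(2,3) s(1), of w] mult_of_nat_notin_Ints[OF p'(2)] p' divide_add_notin_Ints[OF m p'(3)]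
    by (simp add: hecke_S_def on_offgrid_def offgrid_def)
next
  case (dual w)
  obtain a c where p': "p = (a, c)" "of_nat m * a \<notin> \<int>" "c \<notin> \<int>" using p by (auto simp: S_domain_def)
  have a: "a \<notin> \<int>" using p' mult_of_nat_notin_Ints by blast
  have c: "1 - c \<notin> \<int>" using p' by simp
  have s': "Re (1 - s) > 0" using s by simp
  let ?f = "\<lambda>k. lerch_fun w (1 - s) ((1 - c + of_nat k) / of_nat m) (of_nat m * a)"
  have "e2pi (of_nat k * a) * lerch_dual_fun w s (of_nat m * a, (c + of_nat k) / of_nat m) = e2pi (- (a * c)) * ?f (m - Suc k)"
    if k: "k < m" for k
  proof -
    have 1: "e2pi (of_nat k * a) * e2pi (- (of_nat m * a * ((c + of_nat k) / of_nat m))) = e2pi (- (a * c))"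
    proof -
      have "of_nat m * a * ((c + of_nat k) / of_nat m) = a * (c + of_nat k)" using m by simp
      then show ?thesis unfolding e2pi_mult by (intro arg_cong[of _ _ e2pi]) (simp add: algebra_simps)
    qed
    have 2: "1 - (c + of_nat k) / of_nat m = (1 - c + of_nat (m - Suc k)) / of_nat m"
      using m k by (simp add: field_simps of_nat_diff)
    show ?thesis
      unfolding lerch_dual_fun_def case_prod_conv 2 1[symmetric] by (rule mult.assoc[symmetric])
  qed
  then have "hecke_S m (lerch_dual_fun w s) p = 1 / of_nat m * (\<Sum>k<m. e2pi (- (a * c)) * ?f (m - Suc k))"
    by (simp add: hecke_S_def p'(1))
  also have "\<dots> = e2pi (- (a * c)) * (1 / of_nat m * (\<Sum>k<m. ?f (m - Suc k)))"
    by (simp only: sum_distrib_left[symmetric] mult.left_commute)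
  also have "\<dots> = of_real (of_nat m) powr (s - 1) * lerch_dual_fun w s p"
    unfolding sum_lessThan_reflect[of ?f] lerch_fun_T[OF m c p'(2) s']
    by (simp add: lerch_dual_fun_def p'(1))
  finally show ?case
    using p' a divide_add_notin_Ints[OF m p'(3)] by (simp add: hecke_S_def on_offgrid_def offgrid_def)
qed

text \<open>The point 1 + m (c - 1) is m c shifted by the integer 1 - m, and the factor produced by
  this shift cancels the weight up to \<open>e2pi (of_nat k)\<close>, which is 1. The sums agree
  term by term at every point.\<close>

lemma lerch_space_T_dual_eq:
  assumes F: "F \<in> lerch_space s" and m: "m \<ge> 1"
  shows "hecke_T_dual m F p = hecke_T m F p"
proof -
  obtain a c where p: "p = (a, c)" by (cases p)
  have "e2pi (((1 - of_nat m) * a + of_nat k) / of_nat m) * F ((a + of_nat k) / of_nat m, 1 + of_nat m * (c - 1)) =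
      F ((a + of_nat k) / of_nat m, of_nat m * c)" for k
  proof -
    have 1: "1 + of_nat m * (c - 1) = of_nat m * c + of_int (1 - int m)" by (simp add: algebra_simps)
    have "e2pi (((1 - of_nat m) * a + of_nat k) / of_nat m) * e2pi (- (of_int (1 - int m) * ((a + of_nat k) / of_nat m))) = e2pi (of_nat k)"
      unfolding e2pi_mult using m by (intro arg_cong[of _ _ e2pi]) (simp add: field_simps)
    then have 2: "e2pi (((1 - of_nat m) * a + of_nat k) / of_nat m) * e2pi (- (of_int (1 - int m) * ((a + of_nat k) / of_nat m))) = 1"
      unfolding e2pi_of_nat .
    show ?thesis
      unfolding 1 lerch_space_quasi_periodic[OF F, THEN conjunct2] mult.assoc[symmetric] 2 by (rule mult_1)
  qed
  then show ?thesis by (simp only: hecke_T_dual_def hecke_T_def p case_prod_conv)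
qed

text \<open>The point 1 + m (a - 1) differs from m a by a period, and replacing k by m - 1 - k
  matches weights and evaluation points; the two sums differ only in their order.\<close>

lemma lerch_space_S_dual_eq:
  assumes F: "F \<in> lerch_space s" and m: "m \<ge> 1"
  shows "hecke_S_dual m F p = hecke_S m F p"
proof -
  obtain a c where p: "p = (a, c)" by (cases p)
  let ?f = "\<lambda>k. e2pi (of_nat k * a) * F (of_nat m * a, (c + of_nat k) / of_nat m)"
  have "e2pi ((of_nat m - (of_nat k + 1)) * a) * F (1 + of_nat m * (a - 1), (c + of_nat m - (of_nat k + 1)) / of_nat m) = ?f (m - Suc k)"
    if k: "k < m" for k
  proof -
    have 1: "1 + of_nat m * (a - 1) = of_nat m * a + of_int (1 - int m)" by (simp add: algebra_simps)
    have 2: "of_nat m - (of_nat k + 1) = (of_nat (m - Suc k) :: real)"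
      "c + of_nat m - (of_nat k + 1) = c + of_nat (m - Suc k)"
      using k by (simp_all add: of_nat_diff)
    show ?thesis unfolding 1 2 lerch_space_quasi_periodic[OF F, THEN conjunct1] ..
  qed
  then have "hecke_S_dual m F p = 1 / of_nat m * (\<Sum>k<m. ?f (m - Suc k))"
    by (simp add: hecke_S_dual_def p)
  also have "\<dots> = hecke_S m F p"
    unfolding sum_lessThan_reflect[of ?f] by (simp add: hecke_S_def p)
  finally show ?thesis .
qed

lemma invariant_underI:
  assumes "\<And>F p. F \<in> lerch_space s \<Longrightarrow> p \<in> D \<Longrightarrow> H F p = z * F p"
  shows "invariant_under (lerch_space s) H D"
  unfolding invariant_under_def
proof
  fix F assume F: "F \<in> lerch_space s"
  show "\<exists>G\<in>lerch_space s. \<forall>p\<in>D. H F p = G p"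
    using assms[OF F] by (intro bexI[OF _ lerch_space_scale[OF F, of z]]) simp
qed

theorem theorem2p3:
  fixes s :: complex
  shows
   "(\<forall>F\<in>lerch_space s. real_analytic2_on F offgrid) \<and>
    (\<forall>F\<in>lerch_space s. \<forall>a c. a \<notin> \<int> \<and> c \<notin> \<int> \<longrightarrow>
        F (a + 1, c) = F (a, c) \<and> F (a, c + 1) = e2pi (- a) * F (a, c)) \<and>
    (Re s > 0 \<longrightarrow> (\<forall>F\<in>lerch_space s.
        (\<forall>c. c \<notin> \<int> \<longrightarrow> set_integrable lborel {0<..<1} (\<lambda>a. F (a, c))) \<and>
        (\<forall>n::int. continuous_on {0<..<1}
           (\<lambda>c. LINT a:{0<..<1}|lborel. F (a, c) * e2pi (- (of_int n * a)))))) \<and>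
    (Re s < 1 \<longrightarrow> (\<forall>F\<in>lerch_space s.
        (\<forall>a. a \<notin> \<int> \<longrightarrow> set_integrable lborel {0<..<1} (\<lambda>c. e2pi (a * c) * F (a, c))) \<and>
        (\<forall>n::int. continuous_on {0<..<1}
           (\<lambda>a. LINT c:{0<..<1}|lborel. e2pi (a * c) * F (a, c) * e2pi (- (of_int n * c)))))) \<and>
    (0 < Re s \<and> Re s < 1 \<longrightarrow>
        (\<forall>F\<in>lerch_space s. set_integrable lborel ({0..1} \<times> {0..1}) F) \<and>
        (\<forall>m\<ge>1. invariant_under (lerch_space s) (hecke_T m) (T_domain m) \<and>
                invariant_under (lerch_space s) (hecke_S m) (S_domain m) \<and>
                invariant_under (lerch_space s) (hecke_T_dual m) (T_domain m) \<and>
                invariant_under (lerch_space s) (hecke_S_dual m) (S_domain m)))"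
proof (intro conjI ballI allI impI; (elim conjE)?)
  fix F a c assume F: "F \<in> lerch_space s"
  show "F (a + 1, c) = F (a, c)" "F (a, c + 1) = e2pi (- a) * F (a, c)"
    using lerch_space_quasi_periodic[OF F, of a 1 c] by simp_all
next
  fix m :: nat assume m: "m \<ge> 1" and s: "0 < Re s" "Re s < 1"
  have "hecke_T m F p = of_real (of_nat m) powr (- s) * F p" if "F \<in> lerch_space s" "p \<in> T_domain m" for F p
    by (rule lerch_space_T[OF that(1) s m that(2)])
  then show "invariant_under (lerch_space s) (hecke_T m) (T_domain m)" by (rule invariant_underI)
  have "hecke_S m F p = of_real (of_nat m) powr (s - 1) * F p" if "F \<in> lerch_space s" "p \<in> S_domain m" for F p
    by (rule lerch_space_S[OF that(1) s m that(2)])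
  then show "invariant_under (lerch_space s) (hecke_S m) (S_domain m)" by (rule invariant_underI)
  have "hecke_T_dual m F p = of_real (of_nat m) powr (- s) * F p" if "F \<in> lerch_space s" "p \<in> T_domain m" for F p
    by (rule trans[OF lerch_space_T_dual_eq[OF that(1) m] lerch_space_T[OF that(1) s m that(2)]])
  then show "invariant_under (lerch_space s) (hecke_T_dual m) (T_domain m)" by (rule invariant_underI)
  have "hecke_S_dual m F p = of_real (of_nat m) powr (s - 1) * F p" if "F \<in> lerch_space s" "p \<in> S_domain m" for F p
    by (rule trans[OF lerch_space_S_dual_eq[OF that(1) m] lerch_space_S[OF that(1) s m that(2)]])
  then show "invariant_under (lerch_space s) (hecke_S_dual m) (S_domain m)" by (rule invariant_underI)
qed (rule lerch_space_real_analytic lerch_space_fst lerch_space_snd lerch_space_integrable_square; assumption)+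

end
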